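(* Let $q>3$, $\alpha\in[1,2]$, $\gamma\in[\frac12,1)$, $0<\eta_1<\eta_2<1$, and let $f_0\in C^2(\mathbb{T}\times\mathbb{R})$ satisfy $\|f_0\|_{W^{2,\infty}_q}<\infty$, $\int_{\mathbb T}\int_{\mathbb R}f_0\,dv\,dx=1$ and $f_0(x,v)\ge C_0e^{-|v|^\alpha}$ for some $C_0>0$. Then there exist positive constants $C_M$, $C_{\mathcal M}$ depending only on $q$ such that, with $C_{\mathbb{E},1}$, $C_{\mathbb{E},2}$, $l$, $r_{\Delta x}$, $r_{\Delta v}$ and the stability estimate $\mathcal A^n$ defined as in the context, the following holds. If $V_M=C_{\mathbb{E},1}(\Delta v)^{-\gamma}$ and $$\Delta x<r_{\Delta x},\qquad \Delta v<r_{\Delta v},\qquad \eta_1\frac{\Delta v}{C_{\mathbb{E},1}}<\Delta t<\eta_2\frac{\Delta v}{C_{\mathbb{E},1}},$$ then the discrete solution $f^n_{i,j}$ of the scheme satisfies $\mathcal A^n$ for all time levels $n\ge0$ (i.e. $0\le n\le N_t$).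
   Context: **Norms.** $\mathbb T=[0,1]$ periodic. $\|g\|_{L^\infty_q}=\sup_{x,v}|g(x,v)|(1+|v|)^q$, $\|g\|_{W^{N,\infty}_q}=\sum_{a+b\le N}\|\partial_x^a\partial_v^bg\|_{L^\infty_q}$; for grid sequences $\|a^n\|_{L^\infty_q}=\sup_{i,j}|a^n_{i,j}|(1+|v_j|)^q$, $\|b^n\|_{L^\infty_x}=\sup_i|b^n_i|$. **Scheme** (for the Vlasov-Poisson-BGK equation $\partial_tf+v\partial_xf+\mathbb E\partial_vf=\frac1\varepsilon(\mathcal M(f)-f)$, $\partial_x\mathbb E=\int f\,dv-1$, with $\varepsilon>0$ fixed and final time $T^f>0$). Grid: $t^n=n\Delta t$ ($0\le n\le N_t$, $N_t\Delta t=T^f$), $x_i=i\Delta x$ ($N_x\Delta x=1$), $v_j=j\Delta v$ ($|j|\le N_v$, $N_v\Delta v=V_M$). Sums over $i,k$ run over $0,\dots,N_x-1$, sums over $j$ over $-N_v,\dots,N_v$. Write $a^+=\max(a,0)$, $a^-=-\min(a,0)$. Initial data: $f^0_{i,j}=f_0(x_i,v_j)$. Ghost values (Neumann): $f^n_{i,\pm(N_v+1)}=f^n_{i,\pm N_v}$. Field: $\mathbb E^n_i=\sum_kK(x_i,y_k)(\rho^n_k-1)\Delta x$, where $y_k=x_k$, $\rho^n_k=\sum_jf^n_{k,j}\Delta v$, $K(x,y)=y$ for $0\le y\le x$ and $K(x,y)=y-1$ for $x<y\le1$; everything is $N_x$-periodic in the space index. Put $$\tilde f^n_{i,j}=\Big(1-\tfrac{\Delta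 t}{\Delta x}|v_j|-\tfrac{\Delta t}{\Delta v}|\mathbb E^n_i|\Big)f^n_{i,j}+\tfrac{\Delta t}{\Delta x}\big(v_j^+f^n_{i-1,j}+v_j^-f^n_{i+1,j}\big)+\tfrac{\Delta t}{\Delta v}\big((\mathbb E^n_i)^+f^n_{i,j-1}+(\mathbb E^n_i)^-f^n_{i,j+1}\big),$$ $(\tilde\rho^n_i,\tilde\rho^n_i\tilde U^n_i,\tilde\rho^n_i\tilde T^n_i)=\sum_j\tilde f^n_{i,j}(1,v_j,|v_j-\tilde U^n_i|^2)\Delta v$, $\mathcal M(\tilde f^n_{i,j})=\frac{\tilde\rho^n_i}{\sqrt{2\pi\tilde T^n_i}}\exp(-\frac{|v_j-\tilde U^n_i|^2}{2\tilde T^n_i})$, and $f^{n+1}_{i,j}=\frac{\varepsilon\tilde f^n_{i,j}+\Delta t\,\mathcal M(\tilde f^n_{i,j})}{\varepsilon+\Delta t}$. **Constants.** $D_{\alpha',\beta'}=\int_{\mathbb R}e^{-|v|^{\alpha'}-\beta'|v|}dv$, $\tilde D_{\alpha',\beta'}=\sup_v(1+|v|)^qe^{-|v|^{\alpha'}-\beta'|v|}$, $\bar D_{q-m}=\int_{\mathbb R}(1+|v|)^{m-q}dv$; $C_{\mathbb E,1}=(2+T^f)e^{T^f/\varepsilon}+1$, $C_{\mathbb E,2}=(2^q-1)C_{\mathbb E,1}$. Abbreviate $D=D_{\alpha,2\alpha C_{\mathbb E,1}T^f}$, $\tilde D=\tilde D_{\alpha,2\alpha C_{\mathbb E,1}T^f}$,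 $S=2\alpha C_{\mathbb E,1}+\frac{\alpha C_{\mathbb E,1}^2(T^f+1)}{\eta_1}$, $F=\|f_0\|_{L^\infty_q}$, $Q=S+C_{\mathbb E,2}+\frac{C_{\mathcal M}}{\varepsilon}$. Then $a_1=\frac{(C_0D)^{5/9}}{2^{16/9}(1+C_{\mathbb E,2})^{5/9}C_M^{2/9}F^{5/9}}e^{-\frac59QT^f}$; $a_2=\Big\{\frac{C_0^2D\tilde D}{4(q-3)\bar D_{q-2}(C_0D+8)(1+C_{\mathbb E,2})F}\Big\}^{\frac1{q-1}}\exp\big(-\frac{1}{q-1}(2S+C_{\mathbb E,2}+\frac{C_{\mathcal M}+1}{\varepsilon})T^f\big)$; $a_3=\frac{(C_0D)^{\theta}}{2^{\frac{4q+12}{3q+3}}(1+C_{\mathbb E,2})^{\theta}C_M^{\frac{2q}{3q+3}}F^{\theta}}e^{-\theta QT^f}$ with $\theta=\frac{2q+3}{3q+3}$; $a_4=\Big(\frac{C_0D}{4(1+C_{\mathbb E,2})C_MF}e^{-QT^f}\Big)^{2/3}$; $a_5=\Big(2C_{\mathbb E,1}^{1-q}(1+C_{\mathbb E,2})e^{(C_{\mathbb E,2}+\frac{2(C_{\mathcal M}-1)}{\varepsilon})T^f}F\Big)^{-\frac1{q\gamma}}$. $l>0$ is chosen so small that $\Delta x,\Delta v<l$ implies, for $(\alpha',\beta')\in\{(\alpha,2\alpha C_{\mathbb E,1}T^f),(2,0)\}$ and $m\in\{0,1,2\}$: $\frac12D_{\alpha',\beta'}\le\sum_je^{-|v_j|^{\alpha'}-\beta'|v_j|}\Delta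 v\le2D_{\alpha',\beta'}$; $\frac12\tilde D_{\alpha',\beta'}\le\sup_j(1+|v_j|)^qe^{-|v_j|^{\alpha'}-\beta'|v_j|}\le2\tilde D_{\alpha',\beta'}$; $\frac12\bar D_{q-m}\le\sum_j\frac{\Delta v}{(1+|v_j|)^{q-m}}\le2\bar D_{q-m}$; $\sum_{i,j}f_0(x_i,v_j)\Delta x\Delta v\le2$. Finally $r_{\Delta x}=\min\{l,\frac1{4\alpha C_{\mathbb E,1}},\frac12\}$, $r_{\Delta v}=\min\big\{a_1,a_2,a_3,l,l\sqrt{2a_4},a_5,(\frac{1-\eta_2}{\eta_2}\Delta x)^{\frac1{1-\gamma}},\frac1{4\alpha\{C_{\mathbb E,1}(T^f+1)+1\}},\frac12\big\}$ (so $r_{\Delta v}$ depends on $\Delta x$). **Stability estimate $\mathcal A^n$.** $f^n_{i,j}$ satisfies $\mathcal A^n$ if all six hold: $(A^n_1)$ $\sum_{i,j}f^n_{i,j}\Delta x\Delta v\le(2+T^f)e^{T^f/\varepsilon}$; $(A^n_2)$ $\|\mathbb E^n\|_{L^\infty_x}\le C_{\mathbb E,1}$; $(A^n_3)$ $\tilde f^n_{i,j}\ge\frac{C_0}2e^{-(S+\frac1\varepsilon)T^f}e^{-|v_j|^\alpha}e^{-2\alpha C_{\mathbb E,1}T^f|v_j|}$ for all $i,j$; $(A^n_4)$ $\|\tilde f^n\|_{L^\infty_q}\le(1+C_{\mathbb E,2})e^{(C_{\mathbb E,2}+\frac{C_{\mathcal M}-1}\varepsilon)T^f}F$; $(A^n_5)$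 $\tilde\rho^n_i\ge\frac{C_0D}4e^{-(S+\frac1\varepsilon)T^f}$ and $\tilde T^n_i\ge\Big(\frac{C_0D}{4(1+C_{\mathbb E,2})C_MF}e^{-QT^f}\Big)^{2/3}$ for all $i$; $(A^n_6)$ $\|\tilde\rho^n\|_{L^\infty_x},\|\tilde U^n\|_{L^\infty_x},\|\tilde T^n\|_{L^\infty_x}\le\bar D_{q-2}\big(1+\frac8{C_0D}\big)(1+C_{\mathbb E,2})e^{QT^f}F$. *)

theory Defs
  imports "HOL-Analysis.Analysis"
begin

section \<open>Function spaces on the phase space\<close>

text \<open>A function on the torus times the real line is a function of \<open>(x, v)\<close> on the whole plane
  that is 1-periodic in \<open>x\<close>.\<close>

definition periodic_x :: "(real \<Rightarrow> real \<Rightarrow> real) \<Rightarrow> bool" where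
  "periodic_x g \<longleftrightarrow> (\<forall>x v. g (x + 1) v = g x v)"

definition deriv_x :: "(real \<Rightarrow> real \<Rightarrow> real) \<Rightarrow> real \<Rightarrow> real \<Rightarrow> real" where
  "deriv_x g x v = deriv (\<lambda>s. g s v) x"

definition deriv_v :: "(real \<Rightarrow> real \<Rightarrow> real) \<Rightarrow> real \<Rightarrow> real \<Rightarrow> real" where
  "deriv_v g x v = deriv (\<lambda>s. g x s) v"

text \<open>\<open>C_k k g\<close>: all partial derivatives up to order \<open>k\<close>, in any order of differentiation, exist
  everywhere, and those of order \<open>k\<close> are jointly continuous (hence so are the lower ones).\<close>

fun C_k :: "nat \<Rightarrow> (real \<Rightarrow> real \<Rightarrow> real) \<Rightarrow> bool" where
  "C_k 0 g \<longleftrightarrow> continuous_on UNIV (\<lambda>p. g (fst p) (snd p))"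
| "C_k (Suc k) g \<longleftrightarrow>
     (\<forall>x v. (\<lambda>s. g s v) differentiable at x \<and> (\<lambda>s. g x s) differentiable at v) \<and>
     C_k k (deriv_x g) \<and> C_k k (deriv_v g)"

text \<open>The weighted norms take the value \<open>\<infinity>\<close> when the supremum is infinite.\<close>

definition Linf_norm :: "real \<Rightarrow> (real \<Rightarrow> real \<Rightarrow> real) \<Rightarrow> ennreal" where
  "Linf_norm q g = (SUP x. SUP v. ennreal (\<bar>g x v\<bar> * (1 + \<bar>v\<bar>) powr q))"

definition W_norm :: "nat \<Rightarrow> real \<Rightarrow> (real \<Rightarrow> real \<Rightarrow> real) \<Rightarrow> ennreal" where
  "W_norm N q g = (\<Sum>(a, b) \<in> {(a, b). a + b \<le> N}. Linf_norm q ((deriv_x ^^ a) ((deriv_v ^^ b) g)))"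

definition pos_part :: "real \<Rightarrow> real" where "pos_part a = max a 0"

definition neg_part :: "real \<Rightarrow> real" where "neg_part a = - min a 0"


section \<open>The scheme\<close>

text \<open>The Green kernel of the Poisson equation on the torus; only its values on the unit square
  are used.\<close>

definition K_kernel :: "real \<Rightarrow> real \<Rightarrow> real" where
  "K_kernel x y = (if y \<le> x then y else y - 1)"

text \<open>Grid functions are functions of integer indices \<open>i\<close>, \<open>j\<close>; their values are meaningful for
  \<open>0 \<le> i < N\<^sub>x\<close> and \<open>- N\<^sub>v \<le> j \<le> N\<^sub>v\<close>.  The scheme reads them through \<open>ext\<close>, which is periodic in
  the space index and supplies the Neumann ghost values at \<open>j = - N\<^sub>v - 1\<close> and \<open>j = N\<^sub>v + 1\<close>.\<close>

definition ext :: "nat \<Rightarrow> nat \<Rightarrow> (int \<Rightarrow> int \<Rightarrow> real) \<Rightarrow> int \<Rightarrow> int \<Rightarrow> real" where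
  "ext N\<^sub>x N\<^sub>v g i j = g (i mod int N\<^sub>x) (max (- int N\<^sub>v) (min (int N\<^sub>v) j))"

context
  fixes q \<epsilon> :: real
    and f\<^sub>0 :: "real \<Rightarrow> real \<Rightarrow> real"
    and N\<^sub>x N\<^sub>v :: nat
    and \<Delta>x \<Delta>v \<Delta>t :: real
begin

definition xg :: "int \<Rightarrow> real" where "xg i = of_int i * \<Delta>x"

definition vg :: "int \<Rightarrow> real" where "vg j = of_int j * \<Delta>v"

definition I_x :: "int set" where "I_x = {0 ..< int N\<^sub>x}"

definition I_v :: "int set" where "I_v = {- int N\<^sub>v .. int N\<^sub>v}"

definition norm_x :: "(int \<Rightarrow> real) \<Rightarrow> real" where
  "norm_x b = (SUP i \<in> I_x. \<bar>b i\<bar>)"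

definition norm_xv :: "(int \<Rightarrow> int \<Rightarrow> real) \<Rightarrow> real" where
  "norm_xv g = (SUP (i, j) \<in> I_x \<times> I_v. \<bar>g i j\<bar> * (1 + \<bar>vg j\<bar>) powr q)"

definition rho :: "(int \<Rightarrow> int \<Rightarrow> real) \<Rightarrow> int \<Rightarrow> real" where
  "rho g i = (\<Sum>j \<in> I_v. g i j * \<Delta>v)"

definition vel :: "(int \<Rightarrow> int \<Rightarrow> real) \<Rightarrow> int \<Rightarrow> real" where
  "vel g i = (\<Sum>j \<in> I_v. g i j * vg j * \<Delta>v) / rho g i"

definition temp :: "(int \<Rightarrow> int \<Rightarrow> real) \<Rightarrow> int \<Rightarrow> real" where
  "temp g i = (\<Sum>j \<in> I_v. g i j * \<bar>vg j - vel g i\<bar>\<^sup>2 * \<Delta>v) / rho g i"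

definition maxwellian :: "(int \<Rightarrow> int \<Rightarrow> real) \<Rightarrow> int \<Rightarrow> int \<Rightarrow> real" where
  "maxwellian g i j =
     rho g i / sqrt (2 * pi * temp g i) * exp (- (\<bar>vg j - vel g i\<bar>\<^sup>2 / (2 * temp g i)))"

definition e_field :: "(int \<Rightarrow> int \<Rightarrow> real) \<Rightarrow> int \<Rightarrow> real" where
  "e_field g i = (\<Sum>k \<in> I_x. K_kernel (xg i) (xg k) * (rho g k - 1) * \<Delta>x)"

definition transport :: "(int \<Rightarrow> int \<Rightarrow> real) \<Rightarrow> int \<Rightarrow> int \<Rightarrow> real" where
  "transport g i j =
     (let h = ext N\<^sub>x N\<^sub>v g; E = e_field g i in
       (1 - \<Delta>t / \<Delta>x * \<bar>vg j\<bar> - \<Delta>t / \<Delta>v * \<bar>E\<bar>) * h i j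
       + \<Delta>t / \<Delta>x * (pos_part (vg j) * h (i - 1) j + neg_part (vg j) * h (i + 1) j)
       + \<Delta>t / \<Delta>v * (pos_part E * h i (j - 1) + neg_part E * h i (j + 1)))"

primrec sol :: "nat \<Rightarrow> int \<Rightarrow> int \<Rightarrow> real" where
  "sol 0 = (\<lambda>i j. f\<^sub>0 (xg i) (vg j))"
| "sol (Suc n) = (\<lambda>i j.
     (\<epsilon> * transport (sol n) i j + \<Delta>t * maxwellian (transport (sol n)) i j) / (\<epsilon> + \<Delta>t))"

end


section \<open>Constants\<close>

definition D_int :: "real \<Rightarrow> real \<Rightarrow> real" where
  "D_int \<alpha> \<beta> = (LINT v|lborel. exp (- (\<bar>v\<bar> powr \<alpha>) - \<beta> * \<bar>v\<bar>))"

definition D_sup :: "real \<Rightarrow> real \<Rightarrow> real \<Rightarrow> real" where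
  "D_sup q \<alpha> \<beta> = (SUP v. (1 + \<bar>v\<bar>) powr q * exp (- (\<bar>v\<bar> powr \<alpha>) - \<beta> * \<bar>v\<bar>))"

definition D_bar :: "real \<Rightarrow> real" where
  "D_bar p = (LINT v|lborel. (1 + \<bar>v\<bar>) powr (- p))"

context
  fixes q \<alpha> \<gamma> \<eta>\<^sub>1 \<eta>\<^sub>2 \<epsilon> T\<^sub>f C\<^sub>0 :: real
    and f\<^sub>0 :: "real \<Rightarrow> real \<Rightarrow> real"
    and C_M C_Max :: real
begin

definition C_E1 :: real where "C_E1 = (2 + T\<^sub>f) * exp (T\<^sub>f / \<epsilon>) + 1"

definition C_E2 :: real where "C_E2 = (2 powr q - 1) * C_E1"

definition D_const :: real where "D_const = D_int \<alpha> (2 * \<alpha> * C_E1 * T\<^sub>f)"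

definition Dt_const :: real where "Dt_const = D_sup q \<alpha> (2 * \<alpha> * C_E1 * T\<^sub>f)"

definition S_const :: real where
  "S_const = 2 * \<alpha> * C_E1 + \<alpha> * C_E1\<^sup>2 * (T\<^sub>f + 1) / \<eta>\<^sub>1"

definition F_const :: real where "F_const = enn2real (Linf_norm q f\<^sub>0)"

definition Q_const :: real where "Q_const = S_const + C_E2 + C_Max / \<epsilon>"

definition a_1 :: real where
  "a_1 = (C\<^sub>0 * D_const) powr (5/9)
         / (2 powr (16/9) * (1 + C_E2) powr (5/9) * C_M powr (2/9) * F_const powr (5/9))
         * exp (- (5/9) * Q_const * T\<^sub>f)"

definition a_2 :: real where
  "a_2 = (C\<^sub>0\<^sup>2 * D_const * Dt_const
          / (4 * (q - 3) * D_bar (q - 2) * (C\<^sub>0 * D_const + 8) * (1 + C_E2) * F_const))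
           powr (1 / (q - 1))
         * exp (- (1 / (q - 1)) * (2 * S_const + C_E2 + (C_Max + 1) / \<epsilon>) * T\<^sub>f)"

definition a_3 :: real where
  "a_3 = (let \<theta> = (2 * q + 3) / (3 * q + 3) in
           (C\<^sub>0 * D_const) powr \<theta>
           / (2 powr ((4 * q + 12) / (3 * q + 3)) * (1 + C_E2) powr \<theta>
              * C_M powr (2 * q / (3 * q + 3)) * F_const powr \<theta>)
           * exp (- \<theta> * Q_const * T\<^sub>f))"

definition a_4 :: real where
  "a_4 = (C\<^sub>0 * D_const / (4 * (1 + C_E2) * C_M * F_const) * exp (- Q_const * T\<^sub>f)) powr (2/3)"

definition a_5 :: real where
  "a_5 = (2 * C_E1 powr (1 - q) * (1 + C_E2)
          * exp ((C_E2 + 2 * (C_Max - 1) / \<epsilon>) * T\<^sub>f) * F_const) powr (- (1 / (q * \<gamma>)))"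

text \<open>The condition on the mesh threshold \<open>l\<close>.  Only grids as they occur in the scheme are
  considered, i.e. the velocity cut-off is \<open>N\<^sub>v \<Delta>v = C_E1 (\<Delta>v)\<^bsup>-\<gamma>\<^esup>\<close>; the bounds below cannot hold
  for small \<open>\<Delta>v\<close> with an arbitrary cut-off.\<close>

definition mesh_small :: "real \<Rightarrow> bool" where
  "mesh_small l \<longleftrightarrow>
    (\<forall>N\<^sub>x N\<^sub>v :: nat. \<forall>\<Delta>x \<Delta>v :: real.
       0 < \<Delta>x \<and> 0 < \<Delta>v \<and> real N\<^sub>x * \<Delta>x = 1 \<and> real N\<^sub>v * \<Delta>v = C_E1 * \<Delta>v powr (- \<gamma>) \<and>
       \<Delta>x < l \<and> \<Delta>v < l \<longrightarrow>
         (\<forall>(a, b) \<in> {(\<alpha>, 2 * \<alpha> * C_E1 * T\<^sub>f), (2, 0)}.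
            (\<Sum>j \<in> I_v N\<^sub>v. exp (- (\<bar>vg \<Delta>v j\<bar> powr a) - b * \<bar>vg \<Delta>v j\<bar>) * \<Delta>v)
              \<in> {D_int a b / 2 .. 2 * D_int a b} \<and>
            (SUP j \<in> I_v N\<^sub>v. (1 + \<bar>vg \<Delta>v j\<bar>) powr q * exp (- (\<bar>vg \<Delta>v j\<bar> powr a) - b * \<bar>vg \<Delta>v j\<bar>))
              \<in> {D_sup q a b / 2 .. 2 * D_sup q a b}) \<and>
         (\<forall>m \<in> {0, 1, 2}.
            (\<Sum>j \<in> I_v N\<^sub>v. \<Delta>v / (1 + \<bar>vg \<Delta>v j\<bar>) powr (q - m))
              \<in> {D_bar (q - m) / 2 .. 2 * D_bar (q - m)}) \<and>
         (\<Sum>i \<in> I_x N\<^sub>x. \<Sum>j \<in> I_v N\<^sub>v. f\<^sub>0 (xg \<Delta>x i) (vg \<Delta>v j) * \<Delta>x * \<Delta>v) \<le> 2)"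

definition r_x :: "real \<Rightarrow> real" where
  "r_x l = Min {l, 1 / (4 * \<alpha> * C_E1), 1/2}"

definition r_v :: "real \<Rightarrow> real \<Rightarrow> real" where
  "r_v l \<Delta>x = Min {a_1, a_2, a_3, l, l * sqrt (2 * a_4), a_5,
      ((1 - \<eta>\<^sub>2) / \<eta>\<^sub>2 * \<Delta>x) powr (1 / (1 - \<gamma>)),
      1 / (4 * \<alpha> * (C_E1 * (T\<^sub>f + 1) + 1)), 1/2}"

text \<open>The stability estimate for a grid function \<open>g\<close> (one time level of the discrete solution).\<close>

definition stability :: "nat \<Rightarrow> nat \<Rightarrow> real \<Rightarrow> real \<Rightarrow> real \<Rightarrow> (int \<Rightarrow> int \<Rightarrow> real) \<Rightarrow> bool" where
  "stability N\<^sub>x N\<^sub>v \<Delta>x \<Delta>v \<Delta>t g \<longleftrightarrow>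
    (let h = transport N\<^sub>x N\<^sub>v \<Delta>x \<Delta>v \<Delta>t g;
         \<rho> = rho N\<^sub>v \<Delta>v h; U = vel N\<^sub>v \<Delta>v h; T = temp N\<^sub>v \<Delta>v h;
         B = D_bar (q - 2) * (1 + 8 / (C\<^sub>0 * D_const)) * (1 + C_E2) * exp (Q_const * T\<^sub>f) * F_const
     in
      (\<Sum>i \<in> I_x N\<^sub>x. \<Sum>j \<in> I_v N\<^sub>v. g i j * \<Delta>x * \<Delta>v) \<le> (2 + T\<^sub>f) * exp (T\<^sub>f / \<epsilon>) \<and>
      norm_x N\<^sub>x (e_field N\<^sub>x N\<^sub>v \<Delta>x \<Delta>v g) \<le> C_E1 \<and>
      (\<forall>i \<in> I_x N\<^sub>x. \<forall>j \<in> I_v N\<^sub>v.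
         h i j \<ge> C\<^sub>0 / 2 * exp (- (S_const + 1 / \<epsilon>) * T\<^sub>f) * exp (- (\<bar>vg \<Delta>v j\<bar> powr \<alpha>))
                  * exp (- (2 * \<alpha> * C_E1 * T\<^sub>f * \<bar>vg \<Delta>v j\<bar>))) \<and>
      norm_xv q N\<^sub>x N\<^sub>v \<Delta>v h \<le> (1 + C_E2) * exp ((C_E2 + (C_Max - 1) / \<epsilon>) * T\<^sub>f) * F_const \<and>
      (\<forall>i \<in> I_x N\<^sub>x.
         \<rho> i \<ge> C\<^sub>0 * D_const / 4 * exp (- (S_const + 1 / \<epsilon>) * T\<^sub>f) \<and>
         T i \<ge> (C\<^sub>0 * D_const / (4 * (1 + C_E2) * C_M * F_const) * exp (- Q_const * T\<^sub>f)) powr (2/3)) \<and>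
      norm_x N\<^sub>x \<rho> \<le> B \<and> norm_x N\<^sub>x U \<le> B \<and> norm_x N\<^sub>x T \<le> B)"

end

end

theory Submission
  imports Defs "HOL-Probability.Distributions"
begin

text \<open>Every bound is propagated from one time level to the next through the two halves of a step.

  Transport.  The total mass bounds the field by \<open>C_E1\<close>, and then the mesh conditions give the CFL
  condition: each transported value is an average of old values, a share \<open>\<theta>\<close> of which, at most
  \<open>\<Delta>t C_E1 / \<Delta>v\<close>, comes from a neighbouring velocity.  Pointwise bounds thus survive up to the
  relative change of the bounding profile over one velocity cell, times \<open>\<theta>\<close>; this is of order
  \<open>\<Delta>t\<close> whatever \<open>\<Delta>v\<close> is.  The profiles are the weight \<open>(1 + \<bar>v\<bar>)\<close> to the power \<open>- q\<close> from above
  (\<open>h_le\<close>) and a stretched exponential with an added exponential factor, growing in time, from below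
  (\<open>h_ge\<close>).  Mass changes only through the velocity boundary, where the decay makes the flux at most
  one (\<open>boundary_flux_le\<close>, \<open>total_h_le\<close>).

  Relaxation.  The new value is an average of the transported one and its discrete Maxwellian, so a
  lower bound loses the factor \<open>\<epsilon> / (\<epsilon> + \<Delta>t)\<close>, and the other two bounds follow once the Maxwellian
  has at most twice the mass and at most \<open>C_Max\<close> times the weighted norm of the transported
  function.  Both hold as soon as \<open>\<Delta>v\<close> is at most the thermal speed (\<open>maxwellian_grid_sum_le\<close>,
  \<open>maxwellian_weighted_le\<close>), with a \<open>C_Max\<close> that comes from moment inequalities and depends on \<open>q\<close>
  only.

  Hence the temperature must be bounded from below.  By Chebyshev's inequality a distribution
  bounded by \<open>m\<close> has a density \<open>\<rho>\<close> of order at most \<open>m \<surd>T\<close>, which by itself bounds \<open>T\<close> only by a multiple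
  of \<open>(\<rho> / m)\<^sup>2\<close>.  But the lower profile also keeps the thermal energy \<open>\<rho> T\<close> away from zero
  (\<open>thermal_energy_ge\<close>), and \<open>\<rho> T \<le> 8 m (\<surd>T)\<^sup>3\<close> then yields the exponent \<open>2/3\<close> of the estimate
  (\<open>temperature_lower_bound\<close>).  On the grid this argument needs \<open>\<Delta>v\<close> cubed to be
  small relative to \<open>\<rho> T / m\<close>, which follows from \<open>\<Delta>v < a_1\<close>.  The second velocity moment of the lower
  profile is taken over speeds at most one; the exponent \<open>S\<close> is generous enough to absorb the loss of
  its exponential factor there, so that \<open>C_M\<close> can be an absolute constant.

  The bounds of the stability estimate at one level are read off from the three propagated bounds at
  that level; the ones on the macroscopic quantities use the weighted norm and the density.\<close>

section \<open>Comparing grid sums with integrals\<close>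

lemma floor_cell_iff:
  fixes h y :: real
  assumes "0 < h"
  shows "\<lfloor>y / h\<rfloor> = k \<longleftrightarrow> of_int k * h \<le> y \<and> y < (of_int k + 1) * h"
  using assms by (simp add: floor_eq_iff field_simps)

lemma cell_step_function_integral:
  fixes c :: "int \<Rightarrow> real"
  assumes h: "0 < h" and J: "finite J"
  shows "has_bochner_integral lborel (\<lambda>y. if \<lfloor>y / h\<rfloor> \<in> J then c \<lfloor>y / h\<rfloor> else 0) (\<Sum>k\<in>J. c k * h)"
proof -
  have "has_bochner_integral lborel (\<lambda>y. indicator {of_int k * h ..< (of_int k + 1) * h} y *\<^sub>R c k)
      (measure lborel {of_int k * h ..< (of_int k + 1) * h} *\<^sub>R c k)" for k :: int
    by (rule has_bochner_integral_indicator) (auto simp: h emeasure_lborel_Ico)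
  moreover have "measure lborel {of_int k * h ..< (of_int k + 1) * h} = h" for k :: int
    using h by (simp add: algebra_simps)
  ultimately have "has_bochner_integral lborel
      (\<lambda>y. \<Sum>k\<in>J. indicator {of_int k * h ..< (of_int k + 1) * h} y *\<^sub>R c k) (\<Sum>k\<in>J. c k * h)"
    by (intro has_bochner_integral_sum) (auto simp: mult.commute)
  moreover have "(\<Sum>k\<in>J. indicator {of_int k * h ..< (of_int k + 1) * h} y *\<^sub>R c k)
      = (if \<lfloor>y / h\<rfloor> \<in> J then c \<lfloor>y / h\<rfloor> else 0)" for y
  proof -
    have "(\<Sum>k\<in>J. indicator {of_int k * h ..< (of_int k + 1) * h} y *\<^sub>R c k)
        = (\<Sum>k\<in>J. if \<lfloor>y / h\<rfloor> = k then c k else 0)"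
      by (rule sum.cong) (auto simp: floor_cell_iff[OF h] indicator_def)
    then show ?thesis using J by simp
  qed
  ultimately show ?thesis by simp
qed

lemma cell_sum_le_integral:
  fixes G :: "real \<Rightarrow> real" and c :: "int \<Rightarrow> real"
  assumes h: "0 < h" and J: "finite J"
    and G: "set_integrable lborel S G" "\<And>y. y \<in> S \<Longrightarrow> 0 \<le> G y"
    and c: "\<And>y. \<lfloor>y / h\<rfloor> \<in> J \<Longrightarrow> y \<in> S \<and> c \<lfloor>y / h\<rfloor> \<le> G y"
  shows "(\<Sum>k\<in>J. c k * h) \<le> (LINT y:S|lborel. G y)"
proof -
  note I = cell_step_function_integral[OF h J, of c]
  have "(\<Sum>k\<in>J. c k * h) = (LINT y|lborel. (if \<lfloor>y / h\<rfloor> \<in> J then c \<lfloor>y / h\<rfloor> else 0))"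
    using I by (simp add: has_bochner_integral_iff)
  also have "\<dots> \<le> (LINT y:S|lborel. G y)"
    unfolding set_lebesgue_integral_def
  proof (rule integral_mono)
    show "integrable lborel (\<lambda>y. if \<lfloor>y / h\<rfloor> \<in> J then c \<lfloor>y / h\<rfloor> else 0)"
      using I by (simp add: has_bochner_integral_iff)
    show "integrable lborel (\<lambda>y. indicator S y *\<^sub>R G y)" using G by (simp add: set_integrable_def)
    show "(if \<lfloor>y / h\<rfloor> \<in> J then c \<lfloor>y / h\<rfloor> else 0) \<le> indicator S y *\<^sub>R G y" for y
      using c[of y] G(2)[of y] by (auto simp: indicator_def)
  qed
  finally show ?thesis .
qed

lemma integral_le_cell_sum:
  fixes G :: "real \<Rightarrow> real" and c :: "int \<Rightarrow> real"
  assumes h: "0 < h" and J: "finite J"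
    and G: "set_integrable lborel S G"
    and c: "\<And>k. k \<in> J \<Longrightarrow> 0 \<le> c k" "\<And>y. y \<in> S \<Longrightarrow> \<lfloor>y / h\<rfloor> \<in> J \<and> G y \<le> c \<lfloor>y / h\<rfloor>"
  shows "(LINT y:S|lborel. G y) \<le> (\<Sum>k\<in>J. c k * h)"
proof -
  note I = cell_step_function_integral[OF h J, of c]
  have "(LINT y:S|lborel. G y) \<le> (LINT y|lborel. (if \<lfloor>y / h\<rfloor> \<in> J then c \<lfloor>y / h\<rfloor> else 0))"
    unfolding set_lebesgue_integral_def
  proof (rule integral_mono)
    show "integrable lborel (\<lambda>y. if \<lfloor>y / h\<rfloor> \<in> J then c \<lfloor>y / h\<rfloor> else 0)"
      using I by (simp add: has_bochner_integral_iff)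
    show "integrable lborel (\<lambda>y. indicator S y *\<^sub>R G y)" using G by (simp add: set_integrable_def)
    show "indicator S y *\<^sub>R G y \<le> (if \<lfloor>y / h\<rfloor> \<in> J then c \<lfloor>y / h\<rfloor> else 0)" for y
      using c(1)[of "\<lfloor>y / h\<rfloor>"] c(2)[of y] by (auto simp: indicator_def)
  qed
  also have "\<dots> = (\<Sum>k\<in>J. c k * h)"
    using I by (simp add: has_bochner_integral_iff)
  finally show ?thesis .
qed

text \<open>A grid point other than the two nearest to the peak is compared with the cell on its side
  towards the peak, where the function is larger; these cells do not overlap.  The two remaining
  points cost at most \<open>2 h M\<close>.  The peak may lie between grid points, as that of a Maxwellian does.\<close>

lemma unimodal_grid_sum_le:
  fixes G :: "real \<Rightarrow> real"
  assumes G: "integrable lborel G" "\<And>y. 0 \<le> G y" "\<And>y. G y \<le> M"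
    and incr: "\<And>x y. x \<le> y \<Longrightarrow> y \<le> c \<Longrightarrow> G x \<le> G y"
    and decr: "\<And>x y. c \<le> x \<Longrightarrow> x \<le> y \<Longrightarrow> G y \<le> G x"
    and h: "0 < h" and J: "finite J"
  shows "(\<Sum>j\<in>J. G (of_int j * h) * h) \<le> (LINT y|lborel. G y) + 2 * h * M"
proof -
  define R where "R = {j \<in> J. c \<le> (of_int j - 1) * h}"
  define L where "L = {j \<in> J. (of_int j + 1) * h \<le> c}"
  define X where "X = J - (R \<union> L)"
  define R' where "R' = (\<lambda>j. j - 1) ` R"
  define d where "d k = (if c \<le> of_int k * h then G ((of_int k + 1) * h) else G (of_int k * h))" for k :: int
  have fin: "finite R" "finite L" "finite X" "finite R'" using J by (auto simp: R_def L_def X_def R'_def)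
  have RL: "R \<inter> L = {}" using h by (auto simp: R_def L_def algebra_simps)
  have R'L: "R' \<inter> L = {}" using h by (auto simp: R_def R'_def L_def algebra_simps)
  have "J = (R \<union> L) \<union> X" by (auto simp: R_def L_def X_def)
  then have "(\<Sum>j\<in>J. G (of_int j * h) * h)
      = (\<Sum>j\<in>R. G (of_int j * h) * h) + (\<Sum>j\<in>L. G (of_int j * h) * h) + (\<Sum>j\<in>X. G (of_int j * h) * h)"
    using sum.union_disjoint[of "R \<union> L" X "\<lambda>j. G (of_int j * h) * h"] sum.union_disjoint[of R L "\<lambda>j. G (of_int j * h) * h"]
      fin RL by (auto simp: X_def)
  moreover have "(\<Sum>j\<in>X. G (of_int j * h) * h) \<le> 2 * h * M"
  proof -
    have "X \<subseteq> {\<lfloor>c / h\<rfloor>, \<lfloor>c / h\<rfloor> + 1}"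
    proof
      fix j assume "j \<in> X"
      then have "c / h > of_int j - 1" "c / h < of_int j + 1"
        using h by (auto simp: X_def R_def L_def field_simps)
      then show "j \<in> {\<lfloor>c / h\<rfloor>, \<lfloor>c / h\<rfloor> + 1}" by simp linarith
    qed
    then have "card X \<le> card {\<lfloor>c / h\<rfloor>, \<lfloor>c / h\<rfloor> + 1}" by (rule card_mono[rotated]) simp
    then have "card X \<le> 2" by simp
    have M: "0 \<le> M" using G(2)[of 0] G(3)[of 0] by linarith
    have "(\<Sum>j\<in>X. G (of_int j * h) * h) \<le> of_nat (card X) * (M * h)"
      by (rule sum_bounded_above) (use G h in \<open>simp add: mult_right_mono\<close>)
    also have "\<dots> \<le> 2 * (M * h)"
      using \<open>card X \<le> 2\<close> M h by (intro mult_right_mono) auto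
    finally show ?thesis by (simp add: mult_ac)
  qed
  moreover have "(\<Sum>j\<in>R. G (of_int j * h) * h) + (\<Sum>j\<in>L. G (of_int j * h) * h) \<le> (LINT y|lborel. G y)"
  proof -
    have "(\<Sum>j\<in>R. G (of_int j * h) * h) = (\<Sum>k\<in>R'. d k * h)"
      unfolding R'_def by (subst sum.reindex) (auto simp: inj_on_def d_def R_def intro!: sum.cong)
    moreover have "(\<Sum>j\<in>L. G (of_int j * h) * h) = (\<Sum>k\<in>L. d k * h)"
      using h by (intro sum.cong) (auto simp: d_def L_def algebra_simps)
    ultimately have "(\<Sum>j\<in>R. G (of_int j * h) * h) + (\<Sum>j\<in>L. G (of_int j * h) * h) = (\<Sum>k\<in>R' \<union> L. d k * h)"
      using fin R'L by (simp add: sum.union_disjoint)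
    also have "\<dots> \<le> (LINT y:UNIV|lborel. G y)"
    proof (rule cell_sum_le_integral[OF h])
      show "y \<in> UNIV \<and> d \<lfloor>y / h\<rfloor> \<le> G y" if "\<lfloor>y / h\<rfloor> \<in> R' \<union> L" for y
      proof -
        have y: "of_int \<lfloor>y / h\<rfloor> * h \<le> y" "y < (of_int \<lfloor>y / h\<rfloor> + 1) * h"
          using floor_cell_iff[OF h, of y "\<lfloor>y / h\<rfloor>"] by auto
        from that consider "c \<le> of_int \<lfloor>y / h\<rfloor> * h" | "(of_int \<lfloor>y / h\<rfloor> + 1) * h \<le> c"
          by (auto simp: R'_def R_def L_def)
        then show ?thesis
        proof cases
          case 1
          then show ?thesis using y decr[of y "(of_int \<lfloor>y / h\<rfloor> + 1) * h"] by (simp add: d_def)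
        next
          case 2
          then have "of_int \<lfloor>y / h\<rfloor> * h < c" using h by (simp add: algebra_simps)
          then show ?thesis using 2 y incr[of "of_int \<lfloor>y / h\<rfloor> * h" y] by (simp add: d_def)
        qed
      qed
    qed (use fin G in \<open>auto simp: set_integrable_def\<close>)
    finally show ?thesis by (simp add: set_lebesgue_integral_def)
  qed
  ultimately show ?thesis by linarith
qed

lemma unimodal_grid_sum_ge:
  fixes G :: "real \<Rightarrow> real" and N :: nat
  assumes G: "integrable lborel G" "\<And>y. 0 \<le> G y"
    and incr: "\<And>x y. x \<le> y \<Longrightarrow> y \<le> 0 \<Longrightarrow> G x \<le> G y"
    and decr: "\<And>x y. 0 \<le> x \<Longrightarrow> x \<le> y \<Longrightarrow> G y \<le> G x"
    and h: "0 < h"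
  shows "(LINT y:{- (of_nat N * h) ..< of_nat N * h}|lborel. G y)
      \<le> (\<Sum>j\<in>{- int N .. int N}. G (of_int j * h) * h) + h * G 0"
proof -
  define d where "d k = (if 0 \<le> k then G (of_int k * h) else G ((of_int k + 1) * h))" for k :: int
  have "(LINT y:{- (of_nat N * h) ..< of_nat N * h}|lborel. G y) \<le> (\<Sum>k\<in>{- int N ..< int N}. d k * h)"
  proof (rule integral_le_cell_sum[OF h])
    show "set_integrable lborel {- (of_nat N * h) ..< of_nat N * h} G"
      unfolding set_integrable_def by (rule integrable_mult_indicator) (use G in auto)
    show "\<lfloor>y / h\<rfloor> \<in> {- int N ..< int N} \<and> G y \<le> d \<lfloor>y / h\<rfloor>"
      if "y \<in> {- (of_nat N * h) ..< of_nat N * h}" for y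
    proof
      have "- real N \<le> y / h" "y / h < real N" using that h by (auto simp: field_simps)
      then show "\<lfloor>y / h\<rfloor> \<in> {- int N ..< int N}" by (simp add: le_floor_iff floor_less_iff)
      have y: "of_int \<lfloor>y / h\<rfloor> * h \<le> y" "y < (of_int \<lfloor>y / h\<rfloor> + 1) * h"
        using floor_cell_iff[OF h, of y "\<lfloor>y / h\<rfloor>"] by auto
      show "G y \<le> d \<lfloor>y / h\<rfloor>"
      proof (cases "0 \<le> \<lfloor>y / h\<rfloor>")
        case True
        then have "0 \<le> of_int \<lfloor>y / h\<rfloor> * h" using h by simp
        then show ?thesis using y decr True by (simp add: d_def)
      next
        case False
        then have "of_int (\<lfloor>y / h\<rfloor> + 1) \<le> (0::real)" by linarith
        then have "(of_int \<lfloor>y / h\<rfloor> + 1) * h \<le> 0" using h by (simp add: mult_le_0_iff)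
        then show ?thesis using y incr[of y "(of_int \<lfloor>y / h\<rfloor> + 1) * h"] False by (simp add: d_def)
      qed
    qed
  qed (use G in \<open>auto simp: d_def\<close>)
  also have "(\<Sum>k\<in>{- int N ..< int N}. d k * h)
      = (\<Sum>k\<in>{0 ..< int N}. d k * h) + (\<Sum>k\<in>{- int N ..< 0}. d k * h)"
    by (subst sum.union_disjoint[symmetric]) (auto intro!: sum.cong)
  also have "(\<Sum>k\<in>{- int N ..< 0}. d k * h) = (\<Sum>j\<in>{- int N + 1 .. 0}. G (of_int j * h) * h)"
    by (rule sum.reindex_bij_witness[of _ "\<lambda>j. j - 1" "\<lambda>k. k + 1"]) (auto simp: d_def)
  also have "(\<Sum>k\<in>{0 ..< int N}. d k * h) = (\<Sum>k\<in>{0 ..< int N}. G (of_int k * h) * h)"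
    by (intro sum.cong) (auto simp: d_def)
  also have "\<dots> \<le> (\<Sum>k\<in>{0 .. int N}. G (of_int k * h) * h)"
    using G h by (intro sum_mono2) auto
  also have "(\<Sum>j\<in>{- int N + 1 .. 0}. G (of_int j * h) * h) \<le> (\<Sum>j\<in>{- int N .. 0}. G (of_int j * h) * h)"
    using G h by (intro sum_mono2) auto
  also have "{- int N .. 0} = insert 0 {- int N .. -1}" by auto
  also have "(\<Sum>j\<in>insert 0 {- int N .. -1}. G (of_int j * h) * h) = G 0 * h + (\<Sum>j\<in>{- int N .. -1}. G (of_int j * h) * h)"
    by simp
  also have "(\<Sum>k\<in>{0 .. int N}. G (of_int k * h) * h) + (G 0 * h + (\<Sum>j\<in>{- int N .. -1}. G (of_int j * h) * h))
      = (\<Sum>j\<in>{- int N .. int N}. G (of_int j * h) * h) + h * G 0"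
  proof -
    have "{- int N .. int N} = {0 .. int N} \<union> {- int N .. -1}" by auto
    then show ?thesis by (simp add: sum.union_disjoint)
  qed
  finally show ?thesis by simp
qed

section \<open>The velocity profiles and their integrals\<close>

lemma algebraic_profile_integral:
  assumes p: "1 < p"
  shows "has_bochner_integral lborel (\<lambda>v::real. (1 + \<bar>v\<bar>) powr (- p)) (2 / (p - 1))"
proof -
  have "(\<integral>\<^sup>+(v::real). ennreal ((1 + \<bar>v\<bar>) powr (- p)) * indicator {0..} v \<partial>lborel) = 0 - ((1 + 0) powr (1 - p)) / (1 - p)"
  proof (rule nn_integral_FTC_atLeast)
    show "((\<lambda>v::real. (1 + v) powr (1 - p) / (1 - p)) has_field_derivative (1 + \<bar>v\<bar>) powr (- p)) (at v)"
      if "0 \<le> v" for v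
      using that p by (auto intro!: derivative_eq_intros)
    have "filterlim (\<lambda>v::real. 1 + v) at_top at_top"
      by (rule filterlim_tendsto_add_at_top[OF tendsto_const filterlim_ident])
    then have "((\<lambda>v::real. (1 + v) powr (1 - p)) \<longlongrightarrow> 0) at_top"
      using p by (intro tendsto_neg_powr) auto
    then show "((\<lambda>v::real. (1 + v) powr (1 - p) / (1 - p)) \<longlongrightarrow> 0) at_top"
      by (rule tendsto_divide_zero)
  qed auto
  then have "(\<integral>\<^sup>+(v::real). ennreal (indicator {0..} v *\<^sub>R ((1 + \<bar>v\<bar>) powr (- p))) \<partial>lborel) = ennreal (1 / (p - 1))"
    using p by (subst nn_integral_cong[of _ _ "\<lambda>v::real. ennreal ((1 + \<bar>v\<bar>) powr (- p)) * indicator {0..} v"])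
      (auto simp: indicator_def field_simps)
  then have "has_bochner_integral lborel (\<lambda>v. indicator {0..} v *\<^sub>R ((1 + \<bar>v\<bar>) powr (- p))) (1 / (p - 1))"
    using p by (intro has_bochner_integral_nn_integral) auto
  from has_bochner_integral_even_function[OF this] show ?thesis by simp
qed

lemma integrable_algebraic_profile: "1 < p \<Longrightarrow> integrable lborel (\<lambda>v::real. (1 + \<bar>v\<bar>) powr (- p))"
  and D_bar_eq: "1 < p \<Longrightarrow> D_bar p = 2 / (p - 1)"
  using algebraic_profile_integral by (auto simp: has_bochner_integral_iff D_bar_def)

text \<open>The algebraic profile dominates all the exponential ones uniformly in their parameters, so that
  their integrals have an absolute bound.\<close>

lemma exponential_profile_le:
  fixes v :: real
  assumes "1 \<le> a" "0 \<le> b"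
  shows "exp (- (\<bar>v\<bar> powr a) - b * \<bar>v\<bar>) \<le> 4 * (1 + \<bar>v\<bar>) powr (- 2)"
proof -
  have "(1 + \<bar>v\<bar>)\<^sup>2 \<le> 4 * exp (\<bar>v\<bar> powr a)"
  proof (cases "\<bar>v\<bar> \<le> 1")
    case True
    then have "(1 + \<bar>v\<bar>)\<^sup>2 \<le> 2\<^sup>2" by (intro power_mono) auto
    also have "\<dots> \<le> 4 * exp (\<bar>v\<bar> powr a)" by simp
    finally show ?thesis .
  next
    case False
    then have "\<bar>v\<bar> powr 1 \<le> \<bar>v\<bar> powr a" using assms by (intro powr_mono) auto
    then have le: "exp \<bar>v\<bar> \<le> exp (\<bar>v\<bar> powr a)" using False by simp
    have "(1 + \<bar>v\<bar>)\<^sup>2 \<le> 4 * (1 + \<bar>v\<bar> + \<bar>v\<bar>\<^sup>2 / 2)" by (simp add: power2_eq_square algebra_simps)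
    also have "\<dots> \<le> 4 * exp \<bar>v\<bar>" using exp_lower_Taylor_quadratic[of "\<bar>v\<bar>"] by simp
    finally show ?thesis using le by linarith
  qed
  then have "exp (- (\<bar>v\<bar> powr a)) \<le> 4 / (1 + \<bar>v\<bar>)\<^sup>2"
    by (simp add: exp_minus field_simps)
  moreover have "exp (- (\<bar>v\<bar> powr a) - b * \<bar>v\<bar>) \<le> exp (- (\<bar>v\<bar> powr a))" using assms by simp
  moreover have "4 / (1 + \<bar>v\<bar>)\<^sup>2 = 4 * (1 + \<bar>v\<bar>) powr (- 2)"
    by (simp add: powr_minus_divide)
  ultimately show ?thesis by linarith
qed

lemma integrable_exponential_profile:
  assumes "1 \<le> a" "0 \<le> b"
  shows "integrable lborel (\<lambda>v::real. exp (- (\<bar>v\<bar> powr a) - b * \<bar>v\<bar>))"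
proof (rule Bochner_Integration.integrable_bound)
  show "integrable lborel (\<lambda>v::real. 4 * (1 + \<bar>v\<bar>) powr (- 2))"
    using integrable_algebraic_profile[of 2] by simp
qed (use exponential_profile_le[OF assms] in auto)

lemma D_int_le_8:
  assumes "1 \<le> a" "0 \<le> b"
  shows "D_int a b \<le> 8"
proof -
  have "D_int a b \<le> (LINT v::real|lborel. 4 * (1 + \<bar>v\<bar>) powr (- 2))"
    unfolding D_int_def
    by (rule integral_mono) (use integrable_exponential_profile[OF assms] integrable_algebraic_profile[of 2]
        exponential_profile_le[OF assms] in auto)
  also have "\<dots> = 8" using D_bar_eq[of 2] by (simp add: D_bar_def)
  finally show ?thesis .
qed

text \<open>Uniformity in the mesh size lets this bound serve on rescaled grids too.\<close>

lemma algebraic_grid_sum_le: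
  fixes p h :: real
  assumes p: "1 < p" and h: "0 < h" and J: "finite J"
  shows "(\<Sum>j\<in>J. (1 + \<bar>of_int j * h\<bar>) powr (- p) * h) \<le> 2 / (p - 1) + 2 * h"
proof -
  have "(\<Sum>j\<in>J. (1 + \<bar>of_int j * h\<bar>) powr (- p) * h) \<le> (LINT v::real|lborel. (1 + \<bar>v\<bar>) powr (- p)) + 2 * h * 1"
  proof (rule unimodal_grid_sum_le[where c = 0 and G = "\<lambda>v::real. (1 + \<bar>v\<bar>) powr (- p)"])
    show "(1 + \<bar>y\<bar>) powr (- p) \<le> 1" for y :: real
      using p powr_mono2'[of "- p" 1 "1 + \<bar>y\<bar>"] by simp
  qed (use p h J integrable_algebraic_profile in \<open>auto intro!: powr_mono2'\<close>)
  then show ?thesis using D_bar_eq[OF p] by (simp add: D_bar_def)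
qed

section \<open>Grid sums and suprema for a growing velocity cut-off\<close>

lemma cutoff_at_top:
  fixes E \<gamma> :: real
  assumes "0 < E" "0 < \<gamma>"
  shows "eventually (\<lambda>h. V \<le> E * h powr (- \<gamma>)) (at_right 0)"
proof -
  have "filterlim (\<lambda>h::real. h powr (- \<gamma>)) at_top (at_right 0)"
    using assms by real_asymp
  then have "filterlim (\<lambda>h. E * h powr (- \<gamma>)) at_top (at_right 0)"
    using assms by (intro filterlim_tendsto_pos_mult_at_top[OF tendsto_const]) auto
  then show ?thesis by (simp add: filterlim_at_top)
qed

lemma unimodal_grid_sum_near_integral:
  fixes G :: "real \<Rightarrow> real" and E \<gamma> :: real
  assumes G: "integrable lborel G" "\<And>y. 0 \<le> G y" and pos: "0 < (LINT y|lborel. G y)"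
    and incr: "\<And>x y. x \<le> y \<Longrightarrow> y \<le> 0 \<Longrightarrow> G x \<le> G y"
    and decr: "\<And>x y. 0 \<le> x \<Longrightarrow> x \<le> y \<Longrightarrow> G y \<le> G x"
    and E: "0 < E" "0 < \<gamma>"
  shows "eventually (\<lambda>h. \<forall>N::nat. real N * h = E * h powr (- \<gamma>) \<longrightarrow>
      (\<Sum>j\<in>{- int N .. int N}. G (of_int j * h) * h) \<in> {(LINT y|lborel. G y) / 2 .. 2 * (LINT y|lborel. G y)})
    (at_right 0)"
proof -
  let ?I = "LINT y|lborel. G y"
  have "((\<lambda>V. LINT y|lborel. indicator {- V ..< V} y *\<^sub>R G y) \<longlongrightarrow> ?I) at_top"
  proof (rule integral_dominated_convergence_at_top[where w = G])
    show "AE y in lborel. ((\<lambda>V. indicator {- V ..< V} y *\<^sub>R G y) \<longlongrightarrow> G y) at_top"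
    proof (rule AE_I2)
      fix y :: real
      have "eventually (\<lambda>V. indicator {- V ..< V} y *\<^sub>R G y = G y) at_top"
        using eventually_gt_at_top[of "\<bar>y\<bar>"] by eventually_elim (auto simp: indicator_def)
      then show "((\<lambda>V. indicator {- V ..< V} y *\<^sub>R G y) \<longlongrightarrow> G y) at_top" by (rule tendsto_eventually)
    qed
    show "eventually (\<lambda>V. AE y in lborel. norm (indicator {- V ..< V} y *\<^sub>R G y) \<le> G y) at_top"
      using G by (intro always_eventually allI AE_I2) (auto simp: indicator_def)
  qed (use G in auto)
  then have "eventually (\<lambda>V. 3 / 4 * ?I < (LINT y|lborel. indicator {- V ..< V} y *\<^sub>R G y)) at_top"
    using pos by (intro order_tendstoD(1)) auto
  then obtain V0 where V0: "\<And>V. V0 \<le> V \<Longrightarrow> 3 / 4 * ?I < (LINT y:{- V ..< V}|lborel. G y)"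
    by (auto simp: eventually_at_top_linorder set_lebesgue_integral_def)
  have max: "G y \<le> G 0" for y using incr[of y 0] decr[of 0 y] by linarith
  have "((\<lambda>h. h * G 0) \<longlongrightarrow> 0 * G 0) (at_right 0)" by (intro tendsto_intros)
  then have "eventually (\<lambda>h. h * G 0 < ?I / 4) (at_right 0)" using pos by (intro order_tendstoD(2)) auto
  moreover note cutoff_at_top[OF E, of V0] eventually_at_right_less[of "0::real"]
  ultimately show ?thesis
  proof eventually_elim
    case (elim h)
    show ?case
    proof (intro allI impI)
      fix N :: nat
      assume N: "real N * h = E * h powr (- \<gamma>)"
      have "3 / 4 * ?I < (LINT y:{- (real N * h) ..< real N * h}|lborel. G y)" using elim N by (intro V0) simp
      also have "\<dots> \<le> (\<Sum>j\<in>{- int N .. int N}. G (of_int j * h) * h) + h * G 0"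
        by (rule unimodal_grid_sum_ge) (use assms elim in auto)
      finally have "?I / 2 \<le> (\<Sum>j\<in>{- int N .. int N}. G (of_int j * h) * h)" using elim by linarith
      moreover have "(\<Sum>j\<in>{- int N .. int N}. G (of_int j * h) * h) \<le> ?I + 2 * h * G 0"
        by (rule unimodal_grid_sum_le[where c = 0]) (use assms elim max in auto)
      ultimately show "(\<Sum>j\<in>{- int N .. int N}. G (of_int j * h) * h) \<in> {?I / 2 .. 2 * ?I}"
        using elim pos by simp
    qed
  qed
qed

text \<open>A point where \<open>w\<close> exceeds half its supremum lies within the cut-off for a fine mesh, and by
  continuity \<open>w\<close> still exceeds it at the next grid point below.\<close>

lemma grid_sup_near_sup:
  fixes w :: "real \<Rightarrow> real" and E \<gamma> :: real
  assumes w: "continuous_on UNIV w" "\<And>v. w v \<le> B" "0 < w 0"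
    and E: "0 < E" "0 < \<gamma>"
  shows "eventually (\<lambda>h. \<forall>N::nat. real N * h = E * h powr (- \<gamma>) \<longrightarrow>
      (SUP j\<in>{- int N .. int N}. w (of_int j * h)) \<in> {(SUP v. w v) / 2 .. 2 * (SUP v. w v)}) (at_right 0)"
proof -
  let ?D = "SUP v. w v"
  have bdd: "bdd_above (range w)" unfolding bdd_above_def using w(2) by auto
  have le: "w v \<le> ?D" for v using bdd by (rule cSUP_upper[OF UNIV_I])
  have D: "0 < ?D" using le[of 0] w(3) by linarith
  then have "?D / 2 < ?D" by simp
  then obtain v where v: "?D / 2 < w v" using less_cSUP_iff[OF _ bdd, of "?D / 2"] by auto
  have "isCont w v" using w(1) by (simp add: continuous_on_eq_continuous_at)
  then have "eventually (\<lambda>u. ?D / 2 < w u) (nhds v)"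
    using v by (intro order_tendstoD(1)[of w "w v"]) (auto simp: isCont_def tendsto_at_iff_tendsto_nhds)
  then obtain \<delta> where \<delta>: "0 < \<delta>" "\<And>u. dist u v < \<delta> \<Longrightarrow> ?D / 2 < w u"
    by (auto simp: eventually_nhds_metric)
  have "eventually (\<lambda>h. h < min \<delta> 1) (at_right 0)"
    using \<delta>(1) by (intro order_tendstoD(2)[OF tendsto_ident_at]) auto
  moreover note cutoff_at_top[OF E, of "\<bar>v\<bar> + 1"] eventually_at_right_less[of "0::real"]
  ultimately show ?thesis
  proof eventually_elim
    case (elim h)
    show ?case
    proof (intro allI impI)
      fix N :: nat
      assume N: "real N * h = E * h powr (- \<gamma>)"
      define j where "j = \<lfloor>v / h\<rfloor>"
      have j: "of_int j * h \<le> v" "v < (of_int j + 1) * h"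
        using floor_cell_iff[of h v j] elim by (auto simp: j_def)
      then have dist: "\<bar>of_int j * h - v\<bar> \<le> h" by (simp add: algebra_simps abs_le_iff)
      have "\<bar>of_int j\<bar> * h = \<bar>of_int j * h\<bar>" using elim by (simp add: abs_mult)
      also have "\<dots> \<le> real N * h" using dist elim N by linarith
      finally have "\<bar>of_int j\<bar> \<le> real N" using elim by simp
      then have jN: "j \<in> {- int N .. int N}" by auto
      have "?D / 2 < w (of_int j * h)" using dist elim by (intro \<delta>(2)) (simp add: dist_real_def)
      also have "\<dots> \<le> (SUP j\<in>{- int N .. int N}. w (of_int j * h))"
        by (rule cSUP_upper[OF jN]) (auto intro: bdd_aboveI2 w)
      finally have 1: "?D / 2 \<le> (SUP j\<in>{- int N .. int N}. w (of_int j * h))" by simp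
      have "(SUP j\<in>{- int N .. int N}. w (of_int j * h)) \<le> ?D"
        using le by (intro cSUP_least) auto
      with 1 D show "(SUP j\<in>{- int N .. int N}. w (of_int j * h)) \<in> {?D / 2 .. 2 * ?D}" by simp
    qed
  qed
qed

text \<open>This is \<open>x \<le> e\<close> to the power \<open>x\<close>, at \<open>x = y / p\<close>.\<close>

lemma powr_le_exp:
  fixes y p :: real
  assumes "0 \<le> y" "0 < p"
  shows "y powr p \<le> p powr p * exp y"
proof -
  have "y / p \<le> exp (y / p)" using exp_ge_add_one_self[of "y / p"] by linarith
  then have "(y / p) powr p \<le> exp (y / p) powr p" using assms by (intro powr_mono2) auto
  also have "\<dots> = exp y" using assms by (simp add: powr_def)
  finally show ?thesis using assms by (simp add: powr_divide field_simps)
qed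

lemma weighted_exponential_profile_le:
  fixes v q a b :: real
  assumes "0 < q" "1 \<le> a" "0 \<le> b"
  shows "(1 + \<bar>v\<bar>) powr q * exp (- (\<bar>v\<bar> powr a) - b * \<bar>v\<bar>) \<le> q powr q * exp 2"
proof -
  have "\<bar>v\<bar> \<le> 1 + \<bar>v\<bar> powr a"
  proof (cases "\<bar>v\<bar> \<le> 1")
    case False
    then have "\<bar>v\<bar> powr 1 \<le> \<bar>v\<bar> powr a" using assms by (intro powr_mono) auto
    then show ?thesis using False by simp
  qed (use powr_ge_zero[of "\<bar>v\<bar>" a] in linarith)
  moreover have "0 \<le> b * \<bar>v\<bar>" using assms by simp
  ultimately have "(1 + \<bar>v\<bar>) + (- (\<bar>v\<bar> powr a) - b * \<bar>v\<bar>) \<le> 2" by linarith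
  then have "exp (1 + \<bar>v\<bar>) * exp (- (\<bar>v\<bar> powr a) - b * \<bar>v\<bar>) \<le> exp 2"
    by (simp flip: exp_add)
  then have "q powr q * (exp (1 + \<bar>v\<bar>) * exp (- (\<bar>v\<bar> powr a) - b * \<bar>v\<bar>)) \<le> q powr q * exp 2"
    by (intro mult_left_mono) auto
  moreover have "(1 + \<bar>v\<bar>) powr q * exp (- (\<bar>v\<bar> powr a) - b * \<bar>v\<bar>)
      \<le> (q powr q * exp (1 + \<bar>v\<bar>)) * exp (- (\<bar>v\<bar> powr a) - b * \<bar>v\<bar>)"
    using assms powr_le_exp[of "1 + \<bar>v\<bar>" q] by (intro mult_right_mono) auto
  ultimately show ?thesis unfolding mult.assoc by (rule order_trans[rotated])
qed

lemma D_int_pos: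
  assumes "1 \<le> a" "0 \<le> b"
  shows "0 < D_int a b"
proof -
  have "0 < (LINT v:{0..1::real}|lborel. exp (- 1 - b))" by (simp add: set_lebesgue_integral_def)
  also have "\<dots> \<le> D_int a b"
    unfolding D_int_def set_lebesgue_integral_def
  proof (rule integral_mono)
    show "indicator {0..1} v *\<^sub>R exp (- 1 - b) \<le> exp (- (\<bar>v\<bar> powr a) - b * \<bar>v\<bar>)" for v :: real
      using assms powr_mono2[of a v 1] mult_left_mono[of v 1 b] by (auto simp: indicator_def)
  qed (use integrable_exponential_profile[OF assms] in auto)
  finally show ?thesis .
qed

lemma exponential_sum_near_D_int:
  fixes E \<gamma> :: real
  assumes ab: "1 \<le> a" "0 \<le> b" and E: "0 < E" "0 < \<gamma>"
  shows "eventually (\<lambda>h. \<forall>N::nat. real N * h = E * h powr (- \<gamma>) \<longrightarrow>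
      (\<Sum>j\<in>{- int N .. int N}. exp (- (\<bar>of_int j * h\<bar> powr a) - b * \<bar>of_int j * h\<bar>) * h)
        \<in> {D_int a b / 2 .. 2 * D_int a b}) (at_right 0)"
  unfolding D_int_def
proof (rule unimodal_grid_sum_near_integral[OF integrable_exponential_profile[OF ab]])
  show "0 < (LINT v::real|lborel. exp (- (\<bar>v\<bar> powr a) - b * \<bar>v\<bar>))"
    using D_int_pos[OF ab] by (simp add: D_int_def)
  have *: "exp (- (\<bar>y\<bar> powr a) - b * \<bar>y\<bar>) \<le> exp (- (\<bar>x\<bar> powr a) - b * \<bar>x\<bar>)" if "\<bar>x\<bar> \<le> \<bar>y\<bar>" for x y :: real
    using that ab powr_mono2[of a "\<bar>x\<bar>" "\<bar>y\<bar>"] mult_left_mono[of "\<bar>x\<bar>" "\<bar>y\<bar>" b] by simp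
  show "exp (- (\<bar>y\<bar> powr a) - b * \<bar>y\<bar>) \<le> exp (- (\<bar>x\<bar> powr a) - b * \<bar>x\<bar>)" if "0 \<le> x" "x \<le> y" for x y :: real
    using that by (intro *) auto
  show "exp (- (\<bar>x\<bar> powr a) - b * \<bar>x\<bar>) \<le> exp (- (\<bar>y\<bar> powr a) - b * \<bar>y\<bar>)" if "x \<le> y" "y \<le> 0" for x y :: real
    using that by (intro *) auto
qed (use E in auto)

lemma exponential_sup_near_D_sup:
  fixes E \<gamma> :: real
  assumes q: "0 < q" and ab: "1 \<le> a" "0 \<le> b" and E: "0 < E" "0 < \<gamma>"
  shows "eventually (\<lambda>h. \<forall>N::nat. real N * h = E * h powr (- \<gamma>) \<longrightarrow>
      (SUP j\<in>{- int N .. int N}. (1 + \<bar>of_int j * h\<bar>) powr q * exp (- (\<bar>of_int j * h\<bar> powr a) - b * \<bar>of_int j * h\<bar>))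
        \<in> {D_sup q a b / 2 .. 2 * D_sup q a b}) (at_right 0)"
  unfolding D_sup_def
proof (rule grid_sup_near_sup)
  show "continuous_on UNIV (\<lambda>v::real. (1 + \<bar>v\<bar>) powr q * exp (- (\<bar>v\<bar> powr a) - b * \<bar>v\<bar>))"
    using ab by (intro continuous_intros continuous_on_powr') (auto simp: add_nonneg_eq_0_iff)
  show "(1 + \<bar>v\<bar>) powr q * exp (- (\<bar>v\<bar> powr a) - b * \<bar>v\<bar>) \<le> q powr q * exp 2" for v :: real
    by (rule weighted_exponential_profile_le[OF q ab])
qed (use E in auto)

lemma algebraic_sum_near_D_bar:
  fixes E \<gamma> p :: real
  assumes p: "1 < p" and E: "0 < E" "0 < \<gamma>"
  shows "eventually (\<lambda>h. \<forall>N::nat. real N * h = E * h powr (- \<gamma>) \<longrightarrow>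
      (\<Sum>j\<in>{- int N .. int N}. h / (1 + \<bar>of_int j * h\<bar>) powr p) \<in> {D_bar p / 2 .. 2 * D_bar p}) (at_right 0)"
proof -
  have "eventually (\<lambda>h. \<forall>N::nat. real N * h = E * h powr (- \<gamma>) \<longrightarrow>
      (\<Sum>j\<in>{- int N .. int N}. (1 + \<bar>of_int j * h\<bar>) powr (- p) * h) \<in> {D_bar p / 2 .. 2 * D_bar p}) (at_right 0)"
    unfolding D_bar_def
  proof (rule unimodal_grid_sum_near_integral[OF integrable_algebraic_profile[OF p]])
    show "0 < (LINT v::real|lborel. (1 + \<bar>v\<bar>) powr (- p))"
      using D_bar_eq[OF p] p by (simp add: D_bar_def)
  qed (use p E in \<open>auto intro!: powr_mono2'\<close>)
  moreover have "(1 + \<bar>v\<bar>) powr (- p) * h = h / (1 + \<bar>v\<bar>) powr p" for v h :: real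
    by (simp add: powr_minus divide_inverse)
  ultimately show ?thesis by simp
qed

lemma Linf_norm_bound:
  assumes "Linf_norm q g < \<infinity>"
  shows "\<bar>g x v\<bar> * (1 + \<bar>v\<bar>) powr q \<le> enn2real (Linf_norm q g)"
proof -
  have "ennreal (\<bar>g x v\<bar> * (1 + \<bar>v\<bar>) powr q) \<le> Linf_norm q g"
    unfolding Linf_norm_def by (rule SUP_upper2[of x], simp, rule SUP_upper2[of v]) auto
  then have "enn2real (ennreal (\<bar>g x v\<bar> * (1 + \<bar>v\<bar>) powr q)) \<le> enn2real (Linf_norm q g)"
    using assms by (intro enn2real_mono) auto
  then show ?thesis by simp
qed

lemma W_norm_finite_Linf_norm:
  assumes "W_norm 2 q g < \<infinity>"
  shows "Linf_norm q g < \<infinity>" "Linf_norm q (deriv_x g) < \<infinity>" "Linf_norm q (deriv_v g) < \<infinity>"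
proof -
  have "finite {(a, b). a + b \<le> (2::nat)}"
    by (rule finite_subset[of _ "{..2} \<times> {..2}"]) auto
  then have *: "Linf_norm q ((deriv_x ^^ a) ((deriv_v ^^ b) g)) < \<infinity>" if "a + b \<le> 2" for a b
  proof -
    have "(case (a, b) of (a, b) \<Rightarrow> Linf_norm q ((deriv_x ^^ a) ((deriv_v ^^ b) g))) \<le> W_norm 2 q g"
      unfolding W_norm_def by (rule member_le_sum) (use that \<open>finite _\<close> in auto)
    then show ?thesis using assms by auto
  qed
  show "Linf_norm q g < \<infinity>" "Linf_norm q (deriv_x g) < \<infinity>" "Linf_norm q (deriv_v g) < \<infinity>"
    using *[of 0 0] *[of 1 0] *[of 0 1] by auto
qed

text \<open>On a cell the value at the lower left corner exceeds the value at any other point by at most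
  the mesh size times an integrable profile, by the bounds on the two first derivatives.  Summing
  in velocity and then in space bounds the discrete mass by the continuous one plus \<open>O(\<Delta>x + \<Delta>v)\<close>.\<close>

lemma initial_mass_le_2:
  fixes f :: "real \<Rightarrow> real \<Rightarrow> real"
  assumes q: "1 < q" and f: "C_k 2 f" "W_norm 2 q f < \<infinity>" "\<And>x v. 0 \<le> f x v"
    and mass: "(LINT x:{0..1}|lborel. (LINT v|lborel. f x v)) = 1"
  shows "\<exists>l>0. \<forall>N\<^sub>x N\<^sub>v :: nat. \<forall>\<Delta>x \<Delta>v :: real.
     0 < \<Delta>x \<and> 0 < \<Delta>v \<and> real N\<^sub>x * \<Delta>x = 1 \<and> \<Delta>x < l \<and> \<Delta>v < l \<longrightarrow>
     (\<Sum>i\<in>{0 ..< int N\<^sub>x}. \<Sum>j\<in>{- int N\<^sub>v .. int N\<^sub>v}. f (of_int i * \<Delta>x) (of_int j * \<Delta>v) * \<Delta>x * \<Delta>v) \<le> 2"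
proof -
  have fin: "Linf_norm q f < \<infinity>" "Linf_norm q (deriv_x f) < \<infinity>" "Linf_norm q (deriv_v f) < \<infinity>"
    using W_norm_finite_Linf_norm[OF f(2)] by auto
  define C where "C = Max {enn2real (Linf_norm q f), enn2real (Linf_norm q (deriv_x f)), enn2real (Linf_norm q (deriv_v f)), 1}"
  have C1: "1 \<le> C" by (simp add: C_def)
  have weight: "a \<le> C * (1 + \<bar>v\<bar>) powr (- q)" if "a * (1 + \<bar>v\<bar>) powr q \<le> C" for a v :: real
  proof -
    have "a = a * (1 + \<bar>v\<bar>) powr q * (1 + \<bar>v\<bar>) powr (- q)" by (simp add: powr_minus field_simps add_nonneg_eq_0_iff)
    also have "\<dots> \<le> C * (1 + \<bar>v\<bar>) powr (- q)" using that by (intro mult_right_mono) auto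
    finally show ?thesis .
  qed
  have b0: "\<bar>f x v\<bar> \<le> C * (1 + \<bar>v\<bar>) powr (- q)" for x v
    using Linf_norm_bound[OF fin(1), of x v] by (intro weight) (simp add: C_def)
  have bx: "\<bar>deriv_x f x v\<bar> \<le> C * (1 + \<bar>v\<bar>) powr (- q)" for x v
    using Linf_norm_bound[OF fin(2), of x v] by (intro weight) (simp add: C_def)
  have bv: "\<bar>deriv_v f x v\<bar> \<le> C * (1 + \<bar>v\<bar>) powr (- q)" for x v
    using Linf_norm_bound[OF fin(3), of x v] by (intro weight) (simp add: C_def)
  have diff: "(\<lambda>s. f s v) differentiable at x" "(\<lambda>s. f x s) differentiable at v" for x v
    using f(1) by (auto simp: numeral_2_eq_2)
  have Dx: "((\<lambda>s. f s v) has_field_derivative deriv_x f x v) (at x)" for x v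
    unfolding deriv_x_def using diff(1) by (simp add: DERIV_deriv_iff_real_differentiable)
  have Dv: "((\<lambda>s. f x s) has_field_derivative deriv_v f x v) (at v)" for x v
    unfolding deriv_v_def using diff(2) by (simp add: DERIV_deriv_iff_real_differentiable)
  have int: "integrable lborel (f x)" for x
  proof (rule Bochner_Integration.integrable_bound)
    show "integrable lborel (\<lambda>v. C * (1 + \<bar>v\<bar>) powr (- q))" using integrable_algebraic_profile[OF q] by simp
    have "continuous_on UNIV (f x)" using Dv by (intro DERIV_continuous_on[of UNIV _ "deriv_v f x"]) (auto intro: has_field_derivative_at_within)
    then show "f x \<in> borel_measurable lborel" by (simp add: borel_measurable_continuous_onI)
    show "AE v in lborel. norm (f x v) \<le> norm (C * (1 + \<bar>v\<bar>) powr (- q))"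
      using b0 C1 by (auto simp: abs_mult)
  qed
  define \<rho> where "\<rho> x = (LINT v|lborel. f x v)" for x
  have \<rho>: "0 \<le> \<rho> x" for x unfolding \<rho>_def by (rule integral_nonneg_AE) (use f in auto)
  have int_\<rho>: "set_integrable lborel {0..1} \<rho>"
    using mass not_integrable_integral_eq unfolding set_integrable_def set_lebesgue_integral_def \<rho>_def by fastforce
  define l where "l = min 1 (1 / (2 * (C * 2 powr q * D_bar q)))"
  have Dq: "0 < D_bar q" using q by (simp add: D_bar_eq)
  have "(\<Sum>i\<in>{0 ..< int N\<^sub>x}. \<Sum>j\<in>{- int N\<^sub>v .. int N\<^sub>v}. f (of_int i * \<Delta>x) (of_int j * \<Delta>v) * \<Delta>x * \<Delta>v) \<le> 2"
    if h: "0 < \<Delta>x" "0 < \<Delta>v" "real N\<^sub>x * \<Delta>x = 1" "\<Delta>x < l" "\<Delta>v < l" for N\<^sub>x N\<^sub>v :: nat and \<Delta>x \<Delta>v :: real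
  proof -
    define \<delta> where "\<delta> = C * 2 powr q * (\<Delta>x + \<Delta>v)"
    have \<delta>: "0 \<le> \<delta>" using C1 h by (simp add: \<delta>_def)
    have "\<delta> \<le> C * 2 powr q * (2 * (1 / (2 * (C * 2 powr q * D_bar q))))"
      unfolding \<delta>_def using h C1 by (intro mult_left_mono) (auto simp: l_def)
    also have "\<dots> = 1 / D_bar q" using C1 Dq by (simp add: field_simps)
    finally have \<delta>D: "\<delta> * D_bar q \<le> 1" using Dq by (simp add: field_simps)
    have corner: "f (of_int i * \<Delta>x) (of_int j * \<Delta>v) \<le> f x v + \<delta> * (1 + \<bar>v\<bar>) powr (- q)"
      if x: "of_int i * \<Delta>x \<le> x" "x < (of_int i + 1) * \<Delta>x" and v: "of_int j * \<Delta>v \<le> v" "v < (of_int j + 1) * \<Delta>v"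
      for i j :: int and x v
    proof -
      have near: "(1 + \<bar>s\<bar>) powr (- q) \<le> 2 powr q * (1 + \<bar>v\<bar>) powr (- q)" if "s \<in> {of_int j * \<Delta>v .. v}" for s
      proof -
        have "\<bar>s - v\<bar> \<le> 1" using that v h by (auto simp: l_def algebra_simps)
        moreover have "\<bar>v\<bar> \<le> \<bar>s\<bar> + \<bar>s - v\<bar>" by arith
        ultimately have "(1 + \<bar>v\<bar>) / 2 \<le> 1 + \<bar>s\<bar>" by (simp add: field_simps)
        then have "(1 + \<bar>s\<bar>) powr (- q) \<le> ((1 + \<bar>v\<bar>) / 2) powr (- q)" using q by (intro powr_mono2') auto
        also have "\<dots> = 2 powr q * (1 + \<bar>v\<bar>) powr (- q)" by (simp add: powr_divide powr_minus field_simps)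
        finally show ?thesis .
      qed
      have "norm (f (of_int i * \<Delta>x) (of_int j * \<Delta>v) - f x (of_int j * \<Delta>v))
          \<le> C * (1 + \<bar>of_int j * \<Delta>v\<bar>) powr (- q) * norm (of_int i * \<Delta>x - x)"
        by (rule field_differentiable_bound[of UNIV]) (use Dx bx in auto)
      also have "\<dots> \<le> C * (2 powr q * (1 + \<bar>v\<bar>) powr (- q)) * \<Delta>x"
        using near[of "of_int j * \<Delta>v"] v x C1 by (intro mult_mono) (auto simp: algebra_simps)
      finally have 1: "f (of_int i * \<Delta>x) (of_int j * \<Delta>v) \<le> f x (of_int j * \<Delta>v) + C * (2 powr q * (1 + \<bar>v\<bar>) powr (- q)) * \<Delta>x"
        by (simp add: abs_le_iff)
      have "norm (f x (of_int j * \<Delta>v) - f x v)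
          \<le> C * (2 powr q * (1 + \<bar>v\<bar>) powr (- q)) * norm (of_int j * \<Delta>v - v)"
      proof (rule field_differentiable_bound[of "{of_int j * \<Delta>v .. v}"])
        fix s assume s: "s \<in> {of_int j * \<Delta>v .. v}"
        show "((\<lambda>s. f x s) has_field_derivative deriv_v f x s) (at s within {of_int j * \<Delta>v .. v})"
          using Dv by (rule has_field_derivative_at_within)
        have "norm (deriv_v f x s) \<le> C * (1 + \<bar>s\<bar>) powr (- q)" using bv by simp
        also have "\<dots> \<le> C * (2 powr q * (1 + \<bar>v\<bar>) powr (- q))" using near[OF s] C1 by (intro mult_left_mono) auto
        finally show "norm (deriv_v f x s) \<le> C * (2 powr q * (1 + \<bar>v\<bar>) powr (- q))" .
      qed (use v in auto)
      also have "\<dots> \<le> C * (2 powr q * (1 + \<bar>v\<bar>) powr (- q)) * \<Delta>v"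
        using v C1 by (intro mult_left_mono) (auto simp: algebra_simps)
      finally show ?thesis using 1 by (simp add: \<delta>_def algebra_simps abs_le_iff)
    qed
    have vsum: "(\<Sum>j\<in>{- int N\<^sub>v .. int N\<^sub>v}. f (of_int i * \<Delta>x) (of_int j * \<Delta>v) * \<Delta>v) \<le> \<rho> x + \<delta> * D_bar q"
      if x: "of_int i * \<Delta>x \<le> x" "x < (of_int i + 1) * \<Delta>x" for i :: int and x
    proof -
      have I: "integrable lborel (\<lambda>v. f x v + \<delta> * (1 + \<bar>v\<bar>) powr (- q))"
        using int integrable_algebraic_profile[OF q] by auto
      have "(\<Sum>j\<in>{- int N\<^sub>v .. int N\<^sub>v}. f (of_int i * \<Delta>x) (of_int j * \<Delta>v) * \<Delta>v)
          \<le> (LINT v:UNIV|lborel. f x v + \<delta> * (1 + \<bar>v\<bar>) powr (- q))"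
      proof (rule cell_sum_le_integral[OF h(2)])
        show "v \<in> UNIV \<and> f (of_int i * \<Delta>x) (of_int \<lfloor>v / \<Delta>v\<rfloor> * \<Delta>v) \<le> f x v + \<delta> * (1 + \<bar>v\<bar>) powr (- q)" for v
          using corner[OF x, of "\<lfloor>v / \<Delta>v\<rfloor>" v] floor_cell_iff[OF h(2), of v "\<lfloor>v / \<Delta>v\<rfloor>"] by auto
      qed (use I f(3) \<delta> in \<open>auto simp: set_integrable_def\<close>)
      also have "\<dots> = \<rho> x + \<delta> * D_bar q"
        using int integrable_algebraic_profile[OF q] by (simp add: set_lebesgue_integral_def \<rho>_def D_bar_def)
      finally show ?thesis .
    qed
    have "(\<Sum>i\<in>{0 ..< int N\<^sub>x}. (\<Sum>j\<in>{- int N\<^sub>v .. int N\<^sub>v}. f (of_int i * \<Delta>x) (of_int j * \<Delta>v) * \<Delta>v) * \<Delta>x)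
        \<le> (LINT x:{0..1}|lborel. \<rho> x + \<delta> * D_bar q)"
    proof (rule cell_sum_le_integral[OF h(1)])
      show "set_integrable lborel {0..1} (\<lambda>x. \<rho> x + \<delta> * D_bar q)"
        using int_\<rho> by (intro set_integral_add) (auto simp: set_integrable_def)
      show "0 \<le> \<rho> x + \<delta> * D_bar q" for x using \<rho>[of x] \<delta> Dq by simp
      fix x assume i: "\<lfloor>x / \<Delta>x\<rfloor> \<in> {0 ..< int N\<^sub>x}"
      then have "0 \<le> x / \<Delta>x" "x / \<Delta>x < real N\<^sub>x" by (auto simp: floor_less_iff)
      then have "0 \<le> x" "x < 1" using h by (auto simp: field_simps)
      moreover have "(\<Sum>j\<in>{- int N\<^sub>v .. int N\<^sub>v}. f (of_int \<lfloor>x / \<Delta>x\<rfloor> * \<Delta>x) (of_int j * \<Delta>v) * \<Delta>v) \<le> \<rho> x + \<delta> * D_bar q"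
        by (rule vsum) (use floor_cell_iff[OF h(1), of x "\<lfloor>x / \<Delta>x\<rfloor>"] in auto)
      ultimately show "x \<in> {0..1} \<and> (\<Sum>j\<in>{- int N\<^sub>v .. int N\<^sub>v}. f (of_int \<lfloor>x / \<Delta>x\<rfloor> * \<Delta>x) (of_int j * \<Delta>v) * \<Delta>v) \<le> \<rho> x + \<delta> * D_bar q"
        by simp
    qed auto
    also have "\<dots> = (LINT x:{0..1}|lborel. \<rho> x) + (LINT x:{0..1::real}|lborel. \<delta> * D_bar q)"
      using int_\<rho> by (intro set_integral_add) (auto simp: set_integrable_def)
    also have "\<dots> = 1 + \<delta> * D_bar q" using mass by (simp add: \<rho>_def set_lebesgue_integral_def)
    finally show ?thesis using \<delta>D by (simp add: sum_distrib_left sum_distrib_right mult_ac)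
  qed
  moreover have "0 < l" using C1 Dq by (simp add: l_def)
  ultimately show ?thesis by blast
qed

section \<open>Moments of a nonnegative grid function of the velocity\<close>

lemma card_grid_points_le:
  fixes h R U :: real
  assumes h: "0 < h" and R: "0 \<le> R"
  shows "real (card {j \<in> J. \<bar>of_int j * h - U\<bar> \<le> R}) * h \<le> 2 * R + h"
proof -
  have "{j \<in> J. \<bar>of_int j * h - U\<bar> \<le> R} \<subseteq> {\<lceil>(U - R) / h\<rceil> .. \<lfloor>(U + R) / h\<rfloor>}"
    using h by (auto simp: ceiling_le_iff le_floor_iff field_simps abs_le_iff)
  then have "card {j \<in> J. \<bar>of_int j * h - U\<bar> \<le> R} \<le> card {\<lceil>(U - R) / h\<rceil> .. \<lfloor>(U + R) / h\<rfloor>}"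
    by (intro card_mono) auto
  then have "real (card {j \<in> J. \<bar>of_int j * h - U\<bar> \<le> R}) \<le> max 0 (of_int (\<lfloor>(U + R) / h\<rfloor> - \<lceil>(U - R) / h\<rceil> + 1))"
    by simp
  also have "\<dots> \<le> max 0 ((U + R) / h - (U - R) / h + 1)"
    unfolding of_int_add of_int_diff of_int_1
    using of_int_floor_le[of "(U + R) / h"] le_of_int_ceiling[of "(U - R) / h"] by (intro max.mono) linarith+
  also have "(U + R) / h - (U - R) / h + 1 = 2 * R / h + 1" by (simp add: diff_divide_distrib add_divide_distrib)
  also have "max 0 (2 * R / h + 1) = 2 * R / h + 1" using h R by (simp add: max_def)
  finally show ?thesis using h by (simp add: field_simps)
qed

text \<open>A nonnegative grid function with its macroscopic quantities.  These are given by equations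
  free of division, which is how they enter all estimates.\<close>

locale grid_density =
  fixes J :: "int set" and h :: real and w :: "int \<Rightarrow> real" and \<rho> U T :: real
  assumes J: "finite J" and h: "0 < h"
    and w: "\<And>j. j \<in> J \<Longrightarrow> 0 \<le> w j"
    and mass: "\<rho> = (\<Sum>j\<in>J. w j * h)" and \<rho>: "0 < \<rho>"
    and momentum: "\<rho> * U = (\<Sum>j\<in>J. w j * (of_int j * h) * h)"
    and heat: "\<rho> * T = (\<Sum>j\<in>J. w j * (of_int j * h - U)\<^sup>2 * h)" and T: "0 < T"
begin

lemma second_moment: "(\<Sum>j\<in>J. w j * (of_int j * h)\<^sup>2 * h) = \<rho> * (T + U\<^sup>2)"
proof -
  have "\<rho> * T = (\<Sum>j\<in>J. w j * (of_int j * h)\<^sup>2 * h - 2 * U * (w j * (of_int j * h) * h) + U\<^sup>2 * (w j * h))"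
    unfolding heat by (intro sum.cong) (auto simp: power2_eq_square algebra_simps)
  also have "\<dots> = (\<Sum>j\<in>J. w j * (of_int j * h)\<^sup>2 * h) - 2 * U * (\<rho> * U) + U\<^sup>2 * \<rho>"
    unfolding momentum unfolding mass by (simp add: sum.distrib sum_subtractf sum_distrib_left)
  finally show ?thesis by (simp add: power2_eq_square algebra_simps)
qed

text \<open>By Chebyshev's inequality three quarters of the mass lie within \<open>2 \<surd>T\<close> of the mean velocity,
  so a bound on the density there bounds the mass.\<close>

lemma mass_le_local_sup:
  assumes m: "\<And>j. j \<in> J \<Longrightarrow> \<bar>of_int j * h - U\<bar> \<le> 2 * sqrt T \<Longrightarrow> w j \<le> m" and "0 \<le> m"
  shows "\<rho> \<le> 4 / 3 * m * (4 * sqrt T + h)"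
proof -
  let ?near = "{j \<in> J. \<bar>of_int j * h - U\<bar> \<le> 2 * sqrt T}"
  have "w j * h \<le> (if j \<in> ?near then w j * h else 0) + w j * (of_int j * h - U)\<^sup>2 * h / (4 * T)"
    if j: "j \<in> J" for j
  proof (cases "j \<in> ?near")
    case True
    then show ?thesis using w[OF j] h T by simp
  next
    case False
    then have "(2 * sqrt T)\<^sup>2 \<le> \<bar>of_int j * h - U\<bar>\<^sup>2" using j T by (intro power_mono) auto
    then have "4 * T \<le> (of_int j * h - U)\<^sup>2" using T by (simp add: power_mult_distrib)
    then have "w j * h * (4 * T) \<le> w j * h * (of_int j * h - U)\<^sup>2" using w[OF j] h by (intro mult_left_mono) auto
    then show ?thesis using False j T by (simp add: field_simps)
  qed
  then have "\<rho> \<le> (\<Sum>j\<in>J. (if j \<in> ?near then w j * h else 0) + w j * (of_int j * h - U)\<^sup>2 * h / (4 * T))"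
    unfolding mass by (rule sum_mono)
  also have "\<dots> = (\<Sum>j\<in>?near. w j * h) + \<rho> * T / (4 * T)"
    unfolding heat using J by (simp add: sum.distrib sum_divide_distrib sum.inter_filter)
  also have "(\<Sum>j\<in>?near. w j * h) \<le> (\<Sum>j\<in>?near. m * h)" using m h by (intro sum_mono) auto
  also have "\<dots> = m * (real (card ?near) * h)" by simp
  also have "\<dots> \<le> m * (2 * (2 * sqrt T) + h)"
    using \<open>0 \<le> m\<close> T h by (intro mult_left_mono card_grid_points_le) auto
  finally show ?thesis using T by simp
qed

text \<open>A bounded density cannot concentrate, so its thermal energy bounds the temperature from
  below; the mesh must be fine enough not to allow all the mass to sit in a few grid points.\<close>

lemma temperature_lower_bound:
  assumes m: "\<And>j. j \<in> J \<Longrightarrow> w j \<le> m" and fine: "8 * m * h ^ 3 \<le> \<rho> * T"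
  shows "h \<le> sqrt T" and "\<rho> * T \<le> 8 * m * sqrt T ^ 3"
proof -
  have s: "0 < sqrt T" "sqrt T ^ 2 = T" using T by auto
  have "J \<noteq> {}" using mass \<rho> by auto
  then have m0: "0 \<le> m" using m w by (meson all_not_in_conv order_trans)
  have "\<rho> * T \<le> 4 / 3 * m * (4 * sqrt T + h) * T"
    using mass_le_local_sup[of m] m m0 T by (intro mult_right_mono) auto
  then have *: "\<rho> * T \<le> 4 / 3 * m * (4 * sqrt T + h) * sqrt T ^ 2" by (simp only: s)
  have P: "0 < \<rho> * T" using \<rho> T by simp
  have "m \<noteq> 0"
  proof
    assume "m = 0"
    with * have "\<rho> * T \<le> 0" by (simp only: mult_zero_right mult_zero_left)
    with P show False by linarith
  qed
  with m0 have m1: "0 < m" by simp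
  show hs: "h \<le> sqrt T"
  proof (rule ccontr)
    assume "\<not> h \<le> sqrt T"
    then have lt: "sqrt T < h" by simp
    have "4 / 3 * m * (4 * sqrt T + h) * sqrt T ^ 2 \<le> 4 / 3 * m * (5 * h) * h ^ 2"
      using lt m1 s h by (intro mult_mono power_mono) auto
    also have "\<dots> < 8 * m * h ^ 3" using m1 h by (simp add: power2_eq_square power3_eq_cube)
    finally show False using * fine by linarith
  qed
  have "4 / 3 * m * (4 * sqrt T + h) * sqrt T ^ 2 \<le> 4 / 3 * m * (5 * sqrt T) * sqrt T ^ 2"
    using hs m1 s by (intro mult_right_mono mult_left_mono) auto
  also have "\<dots> \<le> 8 * m * sqrt T ^ 3" using m1 s by (simp add: power2_eq_square power3_eq_cube)
  finally show "\<rho> * T \<le> 8 * m * sqrt T ^ 3" using * by linarith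
qed

end

section \<open>The discrete Maxwellian\<close>

text \<open>The integral is \<open>1\<close>, and the error term of the comparison is at most \<open>1\<close> because \<open>4 \<le> 2 \<pi>\<close>.\<close>

lemma maxwellian_grid_sum_le:
  fixes h U T :: real
  assumes h: "0 < h" "h \<le> sqrt T" and T: "0 < T" and K: "finite K"
  shows "(\<Sum>j\<in>K. 1 / sqrt (2 * pi * T) * exp (- (\<bar>of_int j * h - U\<bar>\<^sup>2 / (2 * T))) * h) \<le> 2"
proof -
  have nd: "normal_density U (sqrt T) v = 1 / sqrt (2 * pi * T) * exp (- (\<bar>v - U\<bar>\<^sup>2 / (2 * T)))" for v
    using T by (simp add: normal_density_def)
  have anti: "normal_density U (sqrt T) y \<le> normal_density U (sqrt T) x" if "\<bar>x - U\<bar> \<le> \<bar>y - U\<bar>" for x y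
    unfolding nd using that T
    by (intro mult_left_mono) (auto simp: abs_le_square_iff intro!: divide_right_mono)
  have "(\<Sum>j\<in>K. normal_density U (sqrt T) (of_int j * h) * h)
      \<le> (LINT v|lborel. normal_density U (sqrt T) v) + 2 * h * (1 / sqrt (2 * pi * T))"
  proof (rule unimodal_grid_sum_le[where c = U])
    show "normal_density U (sqrt T) y \<le> 1 / sqrt (2 * pi * T)" for y
      unfolding nd using T by (intro mult_left_le) auto
  qed (use h T K in \<open>auto intro!: anti\<close>)
  moreover have "(LINT v|lborel. normal_density U (sqrt T) v) = 1" using T by simp
  moreover have "2 * h * (1 / sqrt (2 * pi * T)) \<le> 1"
  proof -
    have "(2 * h)\<^sup>2 \<le> (2 * sqrt T)\<^sup>2" using h by (intro power_mono) auto
    also have "\<dots> = 4 * T" using T by (simp add: power_mult_distrib)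
    also have "\<dots> \<le> 2 * pi * T" using T pi_gt3 by (intro mult_right_mono) auto
    finally have "2 * h \<le> sqrt (2 * pi * T)" by (rule real_le_rsqrt)
    then show ?thesis using T by (simp add: field_simps)
  qed
  ultimately show ?thesis unfolding nd by linarith
qed

text \<open>The factor \<open>2 / (q - 3)\<close> is the integral of the algebraic profile of order \<open>q - 2\<close>, and \<open>4\<close> its
  discretisation error on a grid of mesh at most \<open>2\<close>.\<close>

definition moment_const :: "real \<Rightarrow> real" where
  "moment_const q = 3 * 4 powr (q - 3) * (2 / (q - 3) + 4)"

text \<open>The leading \<open>8\<close> bounds the unweighted Maxwellian.  The terms in the inner parentheses stand for
  velocities far from the mean velocity, for a mean velocity at most four times the thermal speed,
  and for a larger one; they are added instead of taking their maximum.\<close>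

definition maxwellian_const :: "real \<Rightarrow> real" where
  "maxwellian_const q =
     2 powr q * (8 + 2 powr q * (q powr (q / 2) * moment_const q + 4 * moment_const q + 8 * 2 powr q))"

lemma moment_const_pos: "3 < q \<Longrightarrow> 0 < moment_const q"
  by (simp add: moment_const_def add_pos_pos)

lemma maxwellian_const_ge_1:
  assumes "3 < q"
  shows "1 \<le> maxwellian_const q"
proof -
  have "1 * 1 \<le> maxwellian_const q"
    unfolding maxwellian_const_def
    using assms moment_const_pos[OF assms]
    by (intro mult_mono) (auto simp: ge_one_powr_ge_zero intro!: add_increasing2)
  then show ?thesis by simp
qed

locale decaying_grid_density = grid_density +
  fixes q N :: real
  assumes q: "3 < q" and decay: "\<And>j. j \<in> J \<Longrightarrow> w j \<le> N * (1 + \<bar>of_int j * h\<bar>) powr (- q)"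
    and fine: "h \<le> sqrt T"
begin

abbreviation R where "R \<equiv> sqrt (T + U\<^sup>2)"

lemma R_pos: "0 < R" and sqrt_T_le_R: "sqrt T \<le> R" and abs_U_le_R: "\<bar>U\<bar> \<le> R"
  using T by (auto simp: add_pos_nonneg intro: real_le_rsqrt)

lemma N_nonneg: "0 \<le> N"
proof -
  have "J \<noteq> {}" using mass \<rho> by auto
  then obtain j where j: "j \<in> J" by auto
  have "0 \<le> N * (1 + \<bar>of_int j * h\<bar>) powr (- q)" using decay[OF j] w[OF j] by linarith
  then show ?thesis by (auto simp: zero_le_mult_iff add_nonneg_eq_0_iff)
qed

lemma mass_le_temperature: "\<rho> \<le> 8 * N * sqrt T"
proof -
  have "w j \<le> N" if "j \<in> J" for j
  proof -
    have "(1 + \<bar>of_int j * h\<bar>) powr (- q) \<le> 1"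
      using q powr_mono2'[of "- q" 1 "1 + \<bar>of_int j * h\<bar>"] by simp
    then show ?thesis using decay[OF that] N_nonneg mult_left_le by fastforce
  qed
  then have "\<rho> \<le> 4 / 3 * N * (4 * sqrt T + h)" using N_nonneg by (intro mass_le_local_sup) auto
  also have "\<dots> \<le> 4 / 3 * N * (5 * sqrt T)" using fine N_nonneg by (intro mult_left_mono) auto
  also have "\<dots> \<le> 8 * N * sqrt T" using N_nonneg T by simp
  finally show ?thesis .
qed

text \<open>The second moment \<open>\<rho> R\<^sup>2\<close> is split at speed \<open>R / 2\<close>: slow particles carry at most a quarter
  of it, and the fast ones are controlled by the decay, whose tail scales like \<open>R\<close> to the power
  \<open>3 - q\<close>.\<close>

lemma mass_mult_powr_R_le: "\<rho> * R powr (q - 1) \<le> moment_const q * N"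
proof -
  define r where "r = R / 2"
  have r: "0 < r" using R_pos by (simp add: r_def)
  have pt: "w j * (of_int j * h)\<^sup>2 * h
      \<le> r\<^sup>2 * (w j * h) + N * (r / 2) powr (2 - q) * r * ((1 + \<bar>of_int j * (h / r)\<bar>) powr (- (q - 2)) * (h / r))"
    if j: "j \<in> J" for j
  proof (cases "\<bar>of_int j * h\<bar> \<le> r")
    case True
    then have "\<bar>of_int j * h\<bar>\<^sup>2 \<le> r\<^sup>2" by (intro power_mono) auto
    then have "w j * h * (of_int j * h)\<^sup>2 \<le> w j * h * r\<^sup>2" using w[OF j] h by (intro mult_left_mono) auto
    moreover have "0 \<le> N * (r / 2) powr (2 - q) * r * ((1 + \<bar>of_int j * (h / r)\<bar>) powr (- (q - 2)) * (h / r))"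
      using N_nonneg r h by (intro mult_nonneg_nonneg) auto
    ultimately show ?thesis by (simp add: mult_ac)
  next
    case False
    define u where "u = \<bar>of_int j * h\<bar>"
    have u: "r < u" "0 < u" using False r by (auto simp: u_def)
    \<comment> \<open>Replacing \<open>u\<close> by the smaller \<open>(r + u) / 2\<close> makes the bound a profile in \<open>u / r\<close> without singularity.\<close>
    have "w j * u\<^sup>2 \<le> N * (1 + u) powr (- q) * u\<^sup>2"
      using decay[OF j] by (intro mult_right_mono) (auto simp: u_def)
    also have "\<dots> \<le> N * u powr (- q) * u\<^sup>2"
      using u q N_nonneg by (intro mult_right_mono mult_left_mono powr_mono2') auto
    also have "\<dots> = N * u powr (2 - q)" using u by (simp add: powr_diff powr_minus field_simps)
    also have "\<dots> \<le> N * (r / 2 * (1 + u / r)) powr (2 - q)"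
      using u r q N_nonneg by (intro mult_left_mono powr_mono2') (auto simp: field_simps add_pos_pos)
    also have "\<dots> = N * (r / 2) powr (2 - q) * (1 + u / r) powr (2 - q)"
    proof -
      have "(r / 2 * (1 + u / r)) powr (2 - q) = (r / 2) powr (2 - q) * (1 + u / r) powr (2 - q)"
        by (rule powr_mult; use u r in simp)
      then show ?thesis by (simp only: mult.assoc)
    qed
    finally have "w j * u\<^sup>2 * h \<le> N * (r / 2) powr (2 - q) * (1 + u / r) powr (2 - q) * h"
      using h by (intro mult_right_mono) auto
    moreover have "u / r = \<bar>of_int j * (h / r)\<bar>" using r by (simp add: u_def abs_mult)
    moreover have "0 \<le> r\<^sup>2 * (w j * h)" using w[OF j] h by simp
    ultimately show ?thesis using r by (simp add: u_def mult_ac)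
  qed
  have "\<rho> * R\<^sup>2 = (\<Sum>j\<in>J. w j * (of_int j * h)\<^sup>2 * h)"
    using second_moment T by simp
  also have "\<dots> \<le> (\<Sum>j\<in>J. r\<^sup>2 * (w j * h)
      + N * (r / 2) powr (2 - q) * r * ((1 + \<bar>of_int j * (h / r)\<bar>) powr (- (q - 2)) * (h / r)))"
    by (rule sum_mono[OF pt])
  also have "\<dots> = r\<^sup>2 * \<rho> + N * (r / 2) powr (2 - q) * r * (\<Sum>j\<in>J. (1 + \<bar>of_int j * (h / r)\<bar>) powr (- (q - 2)) * (h / r))"
    unfolding mass by (simp only: sum.distrib sum_distrib_left)
  also have "\<dots> \<le> r\<^sup>2 * \<rho> + N * (r / 2) powr (2 - q) * r * (2 / (q - 3) + 4)"
  proof -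
    have "(\<Sum>j\<in>J. (1 + \<bar>of_int j * (h / r)\<bar>) powr (- (q - 2)) * (h / r)) \<le> 2 / (q - 2 - 1) + 2 * (h / r)"
      by (rule algebraic_grid_sum_le) (use q r h J in auto)
    also have "h / r \<le> 2" using order_trans[OF fine sqrt_T_le_R] r by (simp add: field_simps r_def)
    finally have "(\<Sum>j\<in>J. (1 + \<bar>of_int j * (h / r)\<bar>) powr (- (q - 2)) * (h / r)) \<le> 2 / (q - 3) + 4" by simp
    then show ?thesis using N_nonneg r by (intro add_left_mono mult_left_mono) auto
  qed
  finally have "\<rho> * R\<^sup>2 - r\<^sup>2 * \<rho> \<le> N * (r / 2) powr (2 - q) * r * (2 / (q - 3) + 4)" by simp
  moreover have "\<rho> * R\<^sup>2 - r\<^sup>2 * \<rho> = 3 / 4 * (\<rho> * R\<^sup>2)" by (simp add: r_def power_divide)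
  moreover have "(r / 2) powr (2 - q) * r = 2 * (R / 4) powr (3 - q)"
    using R_pos powr_mult_base[of "R / 4" "2 - q"] by (simp add: r_def mult_ac)
  ultimately have "3 / 4 * (\<rho> * R\<^sup>2) \<le> N * (2 * (R / 4) powr (3 - q)) * (2 / (q - 3) + 4)"
    by (simp add: mult.assoc)
  moreover have "0 \<le> N * (R / 4) powr (3 - q) * (2 / (q - 3) + 4)"
    using N_nonneg q by (intro mult_nonneg_nonneg) auto
  ultimately have "\<rho> * R\<^sup>2 \<le> 3 * N * (R / 4) powr (3 - q) * (2 / (q - 3) + 4)"
    by (simp add: mult_ac)
  then have "\<rho> * R\<^sup>2 * R powr (q - 3) \<le> 3 * N * (R / 4) powr (3 - q) * (2 / (q - 3) + 4) * R powr (q - 3)"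
    by (intro mult_right_mono) auto
  moreover have "R\<^sup>2 * R powr (q - 3) = R powr (q - 1)"
    using R_pos powr_add[of R 2 "q - 3"] by simp
  moreover have "(R / 4) powr (3 - q) * R powr (q - 3) = 4 powr (q - 3)"
    using R_pos powr_minus[of "R / 4" "q - 3"] by (simp add: powr_divide)
  ultimately show ?thesis by (simp add: moment_const_def mult_ac)
qed

text \<open>The weight is bounded near the origin.  For large \<open>\<bar>v\<bar>\<close>, either \<open>v\<close> is far from \<open>U\<close> and the
  Gaussian absorbs the weight at the price of \<open>T\<close> to the power \<open>q / 2\<close>, or \<open>\<bar>v\<bar> \<le> 2 \<bar>U\<bar>\<close>.  In the
  latter case the moment bound suffices unless \<open>T\<close> is small relative to \<open>U\<^sup>2\<close>; then the mass sits
  at speeds comparable to \<open>\<bar>U\<bar>\<close>, where the decay makes the density itself small.\<close>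

lemma maxwellian_weighted_le:
  "\<rho> / sqrt (2 * pi * T) * exp (- (\<bar>v - U\<bar>\<^sup>2 / (2 * T))) * (1 + \<bar>v\<bar>) powr q \<le> maxwellian_const q * N"
proof -
  define s where "s = sqrt T"
  define e where "e = exp (- (\<bar>v - U\<bar>\<^sup>2 / (2 * T)))"
  define K where "K = q powr (q / 2) * moment_const q + 4 * moment_const q + 8 * 2 powr q"
  have s: "0 < s" "s\<^sup>2 = T" "s \<le> R" using T sqrt_T_le_R by (auto simp: s_def)
  have e: "0 \<le> e" "e \<le> 1" using T by (auto simp: e_def)
  have mc: "0 < moment_const q" using q by (rule moment_const_pos)
  have q': "0 \<le> q - 1" using q by simp
  have base: "\<rho> / s \<le> 8 * N" using mass_le_temperature s by (simp add: s_def field_simps)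
  have split: "x powr q = x * x powr (q - 1)" if "0 \<le> x" for x :: real
    using that powr_mult_base[of x "q - 1"] by simp
  have Rq: "x powr (q - 1) \<le> R powr (q - 1)" if "0 \<le> x" "x \<le> R" for x
    using that q' by (intro powr_mono2) auto
  have mom: "\<rho> * R powr (q - 1) \<le> moment_const q * N" by (rule mass_mult_powr_R_le)
  have large: "\<rho> / s * e * \<bar>v\<bar> powr q \<le> 2 powr q * K * N"
  proof (cases "\<bar>v\<bar> \<le> 2 * \<bar>v - U\<bar>")
    case True
    define x where "x = \<bar>v - U\<bar> / s"
    have x: "0 \<le> x" "\<bar>v - U\<bar> = s * x" using s by (auto simp: x_def)
    have "(x\<^sup>2 / 2) powr (q / 2) \<le> (q / 2) powr (q / 2) * exp (x\<^sup>2 / 2)"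
      using q by (intro powr_le_exp) auto
    then have "2 powr (q / 2) * (x\<^sup>2 / 2) powr (q / 2) \<le> 2 powr (q / 2) * ((q / 2) powr (q / 2) * exp (x\<^sup>2 / 2))"
      by (intro mult_left_mono) auto
    moreover have "2 powr (q / 2) * (x\<^sup>2 / 2) powr (q / 2) = x powr q"
    proof -
      have "2 powr (q / 2) * (x\<^sup>2 / 2) powr (q / 2) = (2 * (x\<^sup>2 / 2)) powr (q / 2)"
        by (rule powr_mult[symmetric]; simp)
      also have "2 * (x\<^sup>2 / 2) = x powr 2" using x by simp
      also have "(x powr 2) powr (q / 2) = x powr q" by (simp add: powr_powr)
      finally show ?thesis .
    qed
    moreover have "2 powr (q / 2) * ((q / 2) powr (q / 2) * exp (x\<^sup>2 / 2)) = q powr (q / 2) * exp (x\<^sup>2 / 2)"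
    proof -
      have "2 powr (q / 2) * (q / 2) powr (q / 2) = (2 * (q / 2)) powr (q / 2)"
        by (rule powr_mult[symmetric]; use q in simp)
      then show ?thesis by simp
    qed
    ultimately have xq: "x powr q \<le> q powr (q / 2) * exp (x\<^sup>2 / 2)" by simp
    have "e = exp (- (x\<^sup>2 / 2))" unfolding e_def x(2) using s T by (simp add: power_mult_distrib)
    then have xe: "x powr q * e \<le> q powr (q / 2)"
      using mult_right_mono[OF xq e(1)] by (simp flip: exp_add add: mult.assoc)
    have "\<bar>v\<bar> powr q \<le> (2 * (s * x)) powr q" using True q x by (intro powr_mono2) auto
    also have "\<dots> = 2 powr q * (s * s powr (q - 1)) * x powr q"
      using x s split[of s] by (simp add: powr_mult)
    finally have "\<rho> / s * e * \<bar>v\<bar> powr q \<le> \<rho> / s * e * (2 powr q * (s * s powr (q - 1)) * x powr q)"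
      using \<rho> s e by (intro mult_left_mono) auto
    also have "\<dots> = 2 powr q * (\<rho> * s powr (q - 1)) * (x powr q * e)" using s by (simp add: field_simps)
    also have "\<dots> \<le> 2 powr q * (\<rho> * R powr (q - 1)) * q powr (q / 2)"
      using Rq[of s] s \<rho> xe e by (intro mult_mono mult_left_mono) auto
    also have "\<dots> \<le> 2 powr q * (moment_const q * N) * q powr (q / 2)"
      using mom by (intro mult_right_mono mult_left_mono) auto
    also have "\<dots> = 2 powr q * (q powr (q / 2) * moment_const q) * N" by simp
    also have "\<dots> \<le> 2 powr q * K * N"
      unfolding K_def using mc N_nonneg by (intro mult_right_mono mult_left_mono) auto
    finally show ?thesis .
  next
    case False
    have "x \<le> 2 * z" if "\<not> x \<le> 2 * y" "x - z \<le> y" for x y z :: real using that by linarith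
    from this[OF False abs_triangle_ineq2] have vU: "\<bar>v\<bar> \<le> 2 * \<bar>U\<bar>" .
    have "\<bar>v\<bar> powr q \<le> (2 * \<bar>U\<bar>) powr q" using vU q by (intro powr_mono2) auto
    then have "\<bar>v\<bar> powr q \<le> 2 powr q * \<bar>U\<bar> powr q" by (simp add: powr_mult)
    then have "\<rho> / s * e * \<bar>v\<bar> powr q \<le> \<rho> / s * 1 * (2 powr q * \<bar>U\<bar> powr q)"
      using \<rho> s e by (intro mult_mono) auto
    then have 1: "\<rho> / s * e * \<bar>v\<bar> powr q \<le> 2 powr q * (\<rho> / s * \<bar>U\<bar> powr q)" by (simp add: mult_ac)
    have "\<rho> / s * \<bar>U\<bar> powr q \<le> K * N"
    proof (cases "\<bar>U\<bar> \<le> 4 * s")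
      case True
      have "\<rho> / s * \<bar>U\<bar> powr q = \<rho> / s * (\<bar>U\<bar> * \<bar>U\<bar> powr (q - 1))" using split[of "\<bar>U\<bar>"] by simp
      also have "\<dots> \<le> \<rho> / s * (4 * s * R powr (q - 1))"
        using True Rq[of "\<bar>U\<bar>"] abs_U_le_R \<rho> s by (intro mult_left_mono mult_mono) auto
      also have "\<dots> = 4 * (\<rho> * R powr (q - 1))" using s by simp
      also have "\<dots> \<le> 4 * moment_const q * N" using mom by simp
      also have "\<dots> \<le> K * N"
        unfolding K_def using mc N_nonneg by (intro mult_right_mono) auto
      finally show ?thesis .
    next
      case False
      have U: "0 < \<bar>U\<bar>" using False s by linarith
      define m where "m = N * (\<bar>U\<bar> / 2) powr (- q)"
      have m: "0 \<le> m" using N_nonneg by (simp add: m_def)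
      have "w j \<le> m" if j: "j \<in> J" "\<bar>of_int j * h - U\<bar> \<le> 2 * sqrt T" for j
      proof -
        have "\<bar>U\<bar> / 2 \<le> 1 + \<bar>of_int j * h\<bar>" using j(2) False unfolding s_def by linarith
        then have "(1 + \<bar>of_int j * h\<bar>) powr (- q) \<le> (\<bar>U\<bar> / 2) powr (- q)"
          using U q by (intro powr_mono2') auto
        then have "N * (1 + \<bar>of_int j * h\<bar>) powr (- q) \<le> m"
          unfolding m_def using N_nonneg by (intro mult_left_mono) auto
        then show ?thesis using decay[OF j(1)] by linarith
      qed
      then have "\<rho> \<le> 4 / 3 * m * (4 * s + h)" unfolding s_def by (intro mass_le_local_sup m)
      also have "\<dots> \<le> 4 / 3 * m * (6 * s)" 
      proof (rule mult_left_mono)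
        show "4 * s + h \<le> 6 * s" using fine s(1) unfolding s_def by linarith
      qed (use m in simp)
      finally have "\<rho> / s \<le> 8 * m" using s by (simp add: field_simps)
      then have "\<rho> / s * \<bar>U\<bar> powr q \<le> 8 * m * \<bar>U\<bar> powr q" by (intro mult_right_mono) auto
      also have "m * \<bar>U\<bar> powr q = 2 powr q * N"
        using U by (simp add: m_def powr_divide powr_minus field_simps)
      then have "8 * m * \<bar>U\<bar> powr q = 8 * 2 powr q * N" by simp
      also have "\<dots> \<le> K * N"
        unfolding K_def using mc N_nonneg by (intro mult_right_mono) auto
      finally show ?thesis .
    qed
    then have "2 powr q * (\<rho> / s * \<bar>U\<bar> powr q) \<le> 2 powr q * (K * N)" by (intro mult_left_mono) auto
    then show ?thesis using 1 by (simp add: mult.assoc)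
  qed
  have "(1 + \<bar>v\<bar>) powr q \<le> (2 * max 1 \<bar>v\<bar>) powr q" using q by (intro powr_mono2) auto
  also have "\<dots> = 2 powr q * max 1 \<bar>v\<bar> powr q" by (simp add: powr_mult)
  also have "\<dots> \<le> 2 powr q * (1 + \<bar>v\<bar> powr q)" by (intro mult_left_mono) (auto simp: max_def)
  finally have "\<rho> / s * e * (1 + \<bar>v\<bar>) powr q \<le> \<rho> / s * e * (2 powr q * (1 + \<bar>v\<bar> powr q))"
    using \<rho> s e by (intro mult_left_mono) auto
  also have "\<dots> = 2 powr q * (\<rho> / s * e + \<rho> / s * e * \<bar>v\<bar> powr q)" by (simp add: algebra_simps)
  also have "\<dots> \<le> 2 powr q * (8 * N + 2 powr q * K * N)"
  proof (intro mult_left_mono add_mono large)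
    have "\<rho> / s * e \<le> \<rho> / s * 1" using \<rho> s e by (intro mult_left_mono) auto
    then show "\<rho> / s * e \<le> 8 * N" using base by linarith
  qed auto
  also have "\<dots> = maxwellian_const q * N" by (simp add: maxwellian_const_def K_def algebra_simps)
  finally have 2: "\<rho> / s * e * (1 + \<bar>v\<bar>) powr q \<le> maxwellian_const q * N" .
  have "s \<le> sqrt (2 * pi * T)" unfolding s_def using T pi_gt3 by (intro real_sqrt_le_mono) auto
  then have "\<rho> / sqrt (2 * pi * T) \<le> \<rho> / s" using \<rho> s by (intro divide_left_mono) auto
  then have "\<rho> / sqrt (2 * pi * T) * e * (1 + \<bar>v\<bar>) powr q \<le> \<rho> / s * e * (1 + \<bar>v\<bar>) powr q"
    using e by (intro mult_right_mono) auto
  with 2 show ?thesis by (simp add: e_def)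
qed

end

section \<open>One transport step\<close>

lemma pos_part_nonneg: "0 \<le> pos_part a" and neg_part_nonneg: "0 \<le> neg_part a"
  and pos_part_add_neg_part: "pos_part a + neg_part a = \<bar>a\<bar>"
  by (auto simp: pos_part_def neg_part_def)

lemma transport_expand:
  assumes "i \<in> I_x N\<^sub>x" "j \<in> I_v N\<^sub>v"
  shows "transport N\<^sub>x N\<^sub>v \<Delta>x \<Delta>v \<Delta>t g i j =
    (1 - \<Delta>t / \<Delta>x * \<bar>vg \<Delta>v j\<bar> - \<Delta>t / \<Delta>v * \<bar>e_field N\<^sub>x N\<^sub>v \<Delta>x \<Delta>v g i\<bar>) * g i j
    + (\<Delta>t / \<Delta>x * pos_part (vg \<Delta>v j)) * g ((i - 1) mod int N\<^sub>x) j
    + (\<Delta>t / \<Delta>x * neg_part (vg \<Delta>v j)) * g ((i + 1) mod int N\<^sub>x) j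
    + (\<Delta>t / \<Delta>v * pos_part (e_field N\<^sub>x N\<^sub>v \<Delta>x \<Delta>v g i)) * g i (max (- int N\<^sub>v) (j - 1))
    + (\<Delta>t / \<Delta>v * neg_part (e_field N\<^sub>x N\<^sub>v \<Delta>x \<Delta>v g i)) * g i (min (int N\<^sub>v) (j + 1))"
proof -
  have "i mod int N\<^sub>x = i" "max (- int N\<^sub>v) (min (int N\<^sub>v) j) = j"
    "max (- int N\<^sub>v) (min (int N\<^sub>v) (j - 1)) = max (- int N\<^sub>v) (j - 1)"
    "max (- int N\<^sub>v) (min (int N\<^sub>v) (j + 1)) = min (int N\<^sub>v) (j + 1)"
    using assms by (auto simp: I_x_def I_v_def)
  then show ?thesis by (simp add: transport_def ext_def Let_def algebra_simps)
qed

lemma weighted_sum_ge: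
  fixes a b :: real
  assumes "0 \<le> c0" "0 \<le> c1" "0 \<le> c2" "0 \<le> c3" "0 \<le> c4"
    and "a \<le> x0" "a \<le> x1" "a \<le> x2" "b \<le> y1" "b \<le> y2"
  shows "(c0 + c1 + c2) * a + (c3 + c4) * b \<le> c0 * x0 + c1 * x1 + c2 * x2 + c3 * y1 + c4 * y2"
proof -
  have "c0 * a \<le> c0 * x0" "c1 * a \<le> c1 * x1" "c2 * a \<le> c2 * x2" "c3 * b \<le> c3 * y1" "c4 * b \<le> c4 * y2"
    using assms by (auto intro: mult_left_mono)
  then show ?thesis by (simp add: distrib_right)
qed

text \<open>Under the CFL condition the step is an average: the values at the same velocity carry the
  weight \<open>1 - \<theta>\<close> and those at a neighbouring velocity the weight \<open>\<theta>\<close>.\<close>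

lemma transport_average:
  fixes \<Delta>t \<Delta>x \<Delta>v :: real
  assumes i: "i \<in> I_x N\<^sub>x" and j: "j \<in> I_v N\<^sub>v"
    and pos: "0 \<le> \<Delta>t" "0 < \<Delta>x" "0 < \<Delta>v"
    and cfl: "\<Delta>t / \<Delta>x * \<bar>vg \<Delta>v j\<bar> + \<Delta>t / \<Delta>v * \<bar>e_field N\<^sub>x N\<^sub>v \<Delta>x \<Delta>v g i\<bar> \<le> 1"
  defines "\<theta> \<equiv> \<Delta>t / \<Delta>v * \<bar>e_field N\<^sub>x N\<^sub>v \<Delta>x \<Delta>v g i\<bar>"
  shows transport_ge: "\<lbrakk>\<And>i'. i' \<in> I_x N\<^sub>x \<Longrightarrow> a \<le> g i' j;
      \<And>j'. j' \<in> I_v N\<^sub>v \<Longrightarrow> \<bar>j' - j\<bar> \<le> 1 \<Longrightarrow> b \<le> g i j'\<rbrakk>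
      \<Longrightarrow> (1 - \<theta>) * a + \<theta> * b \<le> transport N\<^sub>x N\<^sub>v \<Delta>x \<Delta>v \<Delta>t g i j"
    and transport_le: "\<lbrakk>\<And>i'. i' \<in> I_x N\<^sub>x \<Longrightarrow> g i' j \<le> a;
      \<And>j'. j' \<in> I_v N\<^sub>v \<Longrightarrow> \<bar>j' - j\<bar> \<le> 1 \<Longrightarrow> g i j' \<le> b\<rbrakk>
      \<Longrightarrow> transport N\<^sub>x N\<^sub>v \<Delta>x \<Delta>v \<Delta>t g i j \<le> (1 - \<theta>) * a + \<theta> * b"
proof -
  define E where "E = e_field N\<^sub>x N\<^sub>v \<Delta>x \<Delta>v g i"
  define v where "v = vg \<Delta>v j"
  define c1 where "c1 = \<Delta>t / \<Delta>x * pos_part v"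
  define c2 where "c2 = \<Delta>t / \<Delta>x * neg_part v"
  define c3 where "c3 = \<Delta>t / \<Delta>v * pos_part E"
  define c4 where "c4 = \<Delta>t / \<Delta>v * neg_part E"
  define c0 where "c0 = 1 - \<Delta>t / \<Delta>x * \<bar>v\<bar> - \<Delta>t / \<Delta>v * \<bar>E\<bar>"
  have c: "0 \<le> c0" "0 \<le> c1" "0 \<le> c2" "0 \<le> c3" "0 \<le> c4"
    using pos cfl by (auto simp: c0_def c1_def c2_def c3_def c4_def E_def v_def pos_part_nonneg neg_part_nonneg)
  have "c1 + c2 = \<Delta>t / \<Delta>x * \<bar>v\<bar>" "c3 + c4 = \<Delta>t / \<Delta>v * \<bar>E\<bar>"
    unfolding c1_def c2_def c3_def c4_def by (simp_all only: distrib_left[symmetric] pos_part_add_neg_part)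
  then have \<theta>: "c3 + c4 = \<theta>" "c0 + c1 + c2 = 1 - \<theta>"
    by (simp_all add: c0_def \<theta>_def E_def)
  have mem: "(i - 1) mod int N\<^sub>x \<in> I_x N\<^sub>x" "(i + 1) mod int N\<^sub>x \<in> I_x N\<^sub>x"
    "max (- int N\<^sub>v) (j - 1) \<in> I_v N\<^sub>v" "min (int N\<^sub>v) (j + 1) \<in> I_v N\<^sub>v"
    "\<bar>max (- int N\<^sub>v) (j - 1) - j\<bar> \<le> 1" "\<bar>min (int N\<^sub>v) (j + 1) - j\<bar> \<le> 1"
    using i j by (auto simp: I_x_def I_v_def)
  have eq: "transport N\<^sub>x N\<^sub>v \<Delta>x \<Delta>v \<Delta>t g i j = c0 * g i j + c1 * g ((i - 1) mod int N\<^sub>x) j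
      + c2 * g ((i + 1) mod int N\<^sub>x) j + c3 * g i (max (- int N\<^sub>v) (j - 1)) + c4 * g i (min (int N\<^sub>v) (j + 1))"
    unfolding transport_expand[OF i j] c0_def c1_def c2_def c3_def c4_def E_def v_def ..
  show "(1 - \<theta>) * a + \<theta> * b \<le> transport N\<^sub>x N\<^sub>v \<Delta>x \<Delta>v \<Delta>t g i j"
    if "\<And>i'. i' \<in> I_x N\<^sub>x \<Longrightarrow> a \<le> g i' j" "\<And>j'. j' \<in> I_v N\<^sub>v \<Longrightarrow> \<bar>j' - j\<bar> \<le> 1 \<Longrightarrow> b \<le> g i j'"
    unfolding eq \<theta>(2)[symmetric] unfolding \<theta>(1)[symmetric]
    by (rule weighted_sum_ge) (use c that i mem in blast)+
  show "transport N\<^sub>x N\<^sub>v \<Delta>x \<Delta>v \<Delta>t g i j \<le> (1 - \<theta>) * a + \<theta> * b"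
    if h: "\<And>i'. i' \<in> I_x N\<^sub>x \<Longrightarrow> g i' j \<le> a" "\<And>j'. j' \<in> I_v N\<^sub>v \<Longrightarrow> \<bar>j' - j\<bar> \<le> 1 \<Longrightarrow> g i j' \<le> b"
  proof -
    have "(c0 + c1 + c2) * (- a) + (c3 + c4) * (- b) \<le> c0 * (- g i j) + c1 * (- g ((i - 1) mod int N\<^sub>x) j)
      + c2 * (- g ((i + 1) mod int N\<^sub>x) j) + c3 * (- g i (max (- int N\<^sub>v) (j - 1))) + c4 * (- g i (min (int N\<^sub>v) (j + 1)))"
      using c h i mem by (intro weighted_sum_ge) auto
    then show ?thesis unfolding eq \<theta> by simp
  qed
qed

lemma sum_shift_down:
  fixes u :: "int \<Rightarrow> real"
  shows "(\<Sum>j\<in>I_v N. u (max (- int N) (j - 1))) = (\<Sum>j\<in>I_v N. u j) + u (- int N) - u (int N)"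
proof -
  have "I_v N = insert (- int N) {- int N + 1 .. int N}" by (auto simp: I_v_def)
  then have "(\<Sum>j\<in>I_v N. u (max (- int N) (j - 1)))
      = u (- int N) + (\<Sum>j\<in>{- int N + 1 .. int N}. u (max (- int N) (j - 1)))" by simp
  also have "(\<Sum>j\<in>{- int N + 1 .. int N}. u (max (- int N) (j - 1))) = (\<Sum>j\<in>{- int N ..< int N}. u j)"
    by (rule sum.reindex_bij_witness[of _ "\<lambda>j. j + 1" "\<lambda>j. j - 1"]) auto
  also have "I_v N = insert (int N) {- int N ..< int N}" by (auto simp: I_v_def)
  then have "(\<Sum>j\<in>{- int N ..< int N}. u j) = (\<Sum>j\<in>I_v N. u j) - u (int N)" by simp
  finally show ?thesis by simp
qed

lemma sum_shift_up:
  fixes u :: "int \<Rightarrow> real"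
  shows "(\<Sum>j\<in>I_v N. u (min (int N) (j + 1))) = (\<Sum>j\<in>I_v N. u j) + u (int N) - u (- int N)"
proof -
  have "(\<Sum>j\<in>I_v N. u (min (int N) (j + 1))) = (\<Sum>j\<in>I_v N. u (- max (- int N) (j - 1)))"
    by (rule sum.reindex_bij_witness[of _ uminus uminus]) (auto simp: I_v_def intro!: arg_cong[of _ _ u])
  also have "\<dots> = (\<Sum>j\<in>I_v N. u (- j)) + u (int N) - u (- int N)"
    using sum_shift_down[of "\<lambda>j. u (- j)" N] by simp
  also have "(\<Sum>j\<in>I_v N. u (- j)) = (\<Sum>j\<in>I_v N. u j)"
    by (rule sum.reindex_bij_witness[of _ uminus uminus]) (auto simp: I_v_def)
  finally show ?thesis .
qed

lemma sum_periodic_shift: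
  fixes u :: "int \<Rightarrow> real"
  shows "(\<Sum>i\<in>I_x N. u ((i - 1) mod int N)) = (\<Sum>i\<in>I_x N. u i)"
    and "(\<Sum>i\<in>I_x N. u ((i + 1) mod int N)) = (\<Sum>i\<in>I_x N. u i)"
proof -
  show "(\<Sum>i\<in>I_x N. u ((i - 1) mod int N)) = (\<Sum>i\<in>I_x N. u i)"
    by (rule sum.reindex_bij_witness[of _ "\<lambda>i. (i + 1) mod int N" "\<lambda>i. (i - 1) mod int N"])
       (auto simp: I_x_def mod_simps)
  show "(\<Sum>i\<in>I_x N. u ((i + 1) mod int N)) = (\<Sum>i\<in>I_x N. u i)"
    by (rule sum.reindex_bij_witness[of _ "\<lambda>i. (i - 1) mod int N" "\<lambda>i. (i + 1) mod int N"])
       (auto simp: I_x_def mod_simps)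
qed

text \<open>Transport in space conserves mass by periodicity; transport in velocity telescopes to the
  Neumann boundary fluxes.\<close>

lemma transport_total:
  "(\<Sum>i\<in>I_x N\<^sub>x. \<Sum>j\<in>I_v N\<^sub>v. transport N\<^sub>x N\<^sub>v \<Delta>x \<Delta>v \<Delta>t g i j)
    = (\<Sum>i\<in>I_x N\<^sub>x. \<Sum>j\<in>I_v N\<^sub>v. g i j)
      + \<Delta>t / \<Delta>v * (\<Sum>i\<in>I_x N\<^sub>x. e_field N\<^sub>x N\<^sub>v \<Delta>x \<Delta>v g i * (g i (- int N\<^sub>v) - g i (int N\<^sub>v)))"
proof -
  let ?E = "e_field N\<^sub>x N\<^sub>v \<Delta>x \<Delta>v g" and ?v = "vg \<Delta>v"
  define A where "A i j = \<Delta>t / \<Delta>x * (pos_part (?v j) * (g ((i - 1) mod int N\<^sub>x) j - g i j)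
      + neg_part (?v j) * (g ((i + 1) mod int N\<^sub>x) j - g i j))" for i j
  define B where "B i j = \<Delta>t / \<Delta>v * (pos_part (?E i) * (g i (max (- int N\<^sub>v) (j - 1)) - g i j)
      + neg_part (?E i) * (g i (min (int N\<^sub>v) (j + 1)) - g i j))" for i j
  have "(\<Sum>i\<in>I_x N\<^sub>x. \<Sum>j\<in>I_v N\<^sub>v. transport N\<^sub>x N\<^sub>v \<Delta>x \<Delta>v \<Delta>t g i j)
      = (\<Sum>i\<in>I_x N\<^sub>x. \<Sum>j\<in>I_v N\<^sub>v. g i j + A i j + B i j)"
    by (intro sum.cong refl)
       (simp add: transport_expand A_def B_def pos_part_add_neg_part[symmetric] algebra_simps)
  also have "\<dots> = (\<Sum>i\<in>I_x N\<^sub>x. \<Sum>j\<in>I_v N\<^sub>v. g i j) + (\<Sum>i\<in>I_x N\<^sub>x. \<Sum>j\<in>I_v N\<^sub>v. A i j)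
      + (\<Sum>i\<in>I_x N\<^sub>x. \<Sum>j\<in>I_v N\<^sub>v. B i j)"
    by (simp add: sum.distrib)
  also have "(\<Sum>i\<in>I_x N\<^sub>x. \<Sum>j\<in>I_v N\<^sub>v. A i j) = (\<Sum>j\<in>I_v N\<^sub>v. \<Sum>i\<in>I_x N\<^sub>x. A i j)" by (rule sum.swap)
  also have "\<dots> = 0"
  proof (rule sum.neutral, rule ballI)
    fix j
    show "(\<Sum>i\<in>I_x N\<^sub>x. A i j) = 0"
      unfolding A_def sum_distrib_left[symmetric] sum.distrib sum_subtractf
      using sum_periodic_shift[of "\<lambda>i. g i j" N\<^sub>x] by simp
  qed
  also have "(\<Sum>i\<in>I_x N\<^sub>x. \<Sum>j\<in>I_v N\<^sub>v. B i j)
      = (\<Sum>i\<in>I_x N\<^sub>x. \<Delta>t / \<Delta>v * (?E i * (g i (- int N\<^sub>v) - g i (int N\<^sub>v))))"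
  proof (rule sum.cong[OF refl])
    fix i
    have E: "?E i = pos_part (?E i) - neg_part (?E i)" by (auto simp: pos_part_def neg_part_def)
    have "(\<Sum>j\<in>I_v N\<^sub>v. B i j) = \<Delta>t / \<Delta>v * (pos_part (?E i) * (g i (- int N\<^sub>v) - g i (int N\<^sub>v))
        + neg_part (?E i) * (g i (int N\<^sub>v) - g i (- int N\<^sub>v)))"
      unfolding B_def sum_distrib_left[symmetric] sum.distrib sum_subtractf
      using sum_shift_down[of "g i" N\<^sub>v] sum_shift_up[of "g i" N\<^sub>v] by simp
    also have "\<dots> = \<Delta>t / \<Delta>v * (?E i * (g i (- int N\<^sub>v) - g i (int N\<^sub>v)))"
      by (subst (3) E) (simp add: algebra_simps)
    finally show "(\<Sum>j\<in>I_v N\<^sub>v. B i j) = \<Delta>t / \<Delta>v * (?E i * (g i (- int N\<^sub>v) - g i (int N\<^sub>v)))" .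
  qed
  finally show ?thesis by (simp add: sum_distrib_left)
qed

text \<open>The kernel is bounded by one, and the constant background contributes at most its total charge,
  which is one.\<close>

lemma abs_e_field_le:
  assumes i: "i \<in> I_x N\<^sub>x" and pos: "0 < \<Delta>x" "0 < \<Delta>v" and N: "real N\<^sub>x * \<Delta>x = 1"
    and g: "\<And>i j. i \<in> I_x N\<^sub>x \<Longrightarrow> j \<in> I_v N\<^sub>v \<Longrightarrow> 0 \<le> g i j"
  shows "\<bar>e_field N\<^sub>x N\<^sub>v \<Delta>x \<Delta>v g i\<bar> \<le> (\<Sum>i\<in>I_x N\<^sub>x. \<Sum>j\<in>I_v N\<^sub>v. g i j * \<Delta>x * \<Delta>v) + 1"
proof -
  have unit: "0 \<le> xg \<Delta>x k \<and> xg \<Delta>x k \<le> 1" if "k \<in> I_x N\<^sub>x" for k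
  proof -
    have "of_int k * \<Delta>x \<le> real N\<^sub>x * \<Delta>x" using that pos by (intro mult_right_mono) (auto simp: I_x_def)
    then show ?thesis using that pos N by (auto simp: xg_def I_x_def)
  qed
  have "\<bar>e_field N\<^sub>x N\<^sub>v \<Delta>x \<Delta>v g i\<bar> \<le> (\<Sum>k\<in>I_x N\<^sub>x. \<bar>K_kernel (xg \<Delta>x i) (xg \<Delta>x k) * (rho N\<^sub>v \<Delta>v g k - 1) * \<Delta>x\<bar>)"
    unfolding e_field_def by (rule sum_abs)
  also have "\<dots> \<le> (\<Sum>k\<in>I_x N\<^sub>x. (rho N\<^sub>v \<Delta>v g k + 1) * \<Delta>x)"
  proof (rule sum_mono)
    fix k assume k: "k \<in> I_x N\<^sub>x"
    have "0 \<le> rho N\<^sub>v \<Delta>v g k" unfolding rho_def using g[OF k] pos by (intro sum_nonneg) auto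
    then have "\<bar>rho N\<^sub>v \<Delta>v g k - 1\<bar> \<le> rho N\<^sub>v \<Delta>v g k + 1" by linarith
    moreover have "\<bar>K_kernel (xg \<Delta>x i) (xg \<Delta>x k)\<bar> \<le> 1" using unit[OF i] unit[OF k] by (auto simp: K_kernel_def)
    ultimately have "\<bar>K_kernel (xg \<Delta>x i) (xg \<Delta>x k)\<bar> * \<bar>rho N\<^sub>v \<Delta>v g k - 1\<bar> * \<Delta>x \<le> 1 * (rho N\<^sub>v \<Delta>v g k + 1) * \<Delta>x"
      using pos by (intro mult_right_mono mult_mono) auto
    then show "\<bar>K_kernel (xg \<Delta>x i) (xg \<Delta>x k) * (rho N\<^sub>v \<Delta>v g k - 1) * \<Delta>x\<bar> \<le> (rho N\<^sub>v \<Delta>v g k + 1) * \<Delta>x"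
      using pos by (simp add: abs_mult)
  qed
  also have "\<dots> = (\<Sum>k\<in>I_x N\<^sub>x. rho N\<^sub>v \<Delta>v g k * \<Delta>x) + real N\<^sub>x * \<Delta>x"
    by (simp add: distrib_right sum.distrib I_x_def)
  also have "(\<Sum>k\<in>I_x N\<^sub>x. rho N\<^sub>v \<Delta>v g k * \<Delta>x) = (\<Sum>i\<in>I_x N\<^sub>x. \<Sum>j\<in>I_v N\<^sub>v. g i j * \<Delta>x * \<Delta>v)"
    by (simp add: rho_def sum_distrib_right sum_distrib_left mult_ac)
  finally show ?thesis using N by simp
qed

section \<open>Profiles under a velocity shift\<close>

lemma powr_increment_le:
  fixes u d a :: real
  assumes "1 \<le> a" "a \<le> 2" "0 \<le> u" "0 \<le> d" "d \<le> 1"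
  shows "(u + d) powr a - u powr a \<le> a * d * (1 + u)"
proof (cases "d = 0")
  case False
  then have d: "u < u + d" using assms by simp
  have "continuous_on {u .. u + d} (\<lambda>x. x powr a)"
    using assms by (intro continuous_on_powr') (auto intro!: continuous_intros)
  moreover have "((\<lambda>x. x powr a) has_derivative (\<lambda>y. a * x powr (a - 1) * y)) (at x)" if "u < x" for x
    using that assms has_real_derivative_powr[of x a] by (simp add: has_field_derivative_def)
  ultimately obtain x where x: "u < x" "x < u + d"
      "(u + d) powr a - u powr a = a * x powr (a - 1) * (u + d - u)"
    using mvt[OF d, of "\<lambda>x. x powr a" "\<lambda>x y. a * x powr (a - 1) * y"] by auto
  have "x powr (a - 1) \<le> (1 + u) powr (a - 1)" using x assms by (intro powr_mono2) auto
  also have "\<dots> \<le> (1 + u) powr 1" using assms by (intro powr_mono) auto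
  finally have "a * x powr (a - 1) * (u + d - u) \<le> a * (1 + u) * d"
    using assms by (intro mult_mono) auto
  then show ?thesis using x by (simp add: mult_ac)
qed simp

lemma convex_combination_exp_ge:
  fixes s \<theta> :: real
  assumes "0 \<le> \<theta>" "\<theta> \<le> 1"
  shows "exp (- (\<theta> * s)) \<le> (1 - \<theta>) + \<theta> * exp (- s)"
  using convex_onD[OF exp_convex, of \<theta> 0 "- s"] assms by simp

lemma one_plus_powr_le:
  fixes d q :: real
  assumes "1 \<le> q" "0 \<le> d" "d \<le> 1"
  shows "(1 + d) powr q \<le> 1 + (2 powr q - 1) * d"
  using convex_onD[OF powr_convex[OF assms(1)], of d 1 2] assms by (simp add: algebra_simps)

text \<open>Convexity of the power turns the ratio of the weights at neighbouring velocities into a term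
  linear in the mesh size; its slope is the factor \<open>2\<^sup>q - 1\<close> in \<open>C_E2\<close>.\<close>

lemma weight_shift_le:
  fixes u u' d q :: real
  assumes "1 \<le> q" "0 \<le> d" "d \<le> 1" "0 \<le> u" "0 \<le> u'" "u \<le> u' + d"
  shows "(1 + u') powr (- q) \<le> (1 + (2 powr q - 1) * d) * (1 + u) powr (- q)"
proof -
  have "(1 + d) * (1 + u') = 1 + u' + d + d * u'" by (simp add: algebra_simps)
  then have "1 + u \<le> (1 + d) * (1 + u')" using assms mult_nonneg_nonneg[of d u'] by linarith
  then have "(1 + u) powr q \<le> ((1 + d) * (1 + u')) powr q" using assms by (intro powr_mono2) auto
  also have "\<dots> = (1 + d) powr q * (1 + u') powr q" by (rule powr_mult; use assms in simp)
  also have "\<dots> \<le> (1 + (2 powr q - 1) * d) * (1 + u') powr q"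
    using assms by (intro mult_right_mono one_plus_powr_le) auto
  finally show ?thesis using assms by (simp add: powr_minus field_simps)
qed

lemma sum_symmetric_squares:
  "(\<Sum>j\<in>{- int M .. int M}. (of_int j :: real)\<^sup>2) = real M * (real M + 1) * (2 * real M + 1) / 3"
proof (induction M)
  case (Suc M)
  have "{- int (Suc M) .. int (Suc M)} = insert (- int (Suc M)) (insert (int (Suc M)) {- int M .. int M})" by auto
  then show ?case using Suc by (simp add: power2_eq_square field_simps)
qed simp

lemma sum_symmetric_odd: "(\<Sum>j\<in>{- int M .. int M}. (of_int j :: real)) = 0"
proof -
  have "(\<Sum>j\<in>{- int M .. int M}. (of_int j :: real)) = (\<Sum>j\<in>{- int M .. int M}. - of_int j)"
    by (rule sum.reindex_bij_witness[of _ uminus uminus]) auto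
  then show ?thesis by (simp add: sum_negf)
qed

text \<open>The energy of the part of the distribution at speeds at most one already bounds the thermal
  energy from below, whatever the mean velocity: by symmetry of the grid a shift of the centre only
  adds energy.\<close>

lemma thermal_energy_ge:
  fixes h U \<kappa> :: real
  assumes h: "0 < h" "h \<le> 1 / 16" and N: "1 \<le> real N * h" and \<kappa>: "0 \<le> \<kappa>"
    and w: "\<And>j. j \<in> {- int N .. int N} \<Longrightarrow> 0 \<le> w j"
      "\<And>j. j \<in> {- int N .. int N} \<Longrightarrow> \<bar>of_int j * h\<bar> \<le> 1 \<Longrightarrow> \<kappa> \<le> w j"
  shows "\<kappa> / 2 \<le> (\<Sum>j\<in>{- int N .. int N}. w j * (of_int j * h - U)\<^sup>2 * h)"
proof -
  define M where "M = nat \<lfloor>1 / h\<rfloor>"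
  have M: "1 / h - 1 < real M" "real M \<le> 1 / h"
    using h by (auto simp: M_def)
  have Mh: "1 - h < real M * h" "real M * h \<le> 1" using M h by (auto simp: field_simps)
  have MN: "M \<le> N" using order_trans[OF Mh(2) N] h by simp
  have le1: "\<bar>of_int j * h\<bar> \<le> 1" if "j \<in> {- int M .. int M}" for j
  proof -
    have "\<bar>of_int j\<bar> \<le> real M" using that by auto
    then have "\<bar>of_int j\<bar> * h \<le> real M * h" using h by (intro mult_right_mono) auto
    moreover have "\<bar>of_int j * h\<bar> = \<bar>of_int j\<bar> * h" using h by (simp add: abs_mult)
    ultimately show ?thesis using Mh by linarith
  qed
  have "1 / 2 \<le> 2 / 3 * (15 / 16 :: real) ^ 3" by (simp add: power3_eq_cube)
  also have "\<dots> \<le> 2 / 3 * (real M * h) ^ 3" using Mh h by (intro mult_left_mono power_mono) auto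
  also have "\<dots> \<le> real M * (real M + 1) * (2 * real M + 1) / 3 * h ^ 3"
  proof -
    have "2 * real M ^ 3 \<le> real M * (real M + 1) * (2 * real M + 1)"
      by (simp add: power3_eq_cube algebra_simps)
    then have "2 * real M ^ 3 * h ^ 3 \<le> real M * (real M + 1) * (2 * real M + 1) * h ^ 3"
      using h by (intro mult_right_mono) auto
    then show ?thesis by (simp add: power_mult_distrib mult_ac)
  qed
  also have "\<dots> = (\<Sum>j\<in>{- int M .. int M}. (of_int j)\<^sup>2) * h ^ 3"
    by (simp add: sum_symmetric_squares)
  also have "\<dots> = (\<Sum>j\<in>{- int M .. int M}. (of_int j * h)\<^sup>2 * h)"
    unfolding sum_distrib_right by (intro sum.cong) (auto simp: power2_eq_square power3_eq_cube)
  also have "\<dots> \<le> (\<Sum>j\<in>{- int M .. int M}. (of_int j * h - U)\<^sup>2 * h)"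
  proof -
    have "(\<Sum>j\<in>{- int M .. int M}. (of_int j * h - U)\<^sup>2 * h)
        = (\<Sum>j\<in>{- int M .. int M}. (of_int j * h)\<^sup>2 * h - 2 * U * h\<^sup>2 * of_int j + U\<^sup>2 * h)"
      by (intro sum.cong) (auto simp: power2_eq_square algebra_simps)
    also have "\<dots> = (\<Sum>j\<in>{- int M .. int M}. (of_int j * h)\<^sup>2 * h) + (\<Sum>j\<in>{- int M .. int M}. U\<^sup>2 * h)"
      by (simp only: sum.distrib sum_subtractf sum_distrib_left[symmetric] sum_symmetric_odd)
    finally show ?thesis using h by (simp add: sum_nonneg)
  qed
  finally have "\<kappa> * (1 / 2) \<le> \<kappa> * (\<Sum>j\<in>{- int M .. int M}. (of_int j * h - U)\<^sup>2 * h)"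
    using \<kappa> by (intro mult_left_mono) auto
  also have "\<dots> = (\<Sum>j\<in>{- int M .. int M}. \<kappa> * (of_int j * h - U)\<^sup>2 * h)"
    by (simp add: sum_distrib_left mult_ac)
  also have "\<dots> \<le> (\<Sum>j\<in>{- int M .. int M}. w j * (of_int j * h - U)\<^sup>2 * h)"
    using w(2) le1 MN h by (intro sum_mono mult_right_mono) auto
  also have "\<dots> \<le> (\<Sum>j\<in>{- int N .. int N}. w j * (of_int j * h - U)\<^sup>2 * h)"
    using w(1) MN h by (intro sum_mono2) auto
  finally show ?thesis by simp
qed

section \<open>The discrete solution on an admissible mesh\<close>

lemma less_Min_memD:
  fixes x :: real
  assumes "finite A" "a \<in> A" "x < Min A"
  shows "x < a"
  using assms Min_le[of A a] by linarith

text \<open>The data, one admissible mesh, and the choice \<open>C_M = 1000\<close>, a cube so that its powers in \<open>a_1\<close>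
  can be evaluated.\<close>

locale bgk_scheme =
  fixes q \<alpha> \<gamma> \<eta>\<^sub>1 \<eta>\<^sub>2 \<epsilon> T\<^sub>f C\<^sub>0 :: real and f\<^sub>0 :: "real \<Rightarrow> real \<Rightarrow> real" and l :: real
    and N\<^sub>x N\<^sub>v N\<^sub>t :: nat and \<Delta>x \<Delta>v \<Delta>t :: real
  assumes q: "3 < q" and \<alpha>: "1 \<le> \<alpha>" "\<alpha> \<le> 2" and \<gamma>: "1/2 \<le> \<gamma>" "\<gamma> < 1"
    and \<eta>: "0 < \<eta>\<^sub>1" "\<eta>\<^sub>1 < \<eta>\<^sub>2" "\<eta>\<^sub>2 < 1" and \<epsilon>: "0 < \<epsilon>" and T\<^sub>f: "0 < T\<^sub>f" and C\<^sub>0: "0 < C\<^sub>0"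
    and f\<^sub>0_norm: "Linf_norm q f\<^sub>0 < \<infinity>" and f\<^sub>0_ge: "\<And>x v. C\<^sub>0 * exp (- (\<bar>v\<bar> powr \<alpha>)) \<le> f\<^sub>0 x v"
    and mesh: "mesh_small q \<alpha> \<gamma> \<epsilon> T\<^sub>f f\<^sub>0 l"
    and \<Delta>: "0 < \<Delta>x" "0 < \<Delta>v" "0 < \<Delta>t"
    and N\<^sub>x: "real N\<^sub>x * \<Delta>x = 1" and N\<^sub>v: "real N\<^sub>v * \<Delta>v = C_E1 \<epsilon> T\<^sub>f * \<Delta>v powr (- \<gamma>)"
    and N\<^sub>t: "real N\<^sub>t * \<Delta>t = T\<^sub>f"
    and \<Delta>x_less: "\<Delta>x < r_x \<alpha> \<epsilon> T\<^sub>f l"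
    and \<Delta>v_less: "\<Delta>v < r_v q \<alpha> \<gamma> \<eta>\<^sub>1 \<eta>\<^sub>2 \<epsilon> T\<^sub>f C\<^sub>0 f\<^sub>0 1000 (maxwellian_const q) l \<Delta>x"
    and \<Delta>t_less: "\<Delta>t < \<eta>\<^sub>2 * (\<Delta>v / C_E1 \<epsilon> T\<^sub>f)"
begin

abbreviation E1 where "E1 \<equiv> C_E1 \<epsilon> T\<^sub>f"
abbreviation E2 where "E2 \<equiv> C_E2 q \<epsilon> T\<^sub>f"
abbreviation D where "D \<equiv> D_const \<alpha> \<epsilon> T\<^sub>f"
abbreviation S where "S \<equiv> S_const \<alpha> \<eta>\<^sub>1 \<epsilon> T\<^sub>f"
abbreviation F where "F \<equiv> F_const q f\<^sub>0"
abbreviation CX where "CX \<equiv> maxwellian_const q"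
abbreviation Q where "Q \<equiv> Q_const q \<alpha> \<eta>\<^sub>1 \<epsilon> T\<^sub>f CX"
abbreviation v where "v \<equiv> vg \<Delta>v"
abbreviation Ix where "Ix \<equiv> I_x N\<^sub>x"
abbreviation Iv where "Iv \<equiv> I_v N\<^sub>v"

definition total :: "(int \<Rightarrow> int \<Rightarrow> real) \<Rightarrow> real" where
  "total g = (\<Sum>i\<in>Ix. \<Sum>j\<in>Iv. g i j * \<Delta>x * \<Delta>v)"

subsection \<open>Numerical consequences of the mesh conditions\<close>

lemma E1_ge: "3 \<le> E1"
proof -
  have "2 * 1 \<le> (2 + T\<^sub>f) * exp (T\<^sub>f / \<epsilon>)" using T\<^sub>f \<epsilon> by (intro mult_mono) auto
  then show ?thesis by (simp add: C_E1_def)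
qed

lemma E2_ge: "21 \<le> E2"
proof -
  have "2 powr 3 \<le> 2 powr q" using q by (intro powr_mono) auto
  then have "7 * 3 \<le> (2 powr q - 1) * E1" using E1_ge by (intro mult_mono) auto
  then show ?thesis by (simp add: C_E2_def)
qed

lemma CX_ge: "1 \<le> CX"
  using q by (rule maxwellian_const_ge_1)

lemma \<Delta>v_less_each:
  "\<Delta>v < a_1 q \<alpha> \<eta>\<^sub>1 \<epsilon> T\<^sub>f C\<^sub>0 f\<^sub>0 1000 CX" "\<Delta>v < l" "\<Delta>v < a_5 q \<gamma> \<epsilon> T\<^sub>f f\<^sub>0 CX"
  "\<Delta>v < ((1 - \<eta>\<^sub>2) / \<eta>\<^sub>2 * \<Delta>x) powr (1 / (1 - \<gamma>))"
  "\<Delta>v < 1 / (4 * \<alpha> * (E1 * (T\<^sub>f + 1) + 1))"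
  using less_Min_memD[OF _ _ \<Delta>v_less[unfolded r_v_def]] by (blast intro: finite.intros)+

lemma \<Delta>x_less_l: "\<Delta>x < l"
  using less_Min_memD[OF _ _ \<Delta>x_less[unfolded r_x_def]] by (blast intro: finite.intros)

lemma \<Delta>v_less_16: "\<Delta>v < 1 / 16"
proof -
  have "3 * 1 \<le> E1 * (T\<^sub>f + 1)" using E1_ge T\<^sub>f by (intro mult_mono) auto
  then have "4 * 1 * 4 \<le> 4 * \<alpha> * (E1 * (T\<^sub>f + 1) + 1)" using \<alpha> by (intro mult_mono) auto
  then have "1 / (4 * \<alpha> * (E1 * (T\<^sub>f + 1) + 1)) \<le> 1 / 16" by (intro divide_left_mono) auto
  then show ?thesis using \<Delta>v_less_each(5) by linarith
qed

lemma \<Delta>t_E1: "\<Delta>t * E1 < \<eta>\<^sub>2 * \<Delta>v" "\<Delta>t * E1 \<le> \<Delta>v"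
proof -
  show "\<Delta>t * E1 < \<eta>\<^sub>2 * \<Delta>v" using \<Delta>t_less E1_ge by (simp add: field_simps)
  moreover have "\<eta>\<^sub>2 * \<Delta>v \<le> 1 * \<Delta>v" using \<eta> \<Delta> by (intro mult_right_mono) auto
  ultimately show "\<Delta>t * E1 \<le> \<Delta>v" by simp
qed

lemma \<Delta>t_le: "\<Delta>t \<le> 1" "\<Delta>t \<le> T\<^sub>f"
proof -
  have "\<Delta>t * 1 \<le> \<Delta>t * E1" using E1_ge \<Delta> by (intro mult_left_mono) auto
  then show "\<Delta>t \<le> 1" using \<Delta>t_E1 \<Delta>v_less_16 by linarith
  have "N\<^sub>t \<noteq> 0" using N\<^sub>t T\<^sub>f by (metis less_irrefl mult_zero_left of_nat_0)
  then have "1 * \<Delta>t \<le> real N\<^sub>t * \<Delta>t" using \<Delta> by (intro mult_right_mono) auto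
  then show "\<Delta>t \<le> T\<^sub>f" using N\<^sub>t by simp
qed

lemma time_le: "n \<le> N\<^sub>t \<Longrightarrow> real n * \<Delta>t \<le> T\<^sub>f"
  using N\<^sub>t \<Delta> mult_right_mono[of "real n" "real N\<^sub>t" \<Delta>t] by simp

lemma f\<^sub>0_le: "f\<^sub>0 x w \<le> F * (1 + \<bar>w\<bar>) powr (- q)"
proof -
  have "\<bar>f\<^sub>0 x w\<bar> * (1 + \<bar>w\<bar>) powr q \<le> F"
    unfolding F_const_def by (rule Linf_norm_bound[OF f\<^sub>0_norm])
  then have "\<bar>f\<^sub>0 x w\<bar> * (1 + \<bar>w\<bar>) powr q * (1 + \<bar>w\<bar>) powr (- q) \<le> F * (1 + \<bar>w\<bar>) powr (- q)"
    by (intro mult_right_mono) auto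
  moreover have "(1 + \<bar>w\<bar>) powr q * (1 + \<bar>w\<bar>) powr (- q) = 1" by (simp add: powr_minus field_simps add_nonneg_eq_0_iff)
  ultimately show ?thesis by (simp add: mult.assoc)
qed

lemma C\<^sub>0_le_F: "C\<^sub>0 \<le> F" and F_pos: "0 < F"
proof -
  show "C\<^sub>0 \<le> F" using f\<^sub>0_ge[of 0 0] f\<^sub>0_le[of 0 0] \<alpha> by simp
  then show "0 < F" using C\<^sub>0 by simp
qed

lemma \<beta>_nonneg: "0 \<le> 2 * \<alpha> * E1 * T\<^sub>f"
  using \<alpha> E1_ge T\<^sub>f by simp

lemma D_bounds: "0 < D" "D \<le> 8"
  unfolding D_const_def using D_int_pos D_int_le_8 \<alpha> \<beta>_nonneg by auto

lemma mesh_sums: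
  shows "D / 2 \<le> (\<Sum>j\<in>Iv. exp (- (\<bar>v j\<bar> powr \<alpha>) - 2 * \<alpha> * E1 * T\<^sub>f * \<bar>v j\<bar>) * \<Delta>v)"
    and "m \<in> {0, 1, 2} \<Longrightarrow> (\<Sum>j\<in>Iv. (1 + \<bar>v j\<bar>) powr (m - q) * \<Delta>v) \<le> 2 * D_bar (q - m)"
    and "total (\<lambda>i j. f\<^sub>0 (xg \<Delta>x i) (v j)) \<le> 2"
proof -
  note M = mesh[unfolded mesh_small_def, rule_format, of \<Delta>x \<Delta>v N\<^sub>x N\<^sub>v]
  have pre: "0 < \<Delta>x \<and> 0 < \<Delta>v \<and> real N\<^sub>x * \<Delta>x = 1 \<and> real N\<^sub>v * \<Delta>v = E1 * \<Delta>v powr (- \<gamma>) \<and> \<Delta>x < l \<and> \<Delta>v < l"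
    using \<Delta> N\<^sub>x N\<^sub>v \<Delta>x_less_l \<Delta>v_less_each by simp
  show "D / 2 \<le> (\<Sum>j\<in>Iv. exp (- (\<bar>v j\<bar> powr \<alpha>) - 2 * \<alpha> * E1 * T\<^sub>f * \<bar>v j\<bar>) * \<Delta>v)"
    using M[OF pre] unfolding D_const_def by auto
  show "total (\<lambda>i j. f\<^sub>0 (xg \<Delta>x i) (v j)) \<le> 2" using M[OF pre] by (simp add: total_def)
  assume m: "m \<in> {0, 1, 2}"
  have eq: "(1 + \<bar>v j\<bar>) powr (m - q) * \<Delta>v = \<Delta>v / (1 + \<bar>v j\<bar>) powr (q - m)" for j
    using powr_minus_divide[of "1 + \<bar>v j\<bar>" "q - m"] by simp
  show "(\<Sum>j\<in>Iv. (1 + \<bar>v j\<bar>) powr (m - q) * \<Delta>v) \<le> 2 * D_bar (q - m)"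
    unfolding eq using M[OF pre] m by auto
qed

lemma C\<^sub>0_D_le_4: "C\<^sub>0 * D \<le> 4"
proof -
  have "C\<^sub>0 * (D / 2) \<le> C\<^sub>0 * (\<Sum>j\<in>Iv. exp (- (\<bar>v j\<bar> powr \<alpha>) - 2 * \<alpha> * E1 * T\<^sub>f * \<bar>v j\<bar>) * \<Delta>v)"
    using mesh_sums(1) C\<^sub>0 by (intro mult_left_mono) auto
  also have "\<dots> = (\<Sum>i\<in>Ix. \<Sum>j\<in>Iv. C\<^sub>0 * exp (- (\<bar>v j\<bar> powr \<alpha>) - 2 * \<alpha> * E1 * T\<^sub>f * \<bar>v j\<bar>) * \<Delta>x * \<Delta>v)"
  proof -
    have "(\<Sum>i\<in>Ix. \<Sum>j\<in>Iv. C\<^sub>0 * exp (- (\<bar>v j\<bar> powr \<alpha>) - 2 * \<alpha> * E1 * T\<^sub>f * \<bar>v j\<bar>) * \<Delta>x * \<Delta>v)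
        = real N\<^sub>x * \<Delta>x * (C\<^sub>0 * (\<Sum>j\<in>Iv. exp (- (\<bar>v j\<bar> powr \<alpha>) - 2 * \<alpha> * E1 * T\<^sub>f * \<bar>v j\<bar>) * \<Delta>v))"
      by (simp add: I_x_def sum_distrib_left mult_ac)
    then show ?thesis using N\<^sub>x by simp
  qed
  also have "\<dots> \<le> total (\<lambda>i j. f\<^sub>0 (xg \<Delta>x i) (v j))"
    unfolding total_def
  proof (intro sum_mono mult_right_mono)
    fix i j
    have "C\<^sub>0 * exp (- (\<bar>v j\<bar> powr \<alpha>) - 2 * \<alpha> * E1 * T\<^sub>f * \<bar>v j\<bar>) \<le> C\<^sub>0 * exp (- (\<bar>v j\<bar> powr \<alpha>))"
      using C\<^sub>0 \<beta>_nonneg by (intro mult_left_mono) auto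
    then show "C\<^sub>0 * exp (- (\<bar>v j\<bar> powr \<alpha>) - 2 * \<alpha> * E1 * T\<^sub>f * \<bar>v j\<bar>) \<le> f\<^sub>0 (xg \<Delta>x i) (v j)"
      using f\<^sub>0_ge[of "v j" "xg \<Delta>x i"] by linarith
  qed (use \<Delta> in auto)
  finally show ?thesis using mesh_sums(3) by simp
qed

lemma speed_le:
  assumes "j \<in> Iv"
  shows "\<bar>v j\<bar> \<le> E1 * \<Delta>v powr (- \<gamma>)"
proof -
  have "\<bar>of_int j\<bar> \<le> real N\<^sub>v" using assms by (auto simp: I_v_def)
  then have "\<bar>of_int j\<bar> * \<Delta>v \<le> real N\<^sub>v * \<Delta>v" using \<Delta> by (intro mult_right_mono) auto
  then show ?thesis using N\<^sub>v \<Delta> by (simp add: vg_def abs_mult)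
qed

text \<open>The velocity cut-off grows slowly enough for the space transport to use only the share
  \<open>1 - \<eta>\<^sub>2\<close> of the CFL budget that the velocity transport leaves.\<close>

lemma cfl:
  assumes j: "j \<in> Iv" and E: "\<bar>E\<bar> \<le> E1"
  shows "\<Delta>t / \<Delta>x * \<bar>v j\<bar> + \<Delta>t / \<Delta>v * \<bar>E\<bar> \<le> 1"
proof -
  define y where "y = (1 - \<eta>\<^sub>2) / \<eta>\<^sub>2 * \<Delta>x"
  have y: "0 < y" unfolding y_def using \<eta> \<Delta> by simp
  have "\<Delta>v powr (1 - \<gamma>) \<le> (y powr (1 / (1 - \<gamma>))) powr (1 - \<gamma>)"
    using \<Delta>v_less_each(4)[folded y_def] \<Delta> \<gamma> by (intro powr_mono2) auto
  also have "\<dots> = y" using y \<gamma> by (simp add: powr_powr)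
  finally have vy: "\<Delta>v powr (1 - \<gamma>) \<le> y" .
  have "\<Delta>t * \<bar>v j\<bar> \<le> \<Delta>t * (E1 * \<Delta>v powr (- \<gamma>))" using speed_le[OF j] \<Delta> by (intro mult_left_mono) auto
  also have "\<dots> = \<Delta>t * E1 * \<Delta>v powr (- \<gamma>)" by simp
  also have "\<dots> \<le> \<eta>\<^sub>2 * \<Delta>v * \<Delta>v powr (- \<gamma>)" using \<Delta>t_E1(1) by (intro mult_right_mono) auto
  also have "\<dots> = \<eta>\<^sub>2 * \<Delta>v powr (1 - \<gamma>)" using \<Delta> powr_mult_base[of \<Delta>v "- \<gamma>"] by (simp add: mult.assoc)
  also have "\<dots> \<le> \<eta>\<^sub>2 * y" using vy \<eta> by (intro mult_left_mono) auto
  also have "\<dots> = (1 - \<eta>\<^sub>2) * \<Delta>x" unfolding y_def using \<eta> by simp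
  finally have 1: "\<Delta>t / \<Delta>x * \<bar>v j\<bar> \<le> 1 - \<eta>\<^sub>2" using \<Delta> by (simp add: field_simps)
  have "\<Delta>t * \<bar>E\<bar> \<le> \<Delta>t * E1" using E \<Delta> by (intro mult_left_mono) auto
  then have "\<Delta>t * \<bar>E\<bar> \<le> \<eta>\<^sub>2 * \<Delta>v" using \<Delta>t_E1(1) by linarith
  then have "\<Delta>t / \<Delta>v * \<bar>E\<bar> \<le> \<eta>\<^sub>2" using \<Delta> by (simp add: field_simps)
  with 1 show ?thesis by linarith
qed

text \<open>The growth rate of the weighted norm: \<open>C_E2\<close> from transport, the rest from relaxation.\<close>

definition upper_rate :: real where
  "upper_rate = E2 + (CX - 1) / \<epsilon>"

lemma upper_rate_nonneg: "0 \<le> upper_rate"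
  unfolding upper_rate_def using E2_ge CX_ge \<epsilon> by (intro add_nonneg_nonneg) auto

text \<open>The bound on the weighted norm of the transported function in the stability estimate.\<close>

definition H_const :: real where
  "H_const = (1 + E2) * exp (upper_rate * T\<^sub>f) * F"

text \<open>The ratio of the lower bound of the density to the upper bound \<open>H\<close> of the distribution, up to a
  numerical factor (see \<open>H_Y\<close>).  The constant \<open>a_1\<close> and the lower bound of the temperature are powers
  of it.\<close>

definition Y_const :: real where
  "Y_const = C\<^sub>0 * D / ((1 + E2) * F) * exp (- Q * T\<^sub>f)"

lemma H_pos: "0 < H_const"
  unfolding H_const_def using E2_ge F_pos by (intro mult_pos_pos) auto

lemma Q_eq: "Q = S + 1 / \<epsilon> + upper_rate"
  by (simp add: Q_const_def upper_rate_def diff_divide_distrib)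

lemma S_nonneg: "0 \<le> S"
  unfolding S_const_def using \<alpha> E1_ge \<eta> T\<^sub>f by (intro add_nonneg_nonneg) auto

lemma H_Y: "H_const * Y_const = C\<^sub>0 * D * exp (- (S + 1 / \<epsilon>) * T\<^sub>f)"
proof -
  have "exp (upper_rate * T\<^sub>f) * exp (- Q * T\<^sub>f) = exp (- (S + 1 / \<epsilon>) * T\<^sub>f)"
    unfolding Q_eq by (simp add: algebra_simps flip: exp_add)
  moreover have "H_const * Y_const = C\<^sub>0 * D * (exp (upper_rate * T\<^sub>f) * exp (- Q * T\<^sub>f))"
  proof -
    have K: "(1 + E2) * F \<noteq> 0" using E2_ge F_pos by simp
    have "H_const * Y_const = ((1 + E2) * F * (C\<^sub>0 * D / ((1 + E2) * F))) * (exp (upper_rate * T\<^sub>f) * exp (- Q * T\<^sub>f))"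
      by (simp only: H_const_def Y_const_def mult_ac)
    then show ?thesis using K by simp
  qed
  ultimately show ?thesis by simp
qed

lemma H_eq: "H_const = (1 + E2) * F * exp (Q * T\<^sub>f) * exp (- (S + 1 / \<epsilon>) * T\<^sub>f)"
proof -
  have "exp (Q * T\<^sub>f) * exp (- (S + 1 / \<epsilon>) * T\<^sub>f) = exp (upper_rate * T\<^sub>f)"
    unfolding Q_eq by (simp add: algebra_simps flip: exp_add)
  then show ?thesis by (simp add: H_const_def mult_ac)
qed

lemma Y_bounds: "0 < Y_const" "Y_const \<le> 1"
proof -
  show "0 < Y_const" unfolding Y_const_def using C\<^sub>0 D_bounds E2_ge F_pos by (intro mult_pos_pos divide_pos_pos) auto
  have "C\<^sub>0 * D \<le> F * 8" using C\<^sub>0_le_F D_bounds C\<^sub>0 F_pos by (intro mult_mono) auto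
  also have "\<dots> \<le> F * (1 + E2)" using E2_ge F_pos by (intro mult_left_mono) auto
  finally have "C\<^sub>0 * D / ((1 + E2) * F) \<le> 1"
    using E2_ge F_pos by (subst divide_le_eq_1_pos) (simp_all only: mult.commute, simp)
  moreover have "0 \<le> Q * T\<^sub>f"
    unfolding Q_eq using S_nonneg upper_rate_nonneg \<epsilon> T\<^sub>f by (intro mult_nonneg_nonneg add_nonneg_nonneg) auto
  then have "exp (- Q * T\<^sub>f) \<le> 1" by simp
  ultimately have "C\<^sub>0 * D / ((1 + E2) * F) * exp (- Q * T\<^sub>f) \<le> 1 * 1"
    using C\<^sub>0 D_bounds E2_ge F_pos by (intro mult_mono) auto
  then show "Y_const \<le> 1" by (simp add: Y_const_def)
qed

text \<open>In terms of \<open>Y\<close>, the cube of \<open>a_1\<close> is \<open>Y\<close> to the power \<open>5/3\<close>, hence at most \<open>Y\<close>, divided by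
  \<open>2\<close> to the power \<open>16/3\<close>, which is at least \<open>32\<close>, and by \<open>C_M\<close> to the power \<open>2/3\<close>, which is \<open>100\<close>.\<close>

lemma \<Delta>v_cubed_le: "\<Delta>v ^ 3 \<le> Y_const / 3200"
proof -
  have pos: "0 < C\<^sub>0 * D" "0 < (1 + E2) * F" using C\<^sub>0 D_bounds E2_ge F_pos by auto
  have "exp (- Q * T\<^sub>f) powr (5/9) = exp (- (5/9) * Q * T\<^sub>f)" by (simp add: powr_def mult_ac)
  then have Yp: "Y_const powr (5/9) = (C\<^sub>0 * D) powr (5/9) / ((1 + E2) powr (5/9) * F powr (5/9)) * exp (- (5/9) * Q * T\<^sub>f)"
    unfolding Y_const_def using pos E2_ge F_pos C\<^sub>0 D_bounds by (simp add: powr_mult powr_divide)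
  have a1: "a_1 q \<alpha> \<eta>\<^sub>1 \<epsilon> T\<^sub>f C\<^sub>0 f\<^sub>0 1000 CX = Y_const powr (5/9) / (2 powr (16/9) * 1000 powr (2/9))"
    unfolding a_1_def Yp by (simp add: mult_ac)
  have cube: "(x powr p) ^ 3 = x powr (3 * p)" if "0 < x" for x p :: real
    using that by (simp add: powr_power)
  have "Y_const powr (5/3) \<le> Y_const powr 1" using Y_bounds by (intro powr_mono') auto
  then have num: "(Y_const powr (5/9)) ^ 3 \<le> Y_const" using Y_bounds by (simp add: cube)
  have "2 powr 5 \<le> 2 powr (16/3 :: real)" by (intro powr_mono) auto
  then have "32 \<le> (2 powr (16/9 :: real)) ^ 3" by (simp add: cube)
  moreover have "(1000 powr (2/9 :: real)) ^ 3 = 100"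
  proof -
    have "(1000 :: real) = 10 powr 3" by simp
    then have "(1000 powr (2/9 :: real)) ^ 3 = (10 powr 3) powr (2/3 :: real)" by (simp add: cube)
    also have "\<dots> = 10 powr 2" unfolding powr_powr by simp
    finally show ?thesis by simp
  qed
  ultimately have den: "3200 \<le> (2 powr (16/9) * 1000 powr (2/9) :: real) ^ 3"
    by (simp add: power_mult_distrib)
  have "\<Delta>v ^ 3 \<le> (Y_const powr (5/9) / (2 powr (16/9) * 1000 powr (2/9))) ^ 3"
    using \<Delta>v_less_each(1) \<Delta> unfolding a1 by (intro power_mono) auto
  also have "\<dots> = (Y_const powr (5/9)) ^ 3 / (2 powr (16/9) * 1000 powr (2/9)) ^ 3" by (rule power_divide)
  also have "\<dots> \<le> Y_const / 3200" using num den Y_bounds by (intro frac_le) auto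
  finally show ?thesis .
qed

text \<open>The mass leaving through the velocity boundary in one step is at most \<open>\<Delta>t\<close>: at the cut-off
  speed the decay of the solution beats the field.\<close>

lemma boundary_flux_le:
  assumes "t \<le> T\<^sub>f"
  shows "E1 * (exp (upper_rate * t) * F * (1 + real N\<^sub>v * \<Delta>v) powr (- q)) \<le> 1"
proof -
  define X where "X = exp ((E2 + 2 * (CX - 1) / \<epsilon>) * T\<^sub>f) * F"
  define Z where "Z = 2 * E1 powr (1 - q) * (1 + E2) * X"
  have E1: "0 < E1" using E1_ge by linarith
  have X: "0 < X" unfolding X_def using F_pos by simp
  have Z: "0 < Z" unfolding Z_def using X E1 E2_ge by (intro mult_pos_pos) auto
  have q\<gamma>: "0 < q * \<gamma>" using q \<gamma> by simp
  have a5: "a_5 q \<gamma> \<epsilon> T\<^sub>f f\<^sub>0 CX = Z powr (- (1 / (q * \<gamma>)))"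
    by (simp add: a_5_def Z_def X_def mult.assoc)
  have "\<Delta>v powr (q * \<gamma>) \<le> (Z powr (- (1 / (q * \<gamma>)))) powr (q * \<gamma>)"
    using \<Delta>v_less_each(3) \<Delta> q\<gamma> unfolding a5 by (intro powr_mono2) auto
  also have "\<dots> = Z powr (- 1)" unfolding powr_powr using q \<gamma> by simp
  also have "\<dots> = 1 / Z" using Z by (simp add: powr_minus_divide)
  finally have v: "\<Delta>v powr (q * \<gamma>) \<le> 1 / Z" .
  have "upper_rate * t \<le> upper_rate * T\<^sub>f" using assms upper_rate_nonneg by (intro mult_left_mono)
  also have "\<dots> \<le> (E2 + 2 * (CX - 1) / \<epsilon>) * T\<^sub>f"
    unfolding upper_rate_def using CX_ge \<epsilon> T\<^sub>f by (intro mult_right_mono add_left_mono divide_right_mono) auto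
  finally have up: "exp (upper_rate * t) * F \<le> X"
    unfolding X_def using F_pos by (intro mult_right_mono) auto
  have V: "0 < E1 * \<Delta>v powr (- \<gamma>)" using E1 \<Delta> by simp
  have "(1 + real N\<^sub>v * \<Delta>v) powr (- q) \<le> (E1 * \<Delta>v powr (- \<gamma>)) powr (- q)"
    unfolding N\<^sub>v using q V by (intro powr_mono2') auto
  also have "\<dots> = E1 powr (- q) * \<Delta>v powr (q * \<gamma>)"
    using E1 \<Delta> by (simp add: powr_mult powr_powr mult.commute)
  also have "\<dots> \<le> E1 powr (- q) * (1 / Z)" using v by (intro mult_left_mono) auto
  finally have "exp (upper_rate * t) * F * (1 + real N\<^sub>v * \<Delta>v) powr (- q) \<le> X * (E1 powr (- q) * (1 / Z))"
    using up X by (intro mult_mono) auto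
  then have "E1 * (exp (upper_rate * t) * F * (1 + real N\<^sub>v * \<Delta>v) powr (- q)) \<le> E1 * (X * (E1 powr (- q) * (1 / Z)))"
    using E1 by (intro mult_left_mono) auto
  also have "\<dots> = X * E1 powr (1 - q) / Z"
    using E1 powr_mult_base[of E1 "- q"] by (simp add: mult_ac)
  also have "\<dots> = 1 / (2 * (1 + E2))"
  proof -
    have "Z = 2 * (1 + E2) * (X * E1 powr (1 - q))" by (simp add: Z_def)
    moreover have "X * E1 powr (1 - q) \<noteq> 0" using X E1 by simp
    ultimately show ?thesis by simp
  qed
  also have "\<dots> \<le> 1" using E2_ge by simp
  finally show ?thesis .
qed

text \<open>Over a time \<open>dt\<close> the field shifts velocities by at most \<open>E1 dt\<close>.  The logarithm of the profile
  changes accordingly by at most \<open>\<alpha> (1 + \<bar>w\<bar>) + \<alpha> E1 t\<close> times that shift, the two terms being the slopes of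
  \<open>\<bar>w\<bar>\<close> to the power \<open>\<alpha>\<close> and of the linear part.  The coefficients are the time integrals of these
  rates.\<close>

definition lower_envelope :: "real \<Rightarrow> real \<Rightarrow> real" where
  "lower_envelope t w = exp (- (\<alpha> * E1 * t + \<alpha> * E1\<^sup>2 * t\<^sup>2 / 2) - \<bar>w\<bar> powr \<alpha> - \<alpha> * E1 * t * \<bar>w\<bar>)"

lemma lower_envelope_shift:
  assumes t: "0 \<le> t" and w: "\<bar>w'\<bar> \<le> \<bar>w\<bar> + \<Delta>v"
  shows "exp (- (\<alpha> * \<Delta>v * (1 + \<bar>w\<bar>) + \<alpha> * E1 * t * \<Delta>v)) * lower_envelope t w \<le> lower_envelope t w'"
proof -
  have "\<bar>w'\<bar> powr \<alpha> \<le> (\<bar>w\<bar> + \<Delta>v) powr \<alpha>" using w \<alpha> by (intro powr_mono2) auto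
  also have "\<dots> \<le> \<bar>w\<bar> powr \<alpha> + \<alpha> * \<Delta>v * (1 + \<bar>w\<bar>)"
    using powr_increment_le[of \<alpha> "\<bar>w\<bar>" \<Delta>v] \<alpha> \<Delta> \<Delta>v_less_16 by simp
  finally have "\<bar>w'\<bar> powr \<alpha> \<le> \<bar>w\<bar> powr \<alpha> + \<alpha> * \<Delta>v * (1 + \<bar>w\<bar>)" .
  moreover have "\<alpha> * E1 * t * \<bar>w'\<bar> \<le> \<alpha> * E1 * t * (\<bar>w\<bar> + \<Delta>v)"
    using w t \<alpha> E1_ge by (intro mult_left_mono) auto
  ultimately show ?thesis
    unfolding lower_envelope_def exp_add[symmetric] exp_le_cancel_iff by (simp add: distrib_left)
qed

lemma lower_envelope_step:
  assumes t: "0 \<le> t" and \<theta>: "0 \<le> \<theta>" "\<theta> * \<Delta>v \<le> \<Delta>t * E1"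
  shows "lower_envelope (t + \<Delta>t) w
    \<le> exp (- (\<theta> * (\<alpha> * \<Delta>v * (1 + \<bar>w\<bar>) + \<alpha> * E1 * t * \<Delta>v))) * lower_envelope t w"
proof -
  have "\<theta> * \<Delta>v * (\<alpha> * (1 + \<bar>w\<bar>) + \<alpha> * E1 * t) \<le> \<Delta>t * E1 * (\<alpha> * (1 + \<bar>w\<bar>) + \<alpha> * E1 * t)"
    using \<theta> t \<alpha> E1_ge by (intro mult_right_mono) auto
  moreover have "0 \<le> \<alpha> * E1\<^sup>2 * \<Delta>t\<^sup>2 / 2" using \<alpha> by simp
  moreover have "\<alpha> * E1\<^sup>2 * (t + \<Delta>t)\<^sup>2 / 2 = \<alpha> * E1\<^sup>2 * t\<^sup>2 / 2 + \<Delta>t * E1 * (\<alpha> * E1 * t) + \<alpha> * E1\<^sup>2 * \<Delta>t\<^sup>2 / 2"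
    by (simp add: power2_eq_square algebra_simps)
  moreover have "\<theta> * (\<alpha> * \<Delta>v * (1 + \<bar>w\<bar>) + \<alpha> * E1 * t * \<Delta>v) = \<theta> * \<Delta>v * (\<alpha> * (1 + \<bar>w\<bar>) + \<alpha> * E1 * t)"
    by (simp add: algebra_simps)
  moreover have "\<Delta>t * E1 * (\<alpha> * (1 + \<bar>w\<bar>) + \<alpha> * E1 * t)
      = \<alpha> * E1 * \<Delta>t + \<alpha> * E1 * \<Delta>t * \<bar>w\<bar> + \<Delta>t * E1 * (\<alpha> * E1 * t)"
    by (simp add: algebra_simps)
  moreover have "\<alpha> * E1 * (t + \<Delta>t) = \<alpha> * E1 * t + \<alpha> * E1 * \<Delta>t"
    "\<alpha> * E1 * (t + \<Delta>t) * \<bar>w\<bar> = \<alpha> * E1 * t * \<bar>w\<bar> + \<alpha> * E1 * \<Delta>t * \<bar>w\<bar>"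
    by (simp_all add: algebra_simps)
  ultimately show ?thesis
    unfolding lower_envelope_def exp_add[symmetric] exp_le_cancel_iff by linarith
qed

text \<open>Up to one step beyond the final time, the exponent stays below the one in the stability
  estimate, and the surplus \<open>\<alpha> E1 T\<^sub>f\<close> even pays, up to a constant, for the velocity-dependent part at
  speeds at most one.\<close>

lemma lower_envelope_exponent_le:
  assumes t: "0 \<le> t" "t \<le> T\<^sub>f + \<Delta>t"
  shows "\<alpha> * E1 * t \<le> 2 * \<alpha> * E1 * T\<^sub>f" "2 * \<alpha> * E1 * t \<le> 2 * \<alpha> * E1 * T\<^sub>f + 1"
    "2 * \<alpha> * E1 * T\<^sub>f + \<alpha> * E1\<^sup>2 * t\<^sup>2 / 2 \<le> S * T\<^sub>f"
proof -
  have \<alpha>E: "0 \<le> \<alpha> * E1" using \<alpha> E1_ge by simp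
  have t2: "t \<le> 2 * T\<^sub>f" "t \<le> T\<^sub>f + 1" using t \<Delta>t_le by linarith+
  have "\<alpha> * E1 * t \<le> \<alpha> * E1 * (2 * T\<^sub>f)" using t2 \<alpha>E by (intro mult_left_mono) auto
  then show "\<alpha> * E1 * t \<le> 2 * \<alpha> * E1 * T\<^sub>f" by simp
  have "\<alpha> * (\<Delta>t * E1) \<le> 2 * (1 / 16)" using \<alpha> \<Delta>t_E1 \<Delta>v_less_16 \<Delta> E1_ge by (intro mult_mono) auto
  moreover have "\<alpha> * E1 * t \<le> \<alpha> * E1 * (T\<^sub>f + \<Delta>t)" using t \<alpha>E by (intro mult_left_mono) auto
  ultimately show "2 * \<alpha> * E1 * t \<le> 2 * \<alpha> * E1 * T\<^sub>f + 1" by (simp add: algebra_simps)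
  have "t * t \<le> (2 * T\<^sub>f) * (T\<^sub>f + 1)" using t t2 T\<^sub>f by (intro mult_mono) auto
  then have "t\<^sup>2 / 2 \<le> (T\<^sub>f + 1) * T\<^sub>f" by (simp add: power2_eq_square mult_ac)
  then have "\<alpha> * E1\<^sup>2 * (t\<^sup>2 / 2) \<le> \<alpha> * E1\<^sup>2 * ((T\<^sub>f + 1) * T\<^sub>f)"
    using \<alpha> by (intro mult_left_mono) auto
  then have "\<alpha> * E1\<^sup>2 * t\<^sup>2 / 2 \<le> \<alpha> * E1\<^sup>2 * ((T\<^sub>f + 1) * T\<^sub>f)" by simp
  also have "\<dots> \<le> \<alpha> * E1\<^sup>2 * ((T\<^sub>f + 1) * T\<^sub>f) / \<eta>\<^sub>1"
  proof -
    have "0 \<le> \<alpha> * E1\<^sup>2 * ((T\<^sub>f + 1) * T\<^sub>f)" using \<alpha> T\<^sub>f by simp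
    then show ?thesis using \<eta> mult_left_le[of \<eta>\<^sub>1] by (simp add: le_divide_eq)
  qed
  also have "\<dots> = S * T\<^sub>f - 2 * \<alpha> * E1 * T\<^sub>f"
    by (simp add: S_const_def distrib_right[of "2 * \<alpha> * E1"])
  finally show "2 * \<alpha> * E1 * T\<^sub>f + \<alpha> * E1\<^sup>2 * t\<^sup>2 / 2 \<le> S * T\<^sub>f" by simp
qed

end

context bgk_scheme
begin

subsection \<open>The propagated bounds\<close>

text \<open>The bounds carry the current time \<open>n \<Delta>t\<close>; with \<open>T\<^sub>f\<close> in its place they would not be inductive.\<close>

definition invariant :: "nat \<Rightarrow> (int \<Rightarrow> int \<Rightarrow> real) \<Rightarrow> bool" where
  "invariant n g \<longleftrightarrow>
    (\<forall>i\<in>Ix. \<forall>j\<in>Iv.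
      C\<^sub>0 * exp (- (real n * \<Delta>t / \<epsilon>)) * lower_envelope (real n * \<Delta>t) (v j) \<le> g i j \<and>
      g i j \<le> exp (upper_rate * (real n * \<Delta>t)) * F * (1 + \<bar>v j\<bar>) powr (- q)) \<and>
    total g \<le> exp (real n * \<Delta>t / \<epsilon>) * (2 + real n * \<Delta>t)"

lemma invariant_initial: "invariant 0 (\<lambda>i j. f\<^sub>0 (xg \<Delta>x i) (v j))"
  using f\<^sub>0_ge f\<^sub>0_le mesh_sums(3) by (simp add: invariant_def lower_envelope_def)

end

locale bgk_step = bgk_scheme +
  fixes n :: nat and g :: "int \<Rightarrow> int \<Rightarrow> real"
  assumes n: "n \<le> N\<^sub>t" and inv: "invariant n g"
begin

abbreviation t where "t \<equiv> real n * \<Delta>t"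
abbreviation h where "h \<equiv> transport N\<^sub>x N\<^sub>v \<Delta>x \<Delta>v \<Delta>t g"
abbreviation \<rho> where "\<rho> \<equiv> rho N\<^sub>v \<Delta>v h"
abbreviation U where "U \<equiv> vel N\<^sub>v \<Delta>v h"
abbreviation T where "T \<equiv> temp N\<^sub>v \<Delta>v h"
abbreviation M where "M \<equiv> maxwellian N\<^sub>v \<Delta>v h"
abbreviation E where "E \<equiv> e_field N\<^sub>x N\<^sub>v \<Delta>x \<Delta>v g"

lemma t: "0 \<le> t" "t \<le> T\<^sub>f"
  using time_le[OF n] \<Delta> by auto

lemma g_ge: "i \<in> Ix \<Longrightarrow> j \<in> Iv \<Longrightarrow> C\<^sub>0 * exp (- (t / \<epsilon>)) * lower_envelope t (v j) \<le> g i j"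
  and g_le: "i \<in> Ix \<Longrightarrow> j \<in> Iv \<Longrightarrow> g i j \<le> exp (upper_rate * t) * F * (1 + \<bar>v j\<bar>) powr (- q)"
  and total_g_le: "total g \<le> exp (t / \<epsilon>) * (2 + t)"
  using inv by (auto simp: invariant_def)

lemma g_nonneg:
  assumes "i \<in> Ix" "j \<in> Iv"
  shows "0 \<le> g i j"
proof -
  have "0 \<le> C\<^sub>0 * exp (- (t / \<epsilon>)) * lower_envelope t (v j)" using C\<^sub>0 by (simp add: lower_envelope_def)
  then show ?thesis using g_ge[OF assms] by linarith
qed

lemma total_g_le_final: "total g \<le> (2 + T\<^sub>f) * exp (T\<^sub>f / \<epsilon>)"
proof -
  have "exp (t / \<epsilon>) * (2 + t) \<le> exp (T\<^sub>f / \<epsilon>) * (2 + T\<^sub>f)"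
    using t \<epsilon> by (intro mult_mono) (auto simp: divide_right_mono)
  then show ?thesis using total_g_le by (simp add: mult.commute)
qed

lemma abs_E_le: "i \<in> Ix \<Longrightarrow> \<bar>E i\<bar> \<le> E1"
  using abs_e_field_le[of i N\<^sub>x \<Delta>x \<Delta>v N\<^sub>v g] total_g_le_final g_nonneg \<Delta> N\<^sub>x
  by (simp add: total_def C_E1_def)

lemma cfl_E: "i \<in> Ix \<Longrightarrow> j \<in> Iv \<Longrightarrow> \<Delta>t / \<Delta>x * \<bar>v j\<bar> + \<Delta>t / \<Delta>v * \<bar>E i\<bar> \<le> 1"
  by (rule cfl) (auto intro: abs_E_le)

lemma weight_E:
  assumes "i \<in> Ix"
  shows "0 \<le> \<Delta>t / \<Delta>v * \<bar>E i\<bar>" "\<Delta>t / \<Delta>v * \<bar>E i\<bar> \<le> 1" "\<Delta>t / \<Delta>v * \<bar>E i\<bar> * \<Delta>v \<le> \<Delta>t * E1"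
proof -
  show "0 \<le> \<Delta>t / \<Delta>v * \<bar>E i\<bar>" using \<Delta> by simp
  show *: "\<Delta>t / \<Delta>v * \<bar>E i\<bar> * \<Delta>v \<le> \<Delta>t * E1" using abs_E_le[OF assms] \<Delta> by simp
  then have "\<Delta>t / \<Delta>v * \<bar>E i\<bar> * \<Delta>v \<le> 1 * \<Delta>v" using \<Delta>t_E1(2) by simp
  then show "\<Delta>t / \<Delta>v * \<bar>E i\<bar> \<le> 1" using \<Delta>(2) by (rule mult_right_le_imp_le)
qed

lemma speed_neighbour: "\<bar>j' - j\<bar> \<le> 1 \<Longrightarrow> \<bar>\<bar>v j'\<bar> - \<bar>v j\<bar>\<bar> \<le> \<Delta>v"
proof -
  assume "\<bar>j' - j\<bar> \<le> 1"
  then have "\<bar>of_int (j' - j)\<bar> * \<Delta>v \<le> 1 * \<Delta>v" using \<Delta> by (intro mult_right_mono) linarith+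
  moreover have "\<bar>v j' - v j\<bar> = \<bar>of_int (j' - j)\<bar> * \<Delta>v" using \<Delta> by (simp add: vg_def left_diff_distrib[symmetric] abs_mult)
  ultimately show ?thesis using abs_triangle_ineq3[of "v j'" "v j"] by linarith
qed

text \<open>Moving to a neighbouring velocity lowers the envelope at most by the factor \<open>exp (- s)\<close>.  Only
  the share \<open>\<theta>\<close> of the average moves, and by convexity this costs no more than \<open>exp (- \<theta> s)\<close>, whose
  exponent is bounded by a multiple of \<open>\<Delta>t\<close> that does not involve \<open>\<Delta>v\<close>.\<close>

lemma h_ge:
  assumes i: "i \<in> Ix" and j: "j \<in> Iv"
  shows "C\<^sub>0 * exp (- (t / \<epsilon>)) * lower_envelope (t + \<Delta>t) (v j) \<le> h i j"
proof -
  define \<theta> where "\<theta> = \<Delta>t / \<Delta>v * \<bar>E i\<bar>"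
  define s where "s = \<alpha> * \<Delta>v * (1 + \<bar>v j\<bar>) + \<alpha> * E1 * t * \<Delta>v"
  define c where "c = C\<^sub>0 * exp (- (t / \<epsilon>))"
  define W where "W = lower_envelope t (v j)"
  have c: "0 \<le> c" "0 \<le> W" using C\<^sub>0 by (auto simp: c_def W_def lower_envelope_def)
  have \<theta>: "0 \<le> \<theta>" "\<theta> \<le> 1" "\<theta> * \<Delta>v \<le> \<Delta>t * E1" unfolding \<theta>_def using weight_E[OF i] by auto
  have "(1 - \<theta>) * (c * W) + \<theta> * (c * (exp (- s) * W)) \<le> h i j"
    unfolding \<theta>_def
  proof (rule transport_ge[OF i j])
    show "c * W \<le> g i' j" if "i' \<in> Ix" for i' using g_ge[OF that j] by (simp add: c_def W_def)
    fix j' assume j': "j' \<in> Iv" "\<bar>j' - j\<bar> \<le> 1"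
    have "exp (- s) * W \<le> lower_envelope t (v j')"
      unfolding s_def W_def using speed_neighbour[OF j'(2)] t by (intro lower_envelope_shift) auto
    then have "c * (exp (- s) * W) \<le> c * lower_envelope t (v j')" using c by (intro mult_left_mono)
    then show "c * (exp (- s) * W) \<le> g i j'" using g_ge[OF i j'(1)] by (simp add: c_def)
  qed (use \<Delta> cfl_E[OF i j] in auto)
  moreover have "exp (- (\<theta> * s)) * (c * W) \<le> ((1 - \<theta>) + \<theta> * exp (- s)) * (c * W)"
    using c \<theta> by (intro mult_right_mono convex_combination_exp_ge) auto
  moreover have "c * lower_envelope (t + \<Delta>t) (v j) \<le> c * (exp (- (\<theta> * s)) * W)"
    unfolding s_def W_def using c \<theta> t by (intro mult_left_mono lower_envelope_step) auto
  ultimately show ?thesis unfolding c_def[symmetric] by (simp add: algebra_simps)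
qed

lemma h_nonneg:
  assumes "i \<in> Ix" "j \<in> Iv"
  shows "0 \<le> h i j"
proof -
  have "0 \<le> C\<^sub>0 * exp (- (t / \<epsilon>)) * lower_envelope (t + \<Delta>t) (v j)" using C\<^sub>0 by (simp add: lower_envelope_def)
  then show ?thesis using h_ge[OF assms] by linarith
qed

text \<open>The weighted norm after transport, kept separate from its final bound \<open>H\<close> because the relaxation
  step has to be estimated without loss.\<close>

definition N_bound :: real where
  "N_bound = (1 + E2 * \<Delta>t) * (exp (upper_rate * t) * F)"

lemma h_le:
  assumes i: "i \<in> Ix" and j: "j \<in> Iv"
  shows "h i j \<le> N_bound * (1 + \<bar>v j\<bar>) powr (- q)"
proof -
  define \<theta> where "\<theta> = \<Delta>t / \<Delta>v * \<bar>E i\<bar>"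
  define c where "c = exp (upper_rate * t) * F"
  define W where "W = (1 + \<bar>v j\<bar>) powr (- q)"
  define k where "k = 2 powr q - 1"
  have c: "0 \<le> c" "0 \<le> W" using F_pos by (auto simp: c_def W_def)
  have k: "0 \<le> k" using q by (simp add: k_def ge_one_powr_ge_zero)
  have \<theta>: "\<theta> * \<Delta>v \<le> \<Delta>t * E1" unfolding \<theta>_def using weight_E[OF i] by auto
  have "h i j \<le> (1 - \<theta>) * (c * W) + \<theta> * (c * ((1 + k * \<Delta>v) * W))"
    unfolding \<theta>_def
  proof (rule transport_le[OF i j])
    show "g i' j \<le> c * W" if "i' \<in> Ix" for i' using g_le[OF that j] by (simp add: c_def W_def)
    fix j' assume j': "j' \<in> Iv" "\<bar>j' - j\<bar> \<le> 1"
    have "(1 + \<bar>v j'\<bar>) powr (- q) \<le> (1 + k * \<Delta>v) * W"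
      unfolding k_def W_def using speed_neighbour[OF j'(2)] q \<Delta> \<Delta>v_less_16 by (intro weight_shift_le) auto
    then have "c * (1 + \<bar>v j'\<bar>) powr (- q) \<le> c * ((1 + k * \<Delta>v) * W)" using c by (intro mult_left_mono)
    moreover have "g i j' \<le> c * (1 + \<bar>v j'\<bar>) powr (- q)" unfolding c_def by (rule g_le[OF i j'(1)])
    ultimately show "g i j' \<le> c * ((1 + k * \<Delta>v) * W)" by linarith
  qed (use \<Delta> cfl_E[OF i j] in auto)
  also have "\<dots> = (1 + \<theta> * \<Delta>v * k) * (c * W)" by (simp add: algebra_simps)
  also have "\<dots> \<le> (1 + \<Delta>t * E1 * k) * (c * W)"
    using \<theta> c k by (intro mult_right_mono add_left_mono) auto
  also have "\<Delta>t * E1 * k = E2 * \<Delta>t" by (simp add: C_E2_def k_def)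
  finally show ?thesis by (simp add: N_bound_def c_def W_def mult.assoc)
qed

lemma N_bound_le_H: "N_bound \<le> H_const"
proof -
  have "E2 * \<Delta>t \<le> E2" using mult_left_le[of \<Delta>t E2] \<Delta>t_le E2_ge by simp
  moreover have "upper_rate * t \<le> upper_rate * T\<^sub>f" using t upper_rate_nonneg by (intro mult_left_mono)
  ultimately have "(1 + E2 * \<Delta>t) * (exp (upper_rate * t) * F) \<le> (1 + E2) * (exp (upper_rate * T\<^sub>f) * F)"
    using F_pos E2_ge by (intro mult_mono) auto
  then show ?thesis by (simp add: N_bound_def H_const_def mult.assoc)
qed

lemma h_le_H:
  assumes i: "i \<in> Ix" and j: "j \<in> Iv"
  shows "h i j \<le> H_const * (1 + \<bar>v j\<bar>) powr (- q)"
  by (rule order_trans[OF h_le[OF i j]]) (intro mult_right_mono N_bound_le_H, simp)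

lemma total_h_le: "total h \<le> total g + \<Delta>t"
proof -
  define b where "b = exp (upper_rate * t) * F * (1 + real N\<^sub>v * \<Delta>v) powr (- q)"
  have ends: "int N\<^sub>v \<in> Iv" "- int N\<^sub>v \<in> Iv" "\<bar>v (int N\<^sub>v)\<bar> = real N\<^sub>v * \<Delta>v" "\<bar>v (- int N\<^sub>v)\<bar> = real N\<^sub>v * \<Delta>v"
    using \<Delta> by (auto simp: I_v_def vg_def abs_mult)
  have E1b: "E1 * b \<le> 1" unfolding b_def by (rule boundary_flux_le[OF t(2)])
  have "(\<Sum>i\<in>Ix. E i * (g i (- int N\<^sub>v) - g i (int N\<^sub>v))) \<le> (\<Sum>i\<in>Ix. 1)"
  proof (rule sum_mono)
    fix i assume i: "i \<in> Ix"
    have "g i (int N\<^sub>v) \<le> b" "g i (- int N\<^sub>v) \<le> b"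
      using g_le[OF i ends(1)] g_le[OF i ends(2)] unfolding ends b_def by auto
    moreover have "0 \<le> g i (int N\<^sub>v)" "0 \<le> g i (- int N\<^sub>v)" using g_nonneg i ends by auto
    ultimately have "\<bar>g i (- int N\<^sub>v) - g i (int N\<^sub>v)\<bar> \<le> b" by linarith
    then have "\<bar>E i * (g i (- int N\<^sub>v) - g i (int N\<^sub>v))\<bar> \<le> E1 * b"
      unfolding abs_mult using abs_E_le[OF i] E1_ge by (intro mult_mono) auto
    then show "E i * (g i (- int N\<^sub>v) - g i (int N\<^sub>v)) \<le> 1" using E1b by linarith
  qed
  also have "\<dots> = real N\<^sub>x" by (simp add: I_x_def)
  finally have flux: "\<Delta>t * \<Delta>x * (\<Sum>i\<in>Ix. E i * (g i (- int N\<^sub>v) - g i (int N\<^sub>v))) \<le> \<Delta>t * \<Delta>x * real N\<^sub>x"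
    using \<Delta> by (intro mult_left_mono) auto
  have "total h = \<Delta>x * \<Delta>v * (\<Sum>i\<in>Ix. \<Sum>j\<in>Iv. h i j)" by (simp add: total_def sum_distrib_left mult_ac)
  also have "\<dots> = \<Delta>x * \<Delta>v * (\<Sum>i\<in>Ix. \<Sum>j\<in>Iv. g i j) + \<Delta>t * \<Delta>x * (\<Sum>i\<in>Ix. E i * (g i (- int N\<^sub>v) - g i (int N\<^sub>v)))"
    unfolding transport_total using \<Delta> by (simp add: distrib_left)
  also have "\<Delta>x * \<Delta>v * (\<Sum>i\<in>Ix. \<Sum>j\<in>Iv. g i j) = total g" by (simp add: total_def sum_distrib_left mult_ac)
  finally have "total h \<le> total g + \<Delta>t * \<Delta>x * real N\<^sub>x" using flux by simp
  moreover have "\<Delta>t * \<Delta>x * real N\<^sub>x = \<Delta>t" using N\<^sub>x by (simp add: mult.assoc mult.commute)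
  ultimately show ?thesis by simp
qed

lemma lower_factor_le: "exp (- (S + 1 / \<epsilon>) * T\<^sub>f) \<le> exp (- (t / \<epsilon>)) * exp (- (S * T\<^sub>f))"
proof -
  have "t / \<epsilon> \<le> T\<^sub>f / \<epsilon>" using t \<epsilon> by (intro divide_right_mono) auto
  then show ?thesis by (simp add: algebra_simps flip: exp_add)
qed

lemma h_ge_via_envelope:
  assumes i: "i \<in> Ix" and j: "j \<in> Iv"
    and y: "0 \<le> y" "exp (- (S * T\<^sub>f)) * y \<le> lower_envelope (t + \<Delta>t) (v j)"
  shows "C\<^sub>0 * exp (- (S + 1 / \<epsilon>) * T\<^sub>f) * y \<le> h i j"
proof -
  have "C\<^sub>0 * exp (- (S + 1 / \<epsilon>) * T\<^sub>f) * y \<le> C\<^sub>0 * (exp (- (t / \<epsilon>)) * exp (- (S * T\<^sub>f))) * y"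
    using y C\<^sub>0 by (intro mult_right_mono mult_left_mono lower_factor_le) auto
  also have "\<dots> = C\<^sub>0 * exp (- (t / \<epsilon>)) * (exp (- (S * T\<^sub>f)) * y)" by simp
  also have "\<dots> \<le> C\<^sub>0 * exp (- (t / \<epsilon>)) * lower_envelope (t + \<Delta>t) (v j)"
    using y C\<^sub>0 by (intro mult_left_mono) auto
  also have "\<dots> \<le> h i j" by (rule h_ge[OF i j])
  finally show ?thesis .
qed

lemma h_ge_final:
  assumes i: "i \<in> Ix" and j: "j \<in> Iv"
  shows "C\<^sub>0 * exp (- (S + 1 / \<epsilon>) * T\<^sub>f) * exp (- (\<bar>v j\<bar> powr \<alpha>) - 2 * \<alpha> * E1 * T\<^sub>f * \<bar>v j\<bar>) \<le> h i j"
proof -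
  have bounds: "\<alpha> * E1 * (t + \<Delta>t) \<le> 2 * \<alpha> * E1 * T\<^sub>f"
    "2 * \<alpha> * E1 * T\<^sub>f + \<alpha> * E1\<^sup>2 * (t + \<Delta>t)\<^sup>2 / 2 \<le> S * T\<^sub>f"
    using lower_envelope_exponent_le[of "t + \<Delta>t"] t \<Delta> by auto
  have "\<alpha> * E1 * (t + \<Delta>t) * \<bar>v j\<bar> \<le> 2 * \<alpha> * E1 * T\<^sub>f * \<bar>v j\<bar>"
    using bounds(1) by (intro mult_right_mono) auto
  then have "exp (- (S * T\<^sub>f)) * exp (- (\<bar>v j\<bar> powr \<alpha>) - 2 * \<alpha> * E1 * T\<^sub>f * \<bar>v j\<bar>) \<le> lower_envelope (t + \<Delta>t) (v j)"
    unfolding lower_envelope_def exp_add[symmetric] exp_le_cancel_iff using bounds by linarith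
  then show ?thesis by (intro h_ge_via_envelope i j) auto
qed

lemma h_ge_low_speed:
  assumes i: "i \<in> Ix" and j: "j \<in> Iv" and slow: "\<bar>v j\<bar> \<le> 1"
  shows "C\<^sub>0 * exp (- (S + 1 / \<epsilon>) * T\<^sub>f) * exp (- 2) \<le> h i j"
proof -
  have bounds: "2 * \<alpha> * E1 * (t + \<Delta>t) \<le> 2 * \<alpha> * E1 * T\<^sub>f + 1"
    "2 * \<alpha> * E1 * T\<^sub>f + \<alpha> * E1\<^sup>2 * (t + \<Delta>t)\<^sup>2 / 2 \<le> S * T\<^sub>f"
    using lower_envelope_exponent_le[of "t + \<Delta>t"] t \<Delta> by auto
  have "0 \<le> \<alpha> * E1 * (t + \<Delta>t)" using \<alpha> E1_ge t \<Delta> by (intro mult_nonneg_nonneg) auto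
  then have "\<alpha> * E1 * (t + \<Delta>t) * \<bar>v j\<bar> \<le> \<alpha> * E1 * (t + \<Delta>t) * 1"
    using slow by (intro mult_left_mono) auto
  moreover have "\<bar>v j\<bar> powr \<alpha> \<le> 1" using slow \<alpha> powr_mono2[of \<alpha> "\<bar>v j\<bar>" 1] by simp
  ultimately have "exp (- (S * T\<^sub>f)) * exp (- 2) \<le> lower_envelope (t + \<Delta>t) (v j)"
    unfolding lower_envelope_def exp_add[symmetric] exp_le_cancel_iff using bounds by linarith
  then show ?thesis by (intro h_ge_via_envelope i j) auto
qed

lemma \<rho>_ge:
  assumes i: "i \<in> Ix"
  shows "C\<^sub>0 * D / 2 * exp (- (S + 1 / \<epsilon>) * T\<^sub>f) \<le> \<rho> i"
proof -
  define c where "c = C\<^sub>0 * exp (- (S + 1 / \<epsilon>) * T\<^sub>f)"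
  have c: "0 \<le> c" using C\<^sub>0 by (simp add: c_def)
  have "C\<^sub>0 * D / 2 * exp (- (S + 1 / \<epsilon>) * T\<^sub>f) = c * (D / 2)" by (simp add: c_def)
  also have "\<dots> \<le> c * (\<Sum>j\<in>Iv. exp (- (\<bar>v j\<bar> powr \<alpha>) - 2 * \<alpha> * E1 * T\<^sub>f * \<bar>v j\<bar>) * \<Delta>v)"
    using mesh_sums(1) c by (intro mult_left_mono)
  also have "\<dots> = (\<Sum>j\<in>Iv. c * exp (- (\<bar>v j\<bar> powr \<alpha>) - 2 * \<alpha> * E1 * T\<^sub>f * \<bar>v j\<bar>) * \<Delta>v)"
    by (simp add: sum_distrib_left mult.assoc)
  also have "\<dots> \<le> \<rho> i"
    unfolding rho_def c_def using h_ge_final[OF i] \<Delta> by (intro sum_mono mult_right_mono) auto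
  finally show ?thesis .
qed

lemma \<rho>_pos: "i \<in> Ix \<Longrightarrow> 0 < \<rho> i"
proof -
  assume "i \<in> Ix"
  moreover have "0 < C\<^sub>0 * D / 2 * exp (- (S + 1 / \<epsilon>) * T\<^sub>f)" using C\<^sub>0 D_bounds by simp
  ultimately show ?thesis using \<rho>_ge by fastforce
qed

lemma heat_eq:
  assumes i: "i \<in> Ix"
  shows "\<rho> i * T i = (\<Sum>j\<in>Iv. h i j * (v j - U i)\<^sup>2 * \<Delta>v)"
  using \<rho>_pos[OF i] by (simp add: temp_def)

text \<open>The energy at speeds at most one is bounded below by half the lower bound of the distribution
  there, and \<open>exp 2 \<le> 9\<close>.\<close>

lemma heat_ge:
  assumes i: "i \<in> Ix"
  shows "C\<^sub>0 * exp (- (S + 1 / \<epsilon>) * T\<^sub>f) / 18 \<le> \<rho> i * T i"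
proof -
  have "exp 2 \<le> (9 :: real)"
  proof -
    have "exp (1 :: real) ^ 2 \<le> 3 ^ 2" using exp_le by (intro power_mono) auto
    then show ?thesis by (simp flip: exp_double)
  qed
  then have e: "1 / 9 \<le> exp (- 2 :: real)" by (simp add: exp_minus field_simps)
  have c: "0 \<le> C\<^sub>0 * exp (- (S + 1 / \<epsilon>) * T\<^sub>f)" using C\<^sub>0 by simp
  have V: "1 \<le> real N\<^sub>v * \<Delta>v"
  proof -
    have "1 powr (- \<gamma>) \<le> \<Delta>v powr (- \<gamma>)" using \<Delta> \<Delta>v_less_16 \<gamma> by (intro powr_mono2') auto
    then have "1 * 1 \<le> E1 * \<Delta>v powr (- \<gamma>)" using E1_ge by (intro mult_mono) auto
    then show ?thesis using N\<^sub>v by simp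
  qed
  have "C\<^sub>0 * exp (- (S + 1 / \<epsilon>) * T\<^sub>f) * exp (- 2) / 2
      \<le> (\<Sum>j\<in>{- int N\<^sub>v .. int N\<^sub>v}. h i j * (of_int j * \<Delta>v - U i)\<^sup>2 * \<Delta>v)"
  proof (rule thermal_energy_ge)
    show "C\<^sub>0 * exp (- (S + 1 / \<epsilon>) * T\<^sub>f) * exp (- 2) \<le> h i j"
      if "j \<in> {- int N\<^sub>v .. int N\<^sub>v}" "\<bar>of_int j * \<Delta>v\<bar> \<le> 1" for j
      using h_ge_low_speed[OF i, of j] that by (simp add: I_v_def vg_def)
  qed (use \<Delta> \<Delta>v_less_16 V c h_nonneg[OF i] in \<open>auto simp: I_v_def\<close>)
  also have "\<dots> = \<rho> i * T i" unfolding heat_eq[OF i] by (simp add: I_v_def vg_def)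
  finally have "C\<^sub>0 * exp (- (S + 1 / \<epsilon>) * T\<^sub>f) * exp (- 2) / 2 \<le> \<rho> i * T i" .
  moreover have "C\<^sub>0 * exp (- (S + 1 / \<epsilon>) * T\<^sub>f) * (1 / 9) \<le> C\<^sub>0 * exp (- (S + 1 / \<epsilon>) * T\<^sub>f) * exp (- 2)"
    using e c by (intro mult_left_mono)
  ultimately show ?thesis by linarith
qed

lemma density:
  assumes i: "i \<in> Ix"
  shows "grid_density Iv \<Delta>v (h i) (\<rho> i) (U i) (T i)"
proof
  show "\<rho> i * U i = (\<Sum>j\<in>Iv. h i j * (of_int j * \<Delta>v) * \<Delta>v)" using \<rho>_pos[OF i] by (simp add: vel_def vg_def)
  show "\<rho> i * T i = (\<Sum>j\<in>Iv. h i j * (of_int j * \<Delta>v - U i)\<^sup>2 * \<Delta>v)" unfolding heat_eq[OF i] by (simp add: vg_def)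
  have "0 < C\<^sub>0 * exp (- (S + 1 / \<epsilon>) * T\<^sub>f) / 18" using C\<^sub>0 by simp
  then have "0 < \<rho> i * T i" using heat_ge[OF i] by linarith
  then show "0 < T i" using \<rho>_pos[OF i] by (simp add: zero_less_mult_iff)
qed (use \<rho>_pos[OF i] h_nonneg[OF i] \<Delta> in \<open>auto simp: I_v_def rho_def\<close>)

lemma h_le_H_unweighted:
  assumes "i \<in> Ix" "j \<in> Iv"
  shows "h i j \<le> H_const"
proof -
  have "(1 + \<bar>v j\<bar>) powr (- q) \<le> 1" using q powr_mono2'[of "- q" 1 "1 + \<bar>v j\<bar>"] by simp
  then have "H_const * (1 + \<bar>v j\<bar>) powr (- q) \<le> H_const * 1" using H_pos by (intro mult_left_mono) auto
  then show ?thesis using h_le_H[OF assms] by simp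
qed

text \<open>The mesh resolves the thermal speed, which is what keeps the mass and the weighted norm of the
  discrete Maxwellian under control.\<close>

lemma temperature:
  assumes i: "i \<in> Ix"
  shows "0 < T i" "\<Delta>v \<le> sqrt (T i)" "Y_const / 4000 \<le> sqrt (T i) ^ 3"
proof -
  interpret grid_density Iv \<Delta>v "h i" "\<rho> i" "U i" "T i" by (rule density[OF i])
  define c where "c = C\<^sub>0 * exp (- (S + 1 / \<epsilon>) * T\<^sub>f)"
  have c: "0 < c" using C\<^sub>0 by (simp add: c_def)
  have HY: "H_const * Y_const \<le> 8 * c"
    unfolding H_Y c_def using D_bounds C\<^sub>0 by (simp add: mult.commute)
  have heat18: "c / 18 \<le> \<rho> i * T i" using heat_ge[OF i] by (simp add: c_def)
  have "8 * H_const * \<Delta>v ^ 3 \<le> 8 * H_const * (Y_const / 3200)"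
    using \<Delta>v_cubed_le H_pos by (intro mult_left_mono) auto
  \<comment> \<open>The left-hand side is at most \<open>8 (8 c) / 3200 = c / 50\<close>.\<close>
  then have fine: "8 * H_const * \<Delta>v ^ 3 \<le> \<rho> i * T i" using HY heat18 c by simp
  note low = temperature_lower_bound[OF h_le_H_unweighted[OF i] fine]
  show "0 < T i" by (rule T)
  show "\<Delta>v \<le> sqrt (T i)" using low(1) by blast
  have "\<rho> i * T i \<le> 8 * H_const * sqrt (T i) ^ 3" using low(2) by blast
  then have "H_const * (Y_const / 4000) \<le> H_const * sqrt (T i) ^ 3"
    using HY heat18 c by simp
  then show "Y_const / 4000 \<le> sqrt (T i) ^ 3" using H_pos by (rule mult_left_le_imp_le)
qed

lemma decaying_density:
  assumes i: "i \<in> Ix"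
  shows "decaying_grid_density Iv \<Delta>v (h i) (\<rho> i) (U i) (T i) q N_bound"
proof -
  interpret grid_density Iv \<Delta>v "h i" "\<rho> i" "U i" "T i" by (rule density[OF i])
  show ?thesis
    by unfold_locales (use q h_le[OF i] temperature(2)[OF i] in \<open>auto simp: vg_def\<close>)
qed

lemma M_nonneg:
  assumes "i \<in> Ix"
  shows "0 \<le> M i j"
  using \<rho>_pos[OF assms] temperature(1)[OF assms] by (simp add: maxwellian_def)

lemma M_le:
  assumes i: "i \<in> Ix"
  shows "M i j \<le> CX * N_bound * (1 + \<bar>v j\<bar>) powr (- q)"
proof -
  interpret decaying_grid_density Iv \<Delta>v "h i" "\<rho> i" "U i" "T i" q N_bound by (rule decaying_density[OF i])
  have "M i j * (1 + \<bar>v j\<bar>) powr q * (1 + \<bar>v j\<bar>) powr (- q) \<le> CX * N_bound * (1 + \<bar>v j\<bar>) powr (- q)"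
    unfolding maxwellian_def using maxwellian_weighted_le[of "v j"] by (intro mult_right_mono) auto
  moreover have "(1 + \<bar>v j\<bar>) powr q * (1 + \<bar>v j\<bar>) powr (- q) = 1"
    by (simp add: powr_minus field_simps add_nonneg_eq_0_iff)
  ultimately show ?thesis by (simp add: mult.assoc)
qed

lemma M_sum_le:
  assumes i: "i \<in> Ix"
  shows "(\<Sum>j\<in>Iv. M i j * \<Delta>v) \<le> 2 * \<rho> i"
proof -
  have "(\<Sum>j\<in>Iv. M i j * \<Delta>v)
      = \<rho> i * (\<Sum>j\<in>Iv. 1 / sqrt (2 * pi * T i) * exp (- (\<bar>of_int j * \<Delta>v - U i\<bar>\<^sup>2 / (2 * T i))) * \<Delta>v)"
    by (simp add: maxwellian_def vg_def sum_distrib_left mult_ac)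
  also have "\<dots> \<le> \<rho> i * 2"
    using \<rho>_pos[OF i] temperature[OF i] \<Delta> by (intro mult_left_mono maxwellian_grid_sum_le) (auto simp: I_v_def)
  finally show ?thesis by simp
qed

text \<open>Relaxation averages \<open>h\<close> and its Maxwellian with weights \<open>\<epsilon>\<close> and \<open>\<Delta>t\<close>, so it changes each bound
  by a factor \<open>1 + O(\<Delta>t / \<epsilon>)\<close>, that is, at most by an exponential rate.\<close>

lemma invariant_step: "invariant (Suc n) (\<lambda>i j. (\<epsilon> * h i j + \<Delta>t * M i j) / (\<epsilon> + \<Delta>t))"
proof -
  let ?f = "\<lambda>i j. (\<epsilon> * h i j + \<Delta>t * M i j) / (\<epsilon> + \<Delta>t)"
  have t': "real (Suc n) * \<Delta>t = t + \<Delta>t" by (simp add: algebra_simps)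
  have pos: "0 < \<epsilon> + \<Delta>t" using \<epsilon> \<Delta> by simp
  have growth: "1 + \<Delta>t / \<epsilon> \<le> exp (\<Delta>t / \<epsilon>)" by (rule exp_ge_add_one_self)
  have lower: "C\<^sub>0 * exp (- ((t + \<Delta>t) / \<epsilon>)) * lower_envelope (t + \<Delta>t) (v j) \<le> ?f i j"
    if i: "i \<in> Ix" and j: "j \<in> Iv" for i j
  proof -
    have "exp (- (\<Delta>t / \<epsilon>)) \<le> \<epsilon> / (\<epsilon> + \<Delta>t)"
    proof -
      have "exp (- (\<Delta>t / \<epsilon>)) = 1 / exp (\<Delta>t / \<epsilon>)" by (simp add: exp_minus inverse_eq_divide)
      also have "\<dots> \<le> 1 / (1 + \<Delta>t / \<epsilon>)" using growth \<epsilon> \<Delta> by (intro divide_left_mono) (auto simp: add_pos_pos)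
      also have "\<dots> = \<epsilon> / (\<epsilon> + \<Delta>t)" using \<epsilon> \<Delta> by (simp add: field_simps)
      finally show ?thesis .
    qed
    then have "exp (- (\<Delta>t / \<epsilon>)) * (C\<^sub>0 * exp (- (t / \<epsilon>)) * lower_envelope (t + \<Delta>t) (v j)) \<le> \<epsilon> / (\<epsilon> + \<Delta>t) * h i j"
      using h_ge[OF i j] \<epsilon> \<Delta> C\<^sub>0 by (intro mult_mono) (auto simp: lower_envelope_def)
    moreover have "exp (- ((t + \<Delta>t) / \<epsilon>)) = exp (- (\<Delta>t / \<epsilon>)) * exp (- (t / \<epsilon>))"
      by (simp add: add_divide_distrib flip: exp_add)
    moreover have "\<epsilon> / (\<epsilon> + \<Delta>t) * h i j \<le> ?f i j"
      using M_nonneg[OF i, of j] \<Delta> pos by (simp add: divide_right_mono)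
    ultimately show ?thesis by (simp add: mult_ac)
  qed
  have upper: "?f i j \<le> exp (upper_rate * (t + \<Delta>t)) * F * (1 + \<bar>v j\<bar>) powr (- q)"
    if i: "i \<in> Ix" and j: "j \<in> Iv" for i j
  proof -
    let ?w = "(1 + \<bar>v j\<bar>) powr (- q)"
    have Nw: "0 \<le> N_bound * ?w" using h_nonneg[OF i j] h_le[OF i j] by linarith
    have "\<epsilon> * h i j + \<Delta>t * M i j \<le> \<epsilon> * (N_bound * ?w) + \<Delta>t * (CX * N_bound * ?w)"
      using h_le[OF i j] M_le[OF i, of j] \<epsilon> \<Delta> by (intro add_mono mult_left_mono) auto
    then have "?f i j \<le> (\<epsilon> + \<Delta>t * CX) / (\<epsilon> + \<Delta>t) * (N_bound * ?w)"
      using pos by (simp add: divide_right_mono algebra_simps)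
    also have "\<dots> \<le> exp ((CX - 1) / \<epsilon> * \<Delta>t) * (N_bound * ?w)"
    proof (rule mult_right_mono[OF _ Nw])
      have "(\<epsilon> + \<Delta>t * CX) / (\<epsilon> + \<Delta>t) = 1 + \<Delta>t * (CX - 1) / (\<epsilon> + \<Delta>t)" using pos by (simp add: field_simps)
      also have "\<dots> \<le> 1 + \<Delta>t * (CX - 1) / \<epsilon>"
        using \<epsilon> \<Delta> CX_ge by (intro add_left_mono divide_left_mono) auto
      also have "\<dots> = 1 + (CX - 1) / \<epsilon> * \<Delta>t" by simp
      also have "\<dots> \<le> exp ((CX - 1) / \<epsilon> * \<Delta>t)" by (rule exp_ge_add_one_self)
      finally show "(\<epsilon> + \<Delta>t * CX) / (\<epsilon> + \<Delta>t) \<le> exp ((CX - 1) / \<epsilon> * \<Delta>t)" .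
    qed
    also have "\<dots> \<le> exp ((CX - 1) / \<epsilon> * \<Delta>t) * (exp (E2 * \<Delta>t) * (exp (upper_rate * t) * F) * ?w)"
      unfolding N_bound_def using F_pos exp_ge_add_one_self[of "E2 * \<Delta>t"]
      by (intro mult_left_mono mult_right_mono) auto
    also have "\<dots> = exp ((CX - 1) / \<epsilon> * \<Delta>t) * exp (E2 * \<Delta>t) * exp (upper_rate * t) * F * ?w"
      by (simp only: mult.assoc)
    also have "exp ((CX - 1) / \<epsilon> * \<Delta>t) * exp (E2 * \<Delta>t) * exp (upper_rate * t) = exp (upper_rate * (t + \<Delta>t))"
    proof -
      have "upper_rate * \<Delta>t = E2 * \<Delta>t + (CX - 1) / \<epsilon> * \<Delta>t" by (simp add: upper_rate_def distrib_right)
      then show ?thesis unfolding exp_add[symmetric] distrib_left[of upper_rate] by (simp only: ac_simps)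
    qed
    finally show ?thesis .
  qed
  have "total ?f \<le> exp ((t + \<Delta>t) / \<epsilon>) * (2 + (t + \<Delta>t))"
  proof -
    have inner: "(\<Sum>j\<in>Iv. ?f i j * \<Delta>x * \<Delta>v) \<le> (1 + \<Delta>t / \<epsilon>) * (\<Sum>j\<in>Iv. h i j * \<Delta>x * \<Delta>v)"
      if i: "i \<in> Ix" for i
    proof -
      have "(\<Sum>j\<in>Iv. ?f i j * \<Delta>x * \<Delta>v) = (\<epsilon> * \<rho> i + \<Delta>t * (\<Sum>j\<in>Iv. M i j * \<Delta>v)) / (\<epsilon> + \<Delta>t) * \<Delta>x"
        by (simp add: rho_def sum_distrib_left sum_distrib_right sum_divide_distrib sum.distrib[symmetric] add_divide_distrib distrib_left distrib_right mult_ac)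
      also have "\<dots> \<le> (\<epsilon> * \<rho> i + \<Delta>t * (2 * \<rho> i)) / (\<epsilon> + \<Delta>t) * \<Delta>x"
        using M_sum_le[OF i] \<Delta> pos by (intro mult_right_mono divide_right_mono add_left_mono mult_left_mono) auto
      also have "\<dots> = (1 + \<Delta>t / (\<epsilon> + \<Delta>t)) * (\<rho> i * \<Delta>x)" using pos by (simp add: field_simps)
      also have "\<dots> \<le> (1 + \<Delta>t / \<epsilon>) * (\<rho> i * \<Delta>x)"
        using \<epsilon> \<Delta> \<rho>_pos[OF i] by (intro mult_right_mono add_left_mono divide_left_mono) auto
      also have "\<rho> i * \<Delta>x = (\<Sum>j\<in>Iv. h i j * \<Delta>x * \<Delta>v)" by (simp add: rho_def sum_distrib_left mult_ac)
      finally show ?thesis .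
    qed
    have "total ?f \<le> (1 + \<Delta>t / \<epsilon>) * total h"
      unfolding total_def sum_distrib_left[of "1 + \<Delta>t / \<epsilon>" _ Ix] by (rule sum_mono[OF inner])
    also have "\<dots> \<le> exp (\<Delta>t / \<epsilon>) * (exp (t / \<epsilon>) * (2 + t) + \<Delta>t)"
    proof (rule mult_mono[OF growth])
      show "total h \<le> exp (t / \<epsilon>) * (2 + t) + \<Delta>t" using total_h_le total_g_le by linarith
      show "0 \<le> total h" unfolding total_def using h_nonneg \<Delta> by (intro sum_nonneg) auto
    qed auto
    also have "\<dots> \<le> exp (\<Delta>t / \<epsilon>) * (exp (t / \<epsilon>) * (2 + t) + exp (t / \<epsilon>) * \<Delta>t)"
    proof -
      have "1 * \<Delta>t \<le> exp (t / \<epsilon>) * \<Delta>t" using t \<epsilon> \<Delta> by (intro mult_right_mono) auto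
      then show ?thesis by (intro mult_left_mono) auto
    qed
    also have "\<dots> = exp ((t + \<Delta>t) / \<epsilon>) * (2 + (t + \<Delta>t))"
      by (simp add: add_divide_distrib exp_add algebra_simps)
    finally show ?thesis .
  qed
  then show ?thesis unfolding invariant_def t' using lower upper by blast
qed

end

lemma norm_x_le:
  assumes "0 < N" "\<And>i. i \<in> I_x N \<Longrightarrow> \<bar>b i\<bar> \<le> B"
  shows "norm_x N b \<le> B"
  unfolding norm_x_def using assms by (intro cSUP_least) (auto simp: I_x_def)

context bgk_step
begin

subsection \<open>The stability estimate\<close>

lemma N\<^sub>x_pos: "0 < N\<^sub>x"
  using N\<^sub>x by (cases "N\<^sub>x = 0") auto

lemma moment_le:
  assumes i: "i \<in> Ix" and m: "m \<le> 2"
  shows "(\<Sum>j\<in>Iv. h i j * \<bar>v j\<bar> ^ m * \<Delta>v) \<le> 2 * H_const * D_bar (q - 2)"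
proof -
  have m': "real m \<in> {0, 1, 2}" using m by auto
  have "(\<Sum>j\<in>Iv. h i j * \<bar>v j\<bar> ^ m * \<Delta>v) \<le> (\<Sum>j\<in>Iv. H_const * ((1 + \<bar>v j\<bar>) powr (real m - q) * \<Delta>v))"
  proof (rule sum_mono)
    fix j assume j: "j \<in> Iv"
    have "h i j * \<bar>v j\<bar> ^ m \<le> H_const * (1 + \<bar>v j\<bar>) powr (- q) * (1 + \<bar>v j\<bar>) ^ m"
      using h_le_H[OF i j] h_nonneg[OF i j] H_pos by (intro mult_mono power_mono) auto
    also have "(1 + \<bar>v j\<bar>) ^ m = (1 + \<bar>v j\<bar>) powr real m" by (simp add: powr_realpow add_pos_nonneg)
    also have "H_const * (1 + \<bar>v j\<bar>) powr (- q) * (1 + \<bar>v j\<bar>) powr real m = H_const * (1 + \<bar>v j\<bar>) powr (real m - q)"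
      using powr_add[of "1 + \<bar>v j\<bar>" "- q" "real m"] by (simp add: mult.assoc)
    finally show "h i j * \<bar>v j\<bar> ^ m * \<Delta>v \<le> H_const * ((1 + \<bar>v j\<bar>) powr (real m - q) * \<Delta>v)"
      using \<Delta> by (simp add: mult_right_mono flip: mult.assoc)
  qed
  also have "\<dots> = H_const * (\<Sum>j\<in>Iv. (1 + \<bar>v j\<bar>) powr (real m - q) * \<Delta>v)" by (simp add: sum_distrib_left)
  also have "\<dots> \<le> H_const * (2 * D_bar (q - real m))"
    using mesh_sums(2)[OF m'] H_pos by (intro mult_left_mono) auto
  also have "\<dots> \<le> H_const * (2 * D_bar (q - 2))"
  proof -
    have "2 / (q - real m - 1) \<le> 2 / (q - 2 - 1)" using m q by (intro divide_left_mono) auto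
    then have "D_bar (q - real m) \<le> D_bar (q - 2)" using m q by (simp add: D_bar_eq)
    then show ?thesis using H_pos by simp
  qed
  finally show ?thesis by simp
qed

definition B_const :: real where
  "B_const = D_bar (q - 2) * (1 + 8 / (C\<^sub>0 * D)) * (1 + E2) * exp (Q * T\<^sub>f) * F"

text \<open>A moment divided by the density: the factor \<open>e\<close> to the power \<open>- (S + 1 / \<epsilon>) T\<^sub>f\<close> by which the
  upper bound of the distribution falls short of \<open>e\<close> to the power \<open>Q T\<^sub>f\<close> cancels against the lower
  bound of the density.\<close>

lemma macroscopic_bounds:
  assumes i: "i \<in> Ix"
  shows "\<rho> i \<le> B_const"
    and "X \<le> 2 * H_const * D_bar (q - 2) \<Longrightarrow> X / \<rho> i \<le> B_const"
proof -
  define G where "G = (1 + E2) * F * exp (Q * T\<^sub>f)"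
  define e where "e = exp (- (S + 1 / \<epsilon>) * T\<^sub>f)"
  define b where "b = D_bar (q - 2)"
  define c where "c = C\<^sub>0 * D"
  have G: "0 < G" unfolding G_def using E2_ge F_pos by (intro mult_pos_pos) auto
  have "0 \<le> (S + 1 / \<epsilon>) * T\<^sub>f" using S_nonneg \<epsilon> T\<^sub>f by (intro mult_nonneg_nonneg add_nonneg_nonneg) auto
  then have e: "0 < e" "e \<le> 1"
    unfolding e_def mult_minus_left by (simp_all only: exp_gt_zero exp_le_one_iff neg_le_0_iff_le)
  have b: "0 < b" unfolding b_def using q by (simp add: D_bar_eq)
  have c: "0 < c" "c \<le> 4" unfolding c_def using C\<^sub>0 D_bounds C\<^sub>0_D_le_4 by auto
  have H: "H_const = G * e" unfolding H_eq G_def e_def ..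
  have B: "B_const = b * (1 + 8 / c) * G" by (simp add: B_const_def G_def b_def c_def mult_ac)
  have r: "c / 2 * e \<le> \<rho> i" using \<rho>_ge[OF i] by (simp add: c_def e_def)
  have "\<rho> i \<le> 2 * (G * e) * b"
    using moment_le[OF i, of 0] unfolding H b_def by (simp add: rho_def)
  also have "\<dots> \<le> 2 * (G * 1) * b" using e G b by (intro mult_right_mono mult_left_mono) auto
  also have "\<dots> = b * 2 * G" by simp
  also have "\<dots> \<le> b * (1 + 8 / c) * G"
    using b G c by (intro mult_right_mono mult_left_mono) (auto simp: field_simps)
  finally show "\<rho> i \<le> B_const" unfolding B .
  assume X: "X \<le> 2 * H_const * D_bar (q - 2)"
  have "X \<le> 2 * (G * e) * b" using X by (simp add: H b_def)
  also have "\<dots> = b * (4 / c) * G * (c / 2 * e)" using c by simp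
  also have "\<dots> \<le> b * (4 / c) * G * \<rho> i" using r b c G by (intro mult_left_mono) auto
  also have "\<dots> \<le> b * (1 + 8 / c) * G * \<rho> i"
    using b G c \<rho>_pos[OF i] by (intro mult_right_mono mult_left_mono) (auto simp: field_simps)
  finally show "X / \<rho> i \<le> B_const" unfolding B using \<rho>_pos[OF i] by (simp add: field_simps)
qed

lemma mean_velocity_le:
  assumes i: "i \<in> Ix"
  shows "\<bar>U i\<bar> \<le> B_const"
proof -
  have "\<bar>\<Sum>j\<in>Iv. h i j * v j * \<Delta>v\<bar> \<le> (\<Sum>j\<in>Iv. h i j * \<bar>v j\<bar> ^ 1 * \<Delta>v)"
    by (rule order_trans[OF sum_abs]) (use h_nonneg[OF i] \<Delta> in \<open>simp add: abs_mult\<close>)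
  then have "\<bar>\<Sum>j\<in>Iv. h i j * v j * \<Delta>v\<bar> / \<rho> i \<le> B_const"
    using moment_le[OF i, of 1] by (intro macroscopic_bounds(2)[OF i]) linarith
  then show ?thesis using \<rho>_pos[OF i] by (simp add: vel_def abs_divide)
qed

lemma temperature_le:
  assumes i: "i \<in> Ix"
  shows "T i \<le> B_const"
proof -
  interpret grid_density Iv \<Delta>v "h i" "\<rho> i" "U i" "T i" by (rule density[OF i])
  have "\<rho> i * (T i + (U i)\<^sup>2) = (\<Sum>j\<in>Iv. h i j * \<bar>v j\<bar> ^ 2 * \<Delta>v)"
    using second_moment by (simp add: vg_def)
  moreover have "\<rho> i * T i \<le> \<rho> i * (T i + (U i)\<^sup>2)" using \<rho>_pos[OF i] by (intro mult_left_mono) auto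
  ultimately have "\<rho> i * T i / \<rho> i \<le> B_const"
    using moment_le[OF i, of 2] by (intro macroscopic_bounds(2)[OF i]) linarith
  then show ?thesis using \<rho>_pos[OF i] by simp
qed

lemma temperature_ge:
  assumes i: "i \<in> Ix"
  shows "(C\<^sub>0 * D / (4 * (1 + E2) * 1000 * F) * exp (- Q * T\<^sub>f)) powr (2/3) \<le> T i"
proof -
  have "C\<^sub>0 * D / (4 * (1 + E2) * 1000 * F) * exp (- Q * T\<^sub>f) = Y_const / 4000"
    by (simp add: Y_const_def mult_ac)
  moreover have "(Y_const / 4000) powr (2/3) \<le> (sqrt (T i) ^ 3) powr (2/3)"
    using temperature(3)[OF i] Y_bounds by (intro powr_mono2) auto
  moreover have "(sqrt (T i) ^ 3) powr (2/3) = T i"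
  proof -
    have s: "0 < sqrt (T i)" using temperature(1)[OF i] by simp
    have "(sqrt (T i) ^ 3) powr (2/3) = (sqrt (T i) powr 3) powr (2/3)" using s by simp
    also have "\<dots> = sqrt (T i) powr 2" unfolding powr_powr by simp
    also have "\<dots> = T i" using s by simp
    finally show ?thesis .
  qed
  ultimately show ?thesis by (simp only:)
qed

lemma stability_step: "stability q \<alpha> \<eta>\<^sub>1 \<epsilon> T\<^sub>f C\<^sub>0 f\<^sub>0 1000 CX N\<^sub>x N\<^sub>v \<Delta>x \<Delta>v \<Delta>t g"
  unfolding stability_def Let_def
proof (intro conjI ballI)
  show "(\<Sum>i\<in>Ix. \<Sum>j\<in>Iv. g i j * \<Delta>x * \<Delta>v) \<le> (2 + T\<^sub>f) * exp (T\<^sub>f / \<epsilon>)"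
    using total_g_le_final by (simp add: total_def)
  show "norm_x N\<^sub>x E \<le> E1" using N\<^sub>x_pos abs_E_le by (rule norm_x_le)
  show "C\<^sub>0 / 2 * exp (- (S + 1 / \<epsilon>) * T\<^sub>f) * exp (- (\<bar>v j\<bar> powr \<alpha>)) * exp (- (2 * \<alpha> * E1 * T\<^sub>f * \<bar>v j\<bar>)) \<le> h i j"
    if i: "i \<in> Ix" and j: "j \<in> Iv" for i j
  proof -
    define y where "y = exp (- (S + 1 / \<epsilon>) * T\<^sub>f) * exp (- (\<bar>v j\<bar> powr \<alpha>) - 2 * \<alpha> * E1 * T\<^sub>f * \<bar>v j\<bar>)"
    have "C\<^sub>0 / 2 * exp (- (S + 1 / \<epsilon>) * T\<^sub>f) * exp (- (\<bar>v j\<bar> powr \<alpha>)) * exp (- (2 * \<alpha> * E1 * T\<^sub>f * \<bar>v j\<bar>)) = C\<^sub>0 / 2 * y"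
      by (simp only: y_def mult.assoc diff_conv_add_uminus[of "- (\<bar>v j\<bar> powr \<alpha>)"] exp_add)
    also have "\<dots> \<le> C\<^sub>0 * y" using C\<^sub>0 by (simp add: y_def)
    also have "\<dots> \<le> h i j" using h_ge_final[OF i j] by (simp add: y_def mult.assoc)
    finally show ?thesis .
  qed
  show "norm_xv q N\<^sub>x N\<^sub>v \<Delta>v h \<le> (1 + E2) * exp ((E2 + (CX - 1) / \<epsilon>) * T\<^sub>f) * F"
    unfolding norm_xv_def
  proof (rule cSUP_least)
    show "Ix \<times> Iv \<noteq> {}" using N\<^sub>x_pos by (auto simp: I_x_def I_v_def)
    fix p assume "p \<in> Ix \<times> Iv"
    then obtain i j where p: "p = (i, j)" "i \<in> Ix" "j \<in> Iv" by auto
    have "h i j * (1 + \<bar>v j\<bar>) powr q \<le> H_const * (1 + \<bar>v j\<bar>) powr (- q) * (1 + \<bar>v j\<bar>) powr q"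
      using h_le_H[OF p(2,3)] by (intro mult_right_mono) auto
    also have "\<dots> = H_const" by (simp add: powr_minus field_simps add_nonneg_eq_0_iff)
    finally show "(case p of (i, j) \<Rightarrow> \<bar>h i j\<bar> * (1 + \<bar>v j\<bar>) powr q) \<le> (1 + E2) * exp ((E2 + (CX - 1) / \<epsilon>) * T\<^sub>f) * F"
      using h_nonneg[OF p(2,3)] by (simp add: p(1) H_const_def upper_rate_def)
  qed
  show "C\<^sub>0 * D / 4 * exp (- (S + 1 / \<epsilon>) * T\<^sub>f) \<le> \<rho> i" if i: "i \<in> Ix" for i
  proof -
    have "C\<^sub>0 * D / 4 * exp (- (S + 1 / \<epsilon>) * T\<^sub>f) \<le> C\<^sub>0 * D / 2 * exp (- (S + 1 / \<epsilon>) * T\<^sub>f)"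
      using C\<^sub>0 D_bounds by (intro mult_right_mono) auto
    then show ?thesis using \<rho>_ge[OF i] by linarith
  qed
  show "(C\<^sub>0 * D / (4 * (1 + E2) * 1000 * F) * exp (- Q * T\<^sub>f)) powr (2/3) \<le> T i" if "i \<in> Ix" for i
    using that by (rule temperature_ge)
  show "norm_x N\<^sub>x \<rho> \<le> D_bar (q - 2) * (1 + 8 / (C\<^sub>0 * D)) * (1 + E2) * exp (Q * T\<^sub>f) * F"
    unfolding B_const_def[symmetric]
  proof (rule norm_x_le[OF N\<^sub>x_pos])
    show "\<bar>\<rho> i\<bar> \<le> B_const" if "i \<in> Ix" for i using macroscopic_bounds(1)[OF that] \<rho>_pos[OF that] by simp
  qed
  show "norm_x N\<^sub>x U \<le> D_bar (q - 2) * (1 + 8 / (C\<^sub>0 * D)) * (1 + E2) * exp (Q * T\<^sub>f) * F"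
    unfolding B_const_def[symmetric] by (intro norm_x_le N\<^sub>x_pos mean_velocity_le)
  show "norm_x N\<^sub>x T \<le> D_bar (q - 2) * (1 + 8 / (C\<^sub>0 * D)) * (1 + E2) * exp (Q * T\<^sub>f) * F"
    unfolding B_const_def[symmetric]
  proof (rule norm_x_le[OF N\<^sub>x_pos])
    show "\<bar>T i\<bar> \<le> B_const" if "i \<in> Ix" for i using temperature_le[OF that] temperature(1)[OF that] by simp
  qed
qed

end

context bgk_scheme
begin

lemma invariant_sol: "n \<le> N\<^sub>t \<Longrightarrow> invariant n (sol \<epsilon> f\<^sub>0 N\<^sub>x N\<^sub>v \<Delta>x \<Delta>v \<Delta>t n)"
proof (induction n)
  case 0
  show ?case using invariant_initial by simp
next
  case (Suc n)
  interpret bgk_step q \<alpha> \<gamma> \<eta>\<^sub>1 \<eta>\<^sub>2 \<epsilon> T\<^sub>f C\<^sub>0 f\<^sub>0 l N\<^sub>x N\<^sub>v N\<^sub>t \<Delta>x \<Delta>v \<Delta>t n "sol \<epsilon> f\<^sub>0 N\<^sub>x N\<^sub>v \<Delta>x \<Delta>v \<Delta>t n"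
    by unfold_locales (use Suc in auto)
  show ?case using invariant_step by simp
qed

lemma stability_sol:
  assumes "n \<le> N\<^sub>t"
  shows "stability q \<alpha> \<eta>\<^sub>1 \<epsilon> T\<^sub>f C\<^sub>0 f\<^sub>0 1000 CX N\<^sub>x N\<^sub>v \<Delta>x \<Delta>v \<Delta>t (sol \<epsilon> f\<^sub>0 N\<^sub>x N\<^sub>v \<Delta>x \<Delta>v \<Delta>t n)"
proof -
  interpret bgk_step q \<alpha> \<gamma> \<eta>\<^sub>1 \<eta>\<^sub>2 \<epsilon> T\<^sub>f C\<^sub>0 f\<^sub>0 l N\<^sub>x N\<^sub>v N\<^sub>t \<Delta>x \<Delta>v \<Delta>t n "sol \<epsilon> f\<^sub>0 N\<^sub>x N\<^sub>v \<Delta>x \<Delta>v \<Delta>t n"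
    by unfold_locales (use assms invariant_sol in auto)
  show ?thesis by (rule stability_step)
qed

end

section \<open>Mesh threshold and stability combined\<close>

lemma mesh_small_exists:
  assumes q: "3 < q" and \<alpha>: "1 \<le> \<alpha>" and \<gamma>: "0 < \<gamma>" and pos: "0 < \<epsilon>" "0 < T\<^sub>f" "0 < C\<^sub>0"
    and f: "C_k 2 f\<^sub>0" "W_norm 2 q f\<^sub>0 < \<infinity>" "\<And>x v. C\<^sub>0 * exp (- (\<bar>v\<bar> powr \<alpha>)) \<le> f\<^sub>0 x v"
    and mass: "(LINT x:{0..1}|lborel. (LINT v|lborel. f\<^sub>0 x v)) = 1"
  shows "\<exists>l>0. mesh_small q \<alpha> \<gamma> \<epsilon> T\<^sub>f f\<^sub>0 l"
proof -
  define E where "E = C_E1 \<epsilon> T\<^sub>f"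
  have E: "0 < E" unfolding E_def C_E1_def using pos by (intro add_nonneg_pos mult_nonneg_nonneg) auto
  define \<beta> where "\<beta> = 2 * \<alpha> * E * T\<^sub>f"
  have \<beta>: "0 \<le> \<beta>" using \<alpha> E pos by (simp add: \<beta>_def)
  let ?cut = "\<lambda>N h. real N * h = E * h powr (- \<gamma>)"
  define P where "P N h \<longleftrightarrow> (\<forall>(a, b)\<in>{(\<alpha>, \<beta>), (2, 0)}.
          (\<Sum>j\<in>I_v N. exp (- (\<bar>vg h j\<bar> powr a) - b * \<bar>vg h j\<bar>) * h) \<in> {D_int a b / 2 .. 2 * D_int a b} \<and>
          (SUP j\<in>I_v N. (1 + \<bar>vg h j\<bar>) powr q * exp (- (\<bar>vg h j\<bar> powr a) - b * \<bar>vg h j\<bar>))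
            \<in> {D_sup q a b / 2 .. 2 * D_sup q a b}) \<and>
        (\<forall>m\<in>{0, 1, 2}. (\<Sum>j\<in>I_v N. h / (1 + \<bar>vg h j\<bar>) powr (q - m)) \<in> {D_bar (q - m) / 2 .. 2 * D_bar (q - m)})" for N :: nat and h :: real
  have "eventually (\<lambda>h. \<forall>N::nat. ?cut N h \<longrightarrow> P N h) (at_right 0)"
  proof -
    have q0: "0 < q" using q by simp
    have p: "1 < q - 0" "1 < q - 1" "1 < q - 2" using q by auto
    have two: "(1::real) \<le> 2" "(0::real) \<le> 0" by auto
    note near =
      exponential_sum_near_D_int[OF \<alpha> \<beta> E \<gamma>] exponential_sum_near_D_int[OF two E \<gamma>]
      exponential_sup_near_D_sup[OF q0 \<alpha> \<beta> E \<gamma>] exponential_sup_near_D_sup[OF q0 two E \<gamma>]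
      algebraic_sum_near_D_bar[OF p(1) E \<gamma>] algebraic_sum_near_D_bar[OF p(2) E \<gamma>] algebraic_sum_near_D_bar[OF p(3) E \<gamma>]
    from near show ?thesis
    proof eventually_elim
      case (elim h)
      show ?case
      proof (intro allI impI)
        fix N :: nat
        assume "?cut N h"
        note elim[rule_format, OF this]
        then show "P N h"
          unfolding P_def I_v_def vg_def
          by (simp only: ball_simps prod.case simp_thms)
      qed
    qed
  qed
  then obtain l1 where l1: "0 < l1" "\<And>h N. 0 < h \<Longrightarrow> h < l1 \<Longrightarrow> ?cut N h \<Longrightarrow> P N h"
    unfolding eventually_at_right_field by blast
  have f_nonneg: "0 \<le> f\<^sub>0 x v" for x v
    using f(3)[of v x] pos by (meson exp_ge_zero less_imp_le mult_nonneg_nonneg order_trans)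
  obtain l2 where l2: "0 < l2" "\<And>(N\<^sub>x::nat) (N\<^sub>v::nat) (\<Delta>x::real) (\<Delta>v::real).
      0 < \<Delta>x \<and> 0 < \<Delta>v \<and> real N\<^sub>x * \<Delta>x = 1 \<and> \<Delta>x < l2 \<and> \<Delta>v < l2 \<Longrightarrow>
      (\<Sum>i\<in>I_x N\<^sub>x. \<Sum>j\<in>I_v N\<^sub>v. f\<^sub>0 (xg \<Delta>x i) (vg \<Delta>v j) * \<Delta>x * \<Delta>v) \<le> 2"
    using initial_mass_le_2[OF _ f(1,2) f_nonneg mass] q unfolding I_x_def I_v_def xg_def vg_def by auto
  have "mesh_small q \<alpha> \<gamma> \<epsilon> T\<^sub>f f\<^sub>0 (min l1 l2)"
    unfolding mesh_small_def E_def[symmetric] \<beta>_def[symmetric]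
  proof (intro allI impI, elim conjE)
    fix N\<^sub>x N\<^sub>v :: nat and \<Delta>x \<Delta>v :: real
    assume a: "0 < \<Delta>x" "0 < \<Delta>v" "real N\<^sub>x * \<Delta>x = 1" "?cut N\<^sub>v \<Delta>v" "\<Delta>x < min l1 l2" "\<Delta>v < min l1 l2"
    have "P N\<^sub>v \<Delta>v" using a by (intro l1(2)) auto
    moreover have "(\<Sum>i\<in>I_x N\<^sub>x. \<Sum>j\<in>I_v N\<^sub>v. f\<^sub>0 (xg \<Delta>x i) (vg \<Delta>v j) * \<Delta>x * \<Delta>v) \<le> 2"
      using a by (intro l2(2)) auto
    ultimately show "(\<forall>(a, b)\<in>{(\<alpha>, \<beta>), (2, 0)}.
          (\<Sum>j\<in>I_v N\<^sub>v. exp (- (\<bar>vg \<Delta>v j\<bar> powr a) - b * \<bar>vg \<Delta>v j\<bar>) * \<Delta>v) \<in> {D_int a b / 2 .. 2 * D_int a b} \<and>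
          (SUP j\<in>I_v N\<^sub>v. (1 + \<bar>vg \<Delta>v j\<bar>) powr q * exp (- (\<bar>vg \<Delta>v j\<bar> powr a) - b * \<bar>vg \<Delta>v j\<bar>))
            \<in> {D_sup q a b / 2 .. 2 * D_sup q a b}) \<and>
        (\<forall>m\<in>{0, 1, 2}. (\<Sum>j\<in>I_v N\<^sub>v. \<Delta>v / (1 + \<bar>vg \<Delta>v j\<bar>) powr (q - m)) \<in> {D_bar (q - m) / 2 .. 2 * D_bar (q - m)}) \<and>
        (\<Sum>i\<in>I_x N\<^sub>x. \<Sum>j\<in>I_v N\<^sub>v. f\<^sub>0 (xg \<Delta>x i) (vg \<Delta>v j) * \<Delta>x * \<Delta>v) \<le> 2"
      unfolding P_def by blast
  qed
  moreover have "0 < min l1 l2" using l1(1) l2(1) by simp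
  ultimately show ?thesis by blast
qed

theorem theorem4p4:
  fixes q :: real
  assumes "q > 3"
  shows "\<exists>C_M C_Max :: real. 0 < C_M \<and> 0 < C_Max \<and>
    (\<forall>(\<alpha>::real) (\<gamma>::real) (\<eta>\<^sub>1::real) (\<eta>\<^sub>2::real) (\<epsilon>::real) (T\<^sub>f::real) (C\<^sub>0::real)
        (f\<^sub>0 :: real \<Rightarrow> real \<Rightarrow> real).
       1 \<le> \<alpha> \<and> \<alpha> \<le> 2 \<and> 1/2 \<le> \<gamma> \<and> \<gamma> < 1 \<and> 0 < \<eta>\<^sub>1 \<and> \<eta>\<^sub>1 < \<eta>\<^sub>2 \<and> \<eta>\<^sub>2 < 1 \<and>
       0 < \<epsilon> \<and> 0 < T\<^sub>f \<and> 0 < C\<^sub>0 \<and>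
       periodic_x f\<^sub>0 \<and> C_k 2 f\<^sub>0 \<and> W_norm 2 q f\<^sub>0 < \<infinity> \<and>
       (LINT x:{0..1}|lborel. (LINT v|lborel. f\<^sub>0 x v)) = 1 \<and>
       (\<forall>x v. f\<^sub>0 x v \<ge> C\<^sub>0 * exp (- (\<bar>v\<bar> powr \<alpha>)))
       \<longrightarrow>
       (\<exists>l>0. mesh_small q \<alpha> \<gamma> \<epsilon> T\<^sub>f f\<^sub>0 l) \<and>
       (\<forall>l>0. mesh_small q \<alpha> \<gamma> \<epsilon> T\<^sub>f f\<^sub>0 l \<longrightarrow>
         (\<forall>(N\<^sub>x::nat) (N\<^sub>v::nat) (N\<^sub>t::nat) (\<Delta>x::real) (\<Delta>v::real) (\<Delta>t::real) (V_M::real).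
            0 < \<Delta>x \<and> 0 < \<Delta>v \<and> 0 < \<Delta>t \<and>
            real N\<^sub>x * \<Delta>x = 1 \<and> real N\<^sub>v * \<Delta>v = V_M \<and> real N\<^sub>t * \<Delta>t = T\<^sub>f \<and>
            V_M = C_E1 \<epsilon> T\<^sub>f * \<Delta>v powr (- \<gamma>) \<and>
            \<Delta>x < r_x \<alpha> \<epsilon> T\<^sub>f l \<and>
            \<Delta>v < r_v q \<alpha> \<gamma> \<eta>\<^sub>1 \<eta>\<^sub>2 \<epsilon> T\<^sub>f C\<^sub>0 f\<^sub>0 C_M C_Max l \<Delta>x \<and>
            \<eta>\<^sub>1 * (\<Delta>v / C_E1 \<epsilon> T\<^sub>f) < \<Delta>t \<and> \<Delta>t < \<eta>\<^sub>2 * (\<Delta>v / C_E1 \<epsilon> T\<^sub>f)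
            \<longrightarrow>
            (\<forall>n\<le>N\<^sub>t. stability q \<alpha> \<eta>\<^sub>1 \<epsilon> T\<^sub>f C\<^sub>0 f\<^sub>0 C_M C_Max N\<^sub>x N\<^sub>v \<Delta>x \<Delta>v \<Delta>t
                      (sol \<epsilon> f\<^sub>0 N\<^sub>x N\<^sub>v \<Delta>x \<Delta>v \<Delta>t n)))))"
proof (rule exI[of _ 1000], rule exI[of _ "maxwellian_const q"], intro conjI allI impI, goal_cases)
  case 1
  show ?case by simp
next
  case 2
  show ?case using maxwellian_const_ge_1[OF assms] by linarith
next
  case (3 \<alpha> \<gamma> \<eta>\<^sub>1 \<eta>\<^sub>2 \<epsilon> T\<^sub>f C\<^sub>0 f\<^sub>0)
  have "0 < \<gamma>" using 3 by linarith
  with 3 show ?case using assms by (intro mesh_small_exists[where C\<^sub>0 = C\<^sub>0]) simp_all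
next
  case (4 \<alpha> \<gamma> \<eta>\<^sub>1 \<eta>\<^sub>2 \<epsilon> T\<^sub>f C\<^sub>0 f\<^sub>0 l N\<^sub>x N\<^sub>v N\<^sub>t \<Delta>x \<Delta>v \<Delta>t V_M n)
  have "Linf_norm q f\<^sub>0 < \<infinity>" using 4(1) W_norm_finite_Linf_norm(1) by blast
  moreover have "real N\<^sub>v * \<Delta>v = C_E1 \<epsilon> T\<^sub>f * \<Delta>v powr (- \<gamma>)" using 4(4) by metis
  ultimately interpret bgk_scheme q \<alpha> \<gamma> \<eta>\<^sub>1 \<eta>\<^sub>2 \<epsilon> T\<^sub>f C\<^sub>0 f\<^sub>0 l N\<^sub>x N\<^sub>v N\<^sub>t \<Delta>x \<Delta>v \<Delta>t
    using 4 assms by unfold_locales blast+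
  show ?case using 4(5) by (rule stability_sol)
qed

end
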